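(* Let $\mathcal{H}$ be a complex Hilbert space and let $v_1,v_2\in\mathcal{H}$ be linearly independent with $\operatorname{Im}\langle v_1,v_2\rangle\neq 0$. Let $X_1=l(v_1)+l(v_1)^*$, $X_2=r(v_2)+r(v_2)^*$ and $T=X_1+iX_2$, acting on the reducing subspace $\overline{\operatorname{alg}(T,T^*,1)\Omega}$ of the full Fock space $\mathcal{F}(\mathcal{H})$. For $t\in[-2,2]$ put $\zeta(t)=\frac{t-i\sqrt{4-t^2}}{2}$, which has modulus $1$. Write $\frac{\langle v_1,v_2\rangle}{\|v_1\|\|v_2\|}=re^{i\phi}$ with $0<r<1$ and $\phi\in\mathbb{R}$. Then the principal function $g$ of $T$ is given, for (almost every) $(\delta,\gamma)\in\mathbb{R}^2$ with $|\gamma|\le 2\|v_1\|$ and $|\delta|\le 2\|v_2\|$, by $$g(\delta,\gamma)=\frac1\pi\Big(\operatorname{Arg}(1-re^{i(-\phi+\theta_1+\theta_2)})+\operatorname{Arg}(1-re^{i(\phi-\theta_1+\theta_2)})-\operatorname{Arg}(1-re^{i(\phi+\theta_1+\theta_2)})-\operatorname{Arg}(1-re^{i(-\phi-\theta_1+\theta_2)})\Big),$$ where $\theta_1,\theta_2\in[-\pi,0]$ are determined by $e^{i\theta_1}=\zeta(\gamma/\|v_1\|)$ and $e^{i\theta_2}=\zeta(\delta/\|v_2\|)$, and $\operatorname{Arg}$ is the principal argument. Equivalently, $$g(\delta,\gamma)=\frac1\pi\Big(\arctan\tfrac{r\sin(\phi-(\theta_1+\theta_2))}{1-r\cos(\p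hi-(\theta_1+\theta_2))}+\arctan\tfrac{r\sin(\phi+(\theta_1+\theta_2))}{1-r\cos(\phi+(\theta_1+\theta_2))}-\arctan\tfrac{r\sin(\phi-(\theta_1-\theta_2))}{1-r\cos(\phi-(\theta_1-\theta_2))}-\arctan\tfrac{r\sin(\phi+(\theta_1-\theta_2))}{1-r\cos(\phi+(\theta_1-\theta_2))}\Big).$$
   Context: Inner products are linear in the first variable. The full Fock space on $\mathcal{H}$ is $\mathcal{F}(\mathcal{H})=\mathbb{C}\Omega\oplus\bigoplus_{n\ge1}\mathcal{H}^{\otimes n}$, with $\Omega$ a unit vector (the vacuum vector). For $\xi\in\mathcal{H}$, the left creation operator $l(\xi)\in B(\mathcal{F}(\mathcal{H}))$ is given by $l(\xi)\Omega=\xi$, $l(\xi)(\xi_1\otimes\cdots\otimes\xi_n)=\xi\otimes\xi_1\otimes\cdots\otimes\xi_n$, and the right creation operator $r(\xi)$ by $r(\xi)\Omega=\xi$, $r(\xi)(\xi_1\otimes\cdots\otimes\xi_n)=\xi_1\otimes\cdots\otimes\xi_n\otimes\xi$. $\operatorname{alg}(T,T^*,1)$ is the unital algebra generated by $T$ and $T^*$. An operator is completely non-normal if it has no nonzero reducing subspace on which its restriction is normal; $T$ restricted to $\overline{\operatorname{alg}(T,T^*,1)\Omega}$ is completely non-normal, with self-commutator of rank one. Principal function: let $T$ be a completely non-normal bounded operator with trace class self-commutator $T^*T-TT^*=-2C$. Put $U=\frac12(T+T^* )$, $V=-\frac i2(T-T^* )$, and let $\hat C$ be obtained from the self-adjoint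 operator $C$ by continuous functional calculus with the function equal to $-i\sqrt{-t}$ for $t<0$, $0$ for $t=0$, $\sqrt t$ for $t>0$ (so $\hat C^2=C$). The determining function is $E(l,s)=I+\frac1i\hat C(V-l)^{-1}(U-s)^{-1}\hat C$ for $l\in\mathbb{C}\setminus\sigma(V)$, $s\in\mathbb{C}\setminus\sigma(U)$. The principal function of $T$ is the element $g\in L^1(\mathbb{R}^2)$ (determined up to a.e. equality) such that for all such $l,s$ $$\det E(l,s)=\exp\left(\frac1{2\pi i}\iint g(\delta,\gamma)\frac{d\delta}{\delta-l}\frac{d\gamma}{\gamma-s}\right),$$ where $\det$ is the Fredholm determinant; its support is contained in $\{(\delta,\gamma)\in\mathbb{R}^2 : \gamma+i\delta\in\sigma(T)\}$. *)

theory Defs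
  imports "HOL-Analysis.Analysis" "HOL-Computational_Algebra.Polynomial"
begin

section \<open>Complex Hilbert spaces\<close>

text \<open>A complex Hilbert space is a real Hilbert space (whose norm, topology and real inner product
  come from the library) with a compatible complex structure; the real inner product is the real
  part of the complex one. The complex inner product is linear in the first variable. It follows
  that the squared norm of \<open>x\<close> is \<open>cinner x x\<close>.\<close>

class chilbert_space = real_inner + complete_space +
  fixes scaleC :: "complex \<Rightarrow> 'a \<Rightarrow> 'a" (infixr "*\<^sub>C" 75)
    and cinner :: "'a \<Rightarrow> 'a \<Rightarrow> complex"
  assumes scaleC_add_right: "c *\<^sub>C (x + y) = c *\<^sub>C x + c *\<^sub>C y"
    and scaleC_add_left: "(c + d) *\<^sub>C x = c *\<^sub>C x + d *\<^sub>C x"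
    and scaleC_scaleC: "c *\<^sub>C (d *\<^sub>C x) = (c * d) *\<^sub>C x"
    and scaleR_scaleC: "r *\<^sub>R x = complex_of_real r *\<^sub>C x"
    and cinner_commute: "cinner x y = cnj (cinner y x)"
    and cinner_add_left: "cinner (x + y) z = cinner x z + cinner y z"
    and cinner_scaleC_left: "cinner (c *\<^sub>C x) y = c * cinner x y"
    and Re_cinner: "Re (cinner x y) = inner x y"

definition csubspace :: "'a::chilbert_space set \<Rightarrow> bool" where
  "csubspace M \<longleftrightarrow> 0 \<in> M \<and> (\<forall>x\<in>M. \<forall>y\<in>M. x + y \<in> M) \<and> (\<forall>c. \<forall>x\<in>M. c *\<^sub>C x \<in> M)"

definition closed_csubspace :: "'a::chilbert_space set \<Rightarrow> bool" where
  "closed_csubspace M \<longleftrightarrow> csubspace M \<and> closed M"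

definition orthonormal_basis :: "'a::chilbert_space set \<Rightarrow> 'a set \<Rightarrow> bool" where
  "orthonormal_basis M B \<longleftrightarrow>
     B \<subseteq> M \<and> (\<forall>e\<in>B. \<forall>f\<in>B. cinner e f = (if e = f then 1 else 0)) \<and>
     closure (csubspace hull B) = M"


section \<open>Bounded operators on a closed subspace\<close>

text \<open>The Hilbert spaces on which operators act are closed subspaces \<open>M\<close> of an ambient Hilbert
  space (the whole space is \<open>M = UNIV\<close>). An operator on \<open>M\<close> is a function that is
  extensional on \<open>M\<close>, so that equality of operators on \<open>M\<close> is equality of functions.\<close>

definition bounded_ops :: "'a::chilbert_space set \<Rightarrow> ('a \<Rightarrow> 'a) set" where
  "bounded_ops M = {A \<in> M \<rightarrow>\<^sub>E M.
     (\<forall>x\<in>M. \<forall>y\<in>M. A (x + y) = A x + A y) \<and>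
     (\<forall>c. \<forall>x\<in>M. A (c *\<^sub>C x) = c *\<^sub>C A x) \<and>
     (\<exists>K. \<forall>x\<in>M. norm (A x) \<le> K * norm x)}"

definition cadjoint :: "'a::chilbert_space set \<Rightarrow> ('a \<Rightarrow> 'a) \<Rightarrow> 'a \<Rightarrow> 'a" where
  "cadjoint M A =
     (THE B. B \<in> bounded_ops M \<and> (\<forall>x\<in>M. \<forall>y\<in>M. cinner (A x) y = cinner x (B y)))"

definition spectrum :: "'a::chilbert_space set \<Rightarrow> ('a \<Rightarrow> 'a) \<Rightarrow> complex set" where
  "spectrum M A = {z. \<not> (\<exists>B\<in>bounded_ops M. \<forall>x\<in>M.
     B (A x - z *\<^sub>C x) = x \<and> A (B x) - z *\<^sub>C B x = x)}"

definition resolvent :: "'a::chilbert_space set \<Rightarrow> ('a \<Rightarrow> 'a) \<Rightarrow> complex \<Rightarrow> 'a \<Rightarrow> 'a" where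
  "resolvent M A z = inv_into M (\<lambda>x. A x - z *\<^sub>C x)"

definition normal_op :: "'a::chilbert_space set \<Rightarrow> ('a \<Rightarrow> 'a) \<Rightarrow> bool" where
  "normal_op M A \<longleftrightarrow> (\<forall>x\<in>M. cadjoint M A (A x) = A (cadjoint M A x))"

definition reducing_subspace :: "'a::chilbert_space set \<Rightarrow> ('a \<Rightarrow> 'a) \<Rightarrow> 'a set \<Rightarrow> bool" where
  "reducing_subspace M A N \<longleftrightarrow>
     closed_csubspace N \<and> N \<subseteq> M \<and> A ` N \<subseteq> N \<and> cadjoint M A ` N \<subseteq> N"

definition completely_non_normal :: "'a::chilbert_space set \<Rightarrow> ('a \<Rightarrow> 'a) \<Rightarrow> bool" where
  "completely_non_normal M A \<longleftrightarrow>
     (\<forall>N. reducing_subspace M A N \<and> normal_op N (restrict A N) \<longrightarrow> N = {0})"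


section \<open>Continuous functional calculus, trace class, Fredholm determinant\<close>

definition poly_op :: "complex poly \<Rightarrow> ('a::chilbert_space \<Rightarrow> 'a) \<Rightarrow> 'a \<Rightarrow> 'a" where
  "poly_op p A x = (\<Sum>i\<le>degree p. coeff p i *\<^sub>C (A ^^ i) x)"

text \<open>For self-adjoint \<open>A\<close> (so that the spectrum is real), \<open>f(A)\<close> is the operator norm limit of
  \<open>p\<^sub>n(A)\<close> for polynomials \<open>p\<^sub>n\<close> converging to \<open>f\<close> uniformly on the spectrum. Convergence in
  operator norm is uniform convergence on the unit ball.\<close>

definition cont_fun_calc ::
    "'a::chilbert_space set \<Rightarrow> (real \<Rightarrow> complex) \<Rightarrow> ('a \<Rightarrow> 'a) \<Rightarrow> 'a \<Rightarrow> 'a" where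
  "cont_fun_calc M f A = (THE B. B \<in> bounded_ops M \<and>
     (\<forall>p :: nat \<Rightarrow> complex poly.
        uniform_limit {t. complex_of_real t \<in> spectrum M A}
          (\<lambda>n t. poly (p n) (complex_of_real t)) f sequentially \<longrightarrow>
        uniform_limit {x\<in>M. norm x \<le> 1} (\<lambda>n. poly_op (p n) A) B sequentially))"

definition abs_op :: "'a::chilbert_space set \<Rightarrow> ('a \<Rightarrow> 'a) \<Rightarrow> 'a \<Rightarrow> 'a" where
  "abs_op M K = cont_fun_calc M (\<lambda>t. complex_of_real (sqrt t)) (\<lambda>x\<in>M. cadjoint M K (K x))"

definition trace_class :: "'a::chilbert_space set \<Rightarrow> ('a \<Rightarrow> 'a) \<Rightarrow> bool" where
  "trace_class M K \<longleftrightarrow> K \<in> bounded_ops M \<and>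
     (\<forall>B. orthonormal_basis M B \<longrightarrow> (\<lambda>e. cinner (abs_op M K e) e) summable_on B)"

text \<open>The determinant of the matrix of \<open>K\<close> with respect to a finite orthonormal set \<open>S\<close>; it is the
  diagonal matrix entry of the exterior power of \<open>K\<close> at the wedge product of the elements of \<open>S\<close>.\<close>

definition principal_minor :: "('a::chilbert_space \<Rightarrow> 'a) \<Rightarrow> 'a set \<Rightarrow> complex" where
  "principal_minor K S =
     (\<Sum>\<pi> | \<pi> permutes S. of_int (sign \<pi>) * (\<Prod>e\<in>S. cinner (K e) (\<pi> e)))"

text \<open>Trace of the \<open>k\<close>-th exterior power of a trace class operator \<open>K\<close>, computed in the
  orthonormal basis of \<open>k\<close>-fold wedge products of elements of an orthonormal basis \<open>B\<close> of \<open>M\<close>;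
  the value does not depend on \<open>B\<close>.\<close>

definition trace_ext_power ::
    "'a::chilbert_space set \<Rightarrow> nat \<Rightarrow> ('a \<Rightarrow> 'a) \<Rightarrow> complex" where
  "trace_ext_power M k K = (THE d. \<forall>B. orthonormal_basis M B \<longrightarrow>
     (principal_minor K has_sum d) {S. S \<subseteq> B \<and> finite S \<and> card S = k})"

text \<open>\<open>det(I + K)\<close> is the sum over \<open>k\<close> of the traces of the \<open>k\<close>-th exterior powers of \<open>K\<close>.\<close>

definition fredholm_det :: "'a::chilbert_space set \<Rightarrow> ('a \<Rightarrow> 'a) \<Rightarrow> complex" where
  "fredholm_det M A = (\<Sum>k. trace_ext_power M k (\<lambda>x\<in>M. A x - x))"


section \<open>Determining function and principal function\<close>

definition real_part_op :: "'a::chilbert_space set \<Rightarrow> ('a \<Rightarrow> 'a) \<Rightarrow> 'a \<Rightarrow> 'a" where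
  "real_part_op M T = (\<lambda>x\<in>M. (1/2) *\<^sub>C (T x + cadjoint M T x))"

definition imag_part_op :: "'a::chilbert_space set \<Rightarrow> ('a \<Rightarrow> 'a) \<Rightarrow> 'a \<Rightarrow> 'a" where
  "imag_part_op M T = (\<lambda>x\<in>M. (- \<i>/2) *\<^sub>C (T x - cadjoint M T x))"

definition self_commutator :: "'a::chilbert_space set \<Rightarrow> ('a \<Rightarrow> 'a) \<Rightarrow> 'a \<Rightarrow> 'a" where
  "self_commutator M T = (\<lambda>x\<in>M. cadjoint M T (T x) - T (cadjoint M T x))"

text \<open>The self-adjoint operator \<open>C\<close> with \<open>T\<^sup>*T - TT\<^sup>* = -2C\<close>.\<close>

definition C_op :: "'a::chilbert_space set \<Rightarrow> ('a \<Rightarrow> 'a) \<Rightarrow> 'a \<Rightarrow> 'a" where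
  "C_op M T = (\<lambda>x\<in>M. (- 1/2) *\<^sub>C self_commutator M T x)"

definition signed_root :: "real \<Rightarrow> complex" where
  "signed_root t =
     (if t < 0 then - \<i> * complex_of_real (sqrt (- t)) else complex_of_real (sqrt t))"

definition C_hat :: "'a::chilbert_space set \<Rightarrow> ('a \<Rightarrow> 'a) \<Rightarrow> 'a \<Rightarrow> 'a" where
  "C_hat M T = cont_fun_calc M signed_root (C_op M T)"

definition determining_function ::
    "'a::chilbert_space set \<Rightarrow> ('a \<Rightarrow> 'a) \<Rightarrow> complex \<Rightarrow> complex \<Rightarrow> 'a \<Rightarrow> 'a" where
  "determining_function M T l s = (\<lambda>x\<in>M. x + (1/\<i>) *\<^sub>C
     C_hat M T (resolvent M (imag_part_op M T) l (resolvent M (real_part_op M T) s (C_hat M T x))))"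

text \<open>\<open>g\<close> is (a Borel representative of) the principal function of the operator \<open>T\<close> on the
  Hilbert space \<open>M\<close>; the arguments of \<open>g\<close> are \<open>(\<delta>, \<gamma>)\<close>, where \<open>\<delta>\<close> belongs to the imaginary part
  of \<open>T\<close> and \<open>\<gamma>\<close> to the real part. Integrability is demanded because the integral
  of a non-integrable function is \<open>0\<close> by convention.\<close>

definition principal_function ::
    "'a::chilbert_space set \<Rightarrow> ('a \<Rightarrow> 'a) \<Rightarrow> (real \<times> real \<Rightarrow> real) \<Rightarrow> bool" where
  "principal_function M T g \<longleftrightarrow>
     closed_csubspace M \<and> T \<in> bounded_ops M \<and> completely_non_normal M T \<and>
     trace_class M (self_commutator M T) \<and>
     integrable lborel g \<and>
     (\<forall>l s. l \<notin> spectrum M (imag_part_op M T) \<longrightarrow> s \<notin> spectrum M (real_part_op M T) \<longrightarrow>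
        integrable lborel (\<lambda>(\<delta>, \<gamma>). complex_of_real (g (\<delta>, \<gamma>)) / ((\<delta> - l) * (\<gamma> - s))) \<and>
        fredholm_det M (determining_function M T l s) =
          exp (1 / (2 * pi * \<i>) *
            (LINT (\<delta>, \<gamma>)|lborel. complex_of_real (g (\<delta>, \<gamma>)) / ((\<delta> - l) * (\<gamma> - s)))))"


section \<open>The full Fock space\<close>

text \<open>A full Fock space over \<open>'h\<close> is a Hilbert space \<open>'f\<close> with a map \<open>tens\<close> sending a list
  \<open>[\<xi>\<^sub>1, \<dots>, \<xi>\<^sub>n]\<close> to the elementary tensor of its elements, where the empty list goes to the
  vacuum vector. The inner product formula says that tensors of different degrees are orthogonal and
  that the closed span of those of degree \<open>n\<close> is the \<open>n\<close>-th Hilbert space tensor power;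
  multilinearity of \<open>tens\<close> follows from it, and any two full Fock spaces over \<open>'h\<close> are related by a
  unique unitary that respects elementary tensors.\<close>

definition full_fock_space :: "('h::chilbert_space list \<Rightarrow> 'f::chilbert_space) \<Rightarrow> bool" where
  "full_fock_space tens \<longleftrightarrow>
     (\<forall>xs ys. cinner (tens xs) (tens ys) =
        (if length xs = length ys then \<Prod>i<length xs. cinner (xs ! i) (ys ! i) else 0)) \<and>
     closure (csubspace hull (range tens)) = UNIV"

definition left_creation ::
    "('h::chilbert_space list \<Rightarrow> 'f::chilbert_space) \<Rightarrow> 'h \<Rightarrow> 'f \<Rightarrow> 'f" where
  "left_creation tens \<xi> =
     (THE A. A \<in> bounded_ops UNIV \<and> (\<forall>xs. A (tens xs) = tens (\<xi> # xs)))"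

definition right_creation ::
    "('h::chilbert_space list \<Rightarrow> 'f::chilbert_space) \<Rightarrow> 'h \<Rightarrow> 'f \<Rightarrow> 'f" where
  "right_creation tens \<xi> =
     (THE A. A \<in> bounded_ops UNIV \<and> (\<forall>xs. A (tens xs) = tens (xs @ [\<xi>])))"

inductive_set unital_alg :: "('a::chilbert_space \<Rightarrow> 'a) set \<Rightarrow> ('a \<Rightarrow> 'a) set"
  for G :: "('a \<Rightarrow> 'a) set" where
  one: "(\<lambda>x. x) \<in> unital_alg G"
| gen: "A \<in> G \<Longrightarrow> A \<in> unital_alg G"
| add: "A \<in> unital_alg G \<Longrightarrow> B \<in> unital_alg G \<Longrightarrow> (\<lambda>x. A x + B x) \<in> unital_alg G"
| scale: "A \<in> unital_alg G \<Longrightarrow> (\<lambda>x. c *\<^sub>C A x) \<in> unital_alg G"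
| mult: "A \<in> unital_alg G \<Longrightarrow> B \<in> unital_alg G \<Longrightarrow> (\<lambda>x. A (B x)) \<in> unital_alg G"


section \<open>The parametrization of the square\<close>

definition zeta :: "real \<Rightarrow> complex" where
  "zeta t = (complex_of_real t - \<i> * complex_of_real (sqrt (4 - t\<^sup>2))) / 2"

definition theta :: "real \<Rightarrow> real" where
  "theta t = (THE \<theta>. - pi \<le> \<theta> \<and> \<theta> \<le> 0 \<and> exp (\<i> * complex_of_real \<theta>) = zeta t)"

end

(* The commutator [X1, X2] is -2i Im<v1, v2> times the projection onto the vacuum, so C is a rank one
operator and the Fredholm determinant of E(l, s) is 1 plus a multiple of
<(V - l)^{-1} (U - s)^{-1} Omega, Omega>. On the vacuum, X1 and X2 act as Jacobi matrices with
constant entries in the orthonormal systems of normalized tensor powers of v1 and of v2. Writing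
s = |v1| (w + 1/w) and l = |v2| (z + 1/z) with |w|, |z| < 1, the resolvents applied to the vacuum are
geometric series, and det E(l, s) = (1 - w z conj(c)) / (1 - w z c) with
c = <v1, v2> / (|v1| |v2|) = r e^(i phi). The logarithm is the power series of
2i (sum over n) r^n sin(n phi) (w z)^n / n, and (w z)^n is up to a constant the double Cauchy transform
of sin(n theta1) sin(n theta2); summing gives g. Uniqueness of g follows from Poisson kernels. *)

theory Submission
  imports Defs
begin

section \<open>Hilbert space geometry\<close>

text \<open>The determinant identity is demanded at every pair outside the two spectra, yet those
  spectra are never computed. If s lies outside, the resolvent vector at the vacuum has coefficients
  along the orthonormal system that tend to 0 and obey a three-term recurrence; this alone forces s
  = |v1| (w + 1/w) with |w| < 1. The same recurrence lemma evaluates the Cauchy transforms of the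
  sines. Adjoints, creation operators, functional calculus and traces of exterior powers are
  definite descriptions, so each has to be evaluated at a concrete operator together with a proof of
  uniqueness. For multiples of the vacuum projection this can be done by hand. The product of
  resolvents is handled by moving the one at l across the inner product to cnj l; then two geometric
  series starting at the vacuum are paired. For uniqueness only exponentials of integrals are given,
  so the integer ambiguity of the logarithm must be excluded before Poisson kernels can be
  used.\<close>

instance chilbert_space \<subseteq> banach ..

lemma scaleC_one [simp]: "1 *\<^sub>C (x::'a::chilbert_space) = x"
  using scaleR_scaleC[of 1 x] by simp

lemma scaleC_zero_left [simp]: "0 *\<^sub>C (x::'a::chilbert_space) = 0"
  using scaleR_scaleC[of 0 x] by simp

lemma scaleC_zero_right [simp]: "c *\<^sub>C (0::'a::chilbert_space) = 0"
  using scaleC_add_right[of c 0 0] by simp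

lemma scaleC_minus_left [simp]: "(- c) *\<^sub>C (x::'a::chilbert_space) = - (c *\<^sub>C x)"
  using scaleC_add_left[of c "-c" x] by (simp add: eq_neg_iff_add_eq_0 add.commute)

lemma scaleC_minus_right [simp]: "c *\<^sub>C (- x::'a::chilbert_space) = - (c *\<^sub>C x)"
  using scaleC_add_right[of c x "-x"] by (simp add: eq_neg_iff_add_eq_0 add.commute)

lemma scaleC_diff_right: "c *\<^sub>C (x - y::'a::chilbert_space) = c *\<^sub>C x - c *\<^sub>C y"
  using scaleC_add_right[of c x "- y"] by simp

lemma scaleC_diff_left: "(c - d) *\<^sub>C (x::'a::chilbert_space) = c *\<^sub>C x - d *\<^sub>C x"
  using scaleC_add_left[of c "- d" x] by simp

lemma scaleC_sum_right: "c *\<^sub>C (\<Sum>i\<in>S. f i) = (\<Sum>i\<in>S. c *\<^sub>C (f i :: 'a::chilbert_space))"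
  by (induction S rule: infinite_finite_induct) (auto simp: scaleC_add_right)

lemma cinner_add_right: "cinner x (y + z) = cinner x y + cinner x (z::'a::chilbert_space)"
  by (metis cinner_add_left cinner_commute complex_cnj_add)

lemma cinner_scaleC_right: "cinner x (c *\<^sub>C y) = cnj c * cinner x (y::'a::chilbert_space)"
  by (metis cinner_commute cinner_scaleC_left complex_cnj_mult)

lemma cinner_zero_left [simp]: "cinner 0 (y::'a::chilbert_space) = 0"
  using cinner_add_left[of 0 0 y] by simp

lemma cinner_zero_right [simp]: "cinner (y::'a::chilbert_space) 0 = 0"
  using cinner_add_right[of y 0 0] by simp

lemma cinner_minus_left [simp]: "cinner (- x) y = - cinner x (y::'a::chilbert_space)"
  using cinner_add_left[of x "-x" y] by (simp add: eq_neg_iff_add_eq_0 add.commute)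

lemma cinner_minus_right [simp]: "cinner x (- y) = - cinner x (y::'a::chilbert_space)"
  using cinner_add_right[of x y "- y"] by (simp add: eq_neg_iff_add_eq_0 add.commute)

lemma cinner_diff_left: "cinner (x - y) z = cinner x z - cinner y (z::'a::chilbert_space)"
  using cinner_add_left[of x "- y" z] by simp

lemma cinner_diff_right: "cinner x (y - z) = cinner x y - cinner x (z::'a::chilbert_space)"
  using cinner_add_right[of x y "- z"] by simp

lemma cinner_sum_left: "cinner (\<Sum>i\<in>S. f i) y = (\<Sum>i\<in>S. cinner (f i) (y::'a::chilbert_space))"
  by (induction S rule: infinite_finite_induct) (auto simp: cinner_add_left)

lemma cinner_sum_right: "cinner y (\<Sum>i\<in>S. f i) = (\<Sum>i\<in>S. cinner (y::'a::chilbert_space) (f i))"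
  by (induction S rule: infinite_finite_induct) (auto simp: cinner_add_right)

lemmas cinner_simps = cinner_add_left cinner_add_right cinner_diff_left cinner_diff_right
  cinner_scaleC_left cinner_scaleC_right

lemma cinner_self: "cinner x x = complex_of_real ((norm (x::'a::chilbert_space))\<^sup>2)"
proof -
  have "Im (cinner x x) = 0"
    using cinner_commute[of x x] by (simp add: complex_eq_iff)
  then show ?thesis
    by (simp add: complex_eq_iff Re_cinner power2_norm_eq_inner)
qed

lemma cinner_self_eq_0 [simp]: "cinner x x = 0 \<longleftrightarrow> (x::'a::chilbert_space) = 0"
  by (simp add: cinner_self)

lemma norm_scaleC: "norm (c *\<^sub>C (x::'a::chilbert_space)) = cmod c * norm x"
proof -
  have "complex_of_real ((norm (c *\<^sub>C x))\<^sup>2) = (c * cnj c) * cinner x x"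
    by (simp only: cinner_self[symmetric] cinner_simps mult_ac)
  also have "\<dots> = complex_of_real ((cmod c * norm x)\<^sup>2)"
    by (simp only: complex_norm_square[symmetric] cinner_self power_mult_distrib of_real_mult of_real_power)
  finally show ?thesis
    by (metis of_real_eq_iff norm_ge_zero mult_nonneg_nonneg power2_eq_iff_nonneg)
qed

text \<open>Multiplying \<open>x\<close> by a unimodular constant makes the inner product real and
  nonnegative, which reduces the claim to the real Cauchy-Schwarz inequality.\<close>

lemma norm_cinner_le: "cmod (cinner x y) \<le> norm x * norm (y::'a::chilbert_space)"
proof (cases "cinner x y = 0")
  case False
  define c where "c = cnj (cinner x y) / cmod (cinner x y)"
  have c: "cmod c = 1" using False by (simp add: c_def norm_divide)
  have "c * cinner x y = (cinner x y * cnj (cinner x y)) / cmod (cinner x y)"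
    by (simp add: c_def)
  also have "\<dots> = complex_of_real (cmod (cinner x y))"
    unfolding complex_norm_square[symmetric] using False by (simp add: power2_eq_square)
  finally have "cmod (cinner x y) = inner (c *\<^sub>C x) y"
    by (metis Re_cinner Re_complex_of_real cinner_scaleC_left)
  also have "\<dots> \<le> norm (c *\<^sub>C x) * norm y" by (rule norm_cauchy_schwarz)
  finally show ?thesis by (simp add: norm_scaleC c)
qed auto

lemma bounded_linear_scaleC: "bounded_linear (\<lambda>x::'a::chilbert_space. c *\<^sub>C x)"
  by (rule bounded_linear_intro[where K="cmod c"])
    (simp_all add: scaleC_add_right scaleR_scaleC scaleC_scaleC mult.commute norm_scaleC)

lemma bounded_linear_cinner_left: "bounded_linear (\<lambda>x::'a::chilbert_space. cinner x y)"
  by (rule bounded_linear_intro[where K="norm y"])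
    (simp_all add: cinner_simps scaleR_scaleC scaleR_conv_of_real norm_cinner_le)

lemma bounded_linear_cinner_right: "bounded_linear (\<lambda>x::'a::chilbert_space. cinner y x)"
  by (rule bounded_linear_intro[where K="norm y"])
    (simp_all add: cinner_simps scaleR_scaleC scaleR_conv_of_real,
      metis mult.commute norm_cinner_le)

lemmas continuous_on_scaleC [continuous_intros] =
  bounded_linear.continuous_on[OF bounded_linear_scaleC]
lemmas continuous_on_cinner_left [continuous_intros] =
  bounded_linear.continuous_on[OF bounded_linear_cinner_left]
lemmas continuous_on_cinner_right [continuous_intros] =
  bounded_linear.continuous_on[OF bounded_linear_cinner_right]
lemmas tendsto_scaleC = bounded_linear.tendsto[OF bounded_linear_scaleC]

section \<open>Complex subspaces, their hulls and closures\<close>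

lemma csubspace_Inter: "(\<And>M. M \<in> \<M> \<Longrightarrow> csubspace M) \<Longrightarrow> csubspace (\<Inter>\<M>)"
  by (auto simp: csubspace_def)

lemma csubspace_hull: "csubspace (csubspace hull S)"
  unfolding hull_def by (rule csubspace_Inter) auto

lemma csubspace_sum:
  assumes "csubspace N" "\<And>i. i \<in> F \<Longrightarrow> u i \<in> N"
  shows "(\<Sum>i\<in>F. c i *\<^sub>C u i) \<in> N"
  using assms(2) by (induction F rule: infinite_finite_induct)
    (use assms(1) in \<open>auto simp: csubspace_def\<close>)

lemma csubspace_diff: "csubspace N \<Longrightarrow> x \<in> N \<Longrightarrow> y \<in> N \<Longrightarrow> x - y \<in> N"
  unfolding csubspace_def diff_conv_add_uminus by (metis scaleC_minus_left scaleC_one)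

lemma csubspace_closure:
  assumes "csubspace (N :: 'a::chilbert_space set)" shows "closed_csubspace (closure N)"
  unfolding closed_csubspace_def csubspace_def
proof (intro conjI ballI allI)
  show "0 \<in> closure N" using assms closure_subset by (auto simp: csubspace_def)
next
  fix x y assume "x \<in> closure N" "y \<in> closure N"
  then obtain u v where "\<forall>n. u n \<in> N" "u \<longlonglongrightarrow> x" "\<forall>n. v n \<in> N" "v \<longlonglongrightarrow> y"
    by (auto simp: closure_sequential)
  then have "\<forall>n. u n + v n \<in> N" "(\<lambda>n. u n + v n) \<longlonglongrightarrow> x + y"
    using assms by (auto simp: csubspace_def intro: tendsto_add)
  then show "x + y \<in> closure N" by (auto simp: closure_sequential)
next
  fix c x assume "x \<in> closure N"
  then obtain u where "\<forall>n. u n \<in> N" "u \<longlonglongrightarrow> x"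
    by (auto simp: closure_sequential)
  then have "\<forall>n. c *\<^sub>C u n \<in> N" "(\<lambda>n. c *\<^sub>C u n) \<longlonglongrightarrow> c *\<^sub>C x"
    using assms by (auto simp: csubspace_def intro: tendsto_scaleC)
  then show "c *\<^sub>C x \<in> closure N" unfolding closure_sequential by (intro exI conjI)
qed auto

text \<open>Serves as an induction principle: a property whose extension is a closed subspace has to
  be checked only on a total set, such as the elementary tensors.\<close>

lemma closed_csubspace_total:
  assumes "closed_csubspace N" "S \<subseteq> N" "closure (csubspace hull S) = UNIV"
  shows "x \<in> N"
proof -
  have "csubspace hull S \<subseteq> N"
    using assms by (intro hull_minimal) (auto simp: closed_csubspace_def)
  then have "closure (csubspace hull S) \<subseteq> N"
    using assms by (intro closure_minimal) (auto simp: closed_csubspace_def)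
  then show ?thesis using assms(3) by auto
qed

text \<open>Sums are combined by padding both coefficient families with zeros on the union of the
  index sets. Parseval's identity needs the coefficients explicitly.\<close>

lemma csubspace_hull_eq:
  "csubspace hull S = {\<Sum>i\<in>F. c i *\<^sub>C i | F c. finite F \<and> F \<subseteq> (S::'a::chilbert_space set)}" (is "_ = ?R")
proof (rule hull_unique)
  show "S \<subseteq> ?R"
  proof
    fix x assume "x \<in> S"
    then show "x \<in> ?R"
      by (intro CollectI exI[of _ "{x}"] exI[of _ "\<lambda>_. 1"]) auto
  qed
  show "csubspace ?R" unfolding csubspace_def
  proof (intro conjI ballI allI)
    show "0 \<in> ?R" by (intro CollectI exI[of _ "{}"]) auto
  next
    fix x y assume "x \<in> ?R" "y \<in> ?R"
    then obtain F c G d where FG: "finite F" "F \<subseteq> S" "finite G" "G \<subseteq> S"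
      "x = (\<Sum>i\<in>F. c i *\<^sub>C i)" "y = (\<Sum>i\<in>G. d i *\<^sub>C i)" by blast
    have "x = (\<Sum>i\<in>F \<union> G. (if i \<in> F then c i else 0) *\<^sub>C i)"
      unfolding FG using FG by (intro sum.mono_neutral_cong_left) auto
    moreover have "y = (\<Sum>i\<in>F \<union> G. (if i \<in> G then d i else 0) *\<^sub>C i)"
      unfolding FG using FG by (intro sum.mono_neutral_cong_left) auto
    ultimately have "x + y = (\<Sum>i\<in>F \<union> G. ((if i \<in> F then c i else 0) + (if i \<in> G then d i else 0)) *\<^sub>C i)"
      by (simp only: scaleC_add_left sum.distrib)
    then show "x + y \<in> ?R"
      using FG(1-4) by (intro CollectI exI[of _ "F \<union> G"] exI[of _ "\<lambda>i. (if i \<in> F then c i else 0) + (if i \<in> G then d i else 0)"]) auto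
  next
    fix c x assume "x \<in> ?R"
    then obtain F d where F: "finite F" "F \<subseteq> S" "x = (\<Sum>i\<in>F. d i *\<^sub>C i)" by blast
    then have "c *\<^sub>C x = (\<Sum>i\<in>F. (c * d i) *\<^sub>C i)"
      by (simp add: scaleC_sum_right scaleC_scaleC)
    then show "c *\<^sub>C x \<in> ?R"
      using F(1,2) by (intro CollectI exI[of _ F] exI[of _ "\<lambda>i. c * d i"]) auto
  qed
next
  fix N assume "S \<subseteq> N" "csubspace N"
  then show "?R \<subseteq> N" by (auto intro!: csubspace_sum)
qed

section \<open>Bounded operators\<close>

lemma bounded_opsI:
  assumes "\<And>x. x \<in> M \<Longrightarrow> A x \<in> M" "\<And>x. x \<notin> M \<Longrightarrow> A x = undefined"
    "\<And>x y. x \<in> M \<Longrightarrow> y \<in> M \<Longrightarrow> A (x + y) = A x + A y"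
    "\<And>c x. x \<in> M \<Longrightarrow> A (c *\<^sub>C x) = c *\<^sub>C A x"
    "\<And>x. x \<in> M \<Longrightarrow> norm (A x) \<le> K * norm x"
  shows "A \<in> bounded_ops M"
  using assms unfolding bounded_ops_def
  by (intro CollectI conjI exI[of _ K]) (auto simp: PiE_def extensional_def)

lemma bounded_ops_in: "A \<in> bounded_ops M \<Longrightarrow> x \<in> M \<Longrightarrow> A x \<in> M"
  by (auto simp: bounded_ops_def)

lemma bounded_ops_add: "A \<in> bounded_ops M \<Longrightarrow> x \<in> M \<Longrightarrow> y \<in> M \<Longrightarrow> A (x + y) = A x + A y"
  by (auto simp: bounded_ops_def)

lemma bounded_ops_scaleC: "A \<in> bounded_ops M \<Longrightarrow> x \<in> M \<Longrightarrow> A (c *\<^sub>C x) = c *\<^sub>C A x"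
  by (auto simp: bounded_ops_def)

lemma bounded_ops_bound:
  assumes "A \<in> bounded_ops M"
  obtains K where "K > 0" "\<And>x. x \<in> M \<Longrightarrow> norm (A x) \<le> K * norm x"
proof -
  obtain K where K: "\<forall>x\<in>M. norm (A x) \<le> K * norm x"
    using assms by (auto simp: bounded_ops_def)
  have "norm (A x) \<le> max 1 K * norm x" if "x \<in> M" for x
    using K that by (meson dual_order.trans max.cobounded2 mult_right_mono norm_ge_zero)
  then show ?thesis by (intro that[of "max 1 K"]) auto
qed

lemma bounded_ops_UNIV_bound:
  assumes "A \<in> bounded_ops UNIV"
  obtains K where "K > 0" "\<And>x. norm (A x) \<le> K * norm x"
  by (rule bounded_ops_bound[OF assms], rule that) auto

lemma bounded_ops_ext:
  assumes "A \<in> bounded_ops M" "B \<in> bounded_ops M" "\<And>x. x \<in> M \<Longrightarrow> A x = B x"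
  shows "A = B"
  using assms by (auto simp: bounded_ops_def intro: PiE_ext)

lemma bounded_ops_diff:
  assumes "A \<in> bounded_ops M" "csubspace M" "x \<in> M" "y \<in> M"
  shows "A (x - y) = A x - A y"
proof -
  have "A (x + (-1) *\<^sub>C y) = A x + (-1) *\<^sub>C A y"
    using assms by (metis bounded_ops_add bounded_ops_scaleC csubspace_def)
  then show ?thesis by simp
qed

lemma bounded_ops_bounded_linear:
  assumes "A \<in> bounded_ops UNIV" shows "bounded_linear A"
proof -
  obtain K where "K > 0" and K: "\<And>x. norm (A x) \<le> K * norm x" by (rule bounded_ops_UNIV_bound[OF assms], rule that)
  show ?thesis
  proof (rule bounded_linear_intro[where K=K])
    show "norm (A x) \<le> norm x * K" for x using K[of x] by (simp only: mult.commute)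
  qed (simp_all add: bounded_ops_add[OF assms] bounded_ops_scaleC[OF assms] scaleR_scaleC)
qed

lemma bounded_ops_UNIV_I:
  assumes "bounded_linear A" "\<And>c x. A (c *\<^sub>C x) = c *\<^sub>C A x"
  shows "A \<in> bounded_ops UNIV"
proof -
  obtain K where "\<forall>x. norm (A x) \<le> norm x * K" using assms(1) bounded_linear.bounded by blast
  then show ?thesis using assms linear_add[OF bounded_linear.linear[OF assms(1)]]
    by (intro bounded_opsI[where K=K]) (auto simp: mult.commute[of K])
qed

lemma bounded_ops_UNIV_add:
  "A \<in> bounded_ops UNIV \<Longrightarrow> B \<in> bounded_ops UNIV \<Longrightarrow> (\<lambda>x. A x + B x) \<in> bounded_ops UNIV"
  by (rule bounded_ops_UNIV_I)
    (simp_all add: bounded_linear_add bounded_ops_bounded_linear bounded_ops_scaleC[of _ UNIV] scaleC_add_right)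

lemma bounded_ops_UNIV_scale:
  "A \<in> bounded_ops UNIV \<Longrightarrow> (\<lambda>x. c *\<^sub>C A x) \<in> bounded_ops UNIV"
  by (rule bounded_ops_UNIV_I)
    (simp_all add: bounded_linear_compose[OF bounded_linear_scaleC] bounded_ops_bounded_linear
      bounded_ops_scaleC[of _ UNIV] scaleC_scaleC mult.commute)

lemma bounded_ops_restrict:
  assumes "A \<in> bounded_ops UNIV" "A ` M \<subseteq> M" "csubspace M"
  shows "restrict A M \<in> bounded_ops M"
proof -
  obtain K where "K > 0" and "\<And>x. norm (A x) \<le> K * norm x" by (rule bounded_ops_UNIV_bound[OF assms(1)], rule that)
  then show ?thesis using assms
    by (intro bounded_opsI[where K=K]) (auto simp: csubspace_def bounded_ops_add[of _ UNIV] bounded_ops_scaleC[of _ UNIV])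
qed

text \<open>\<open>cadjoint\<close> is a definite description, so adjoints are identified by
  exhibiting one. Two candidates agree because the difference of their values at a point is
  orthogonal to itself.\<close>

lemma cadjoint_eqI:
  assumes B: "B \<in> bounded_ops M"
    and adj: "\<And>x y. x \<in> M \<Longrightarrow> y \<in> M \<Longrightarrow> cinner (A x) y = cinner x (B y)" and M: "csubspace M"
  shows "cadjoint M A = B"
  unfolding cadjoint_def
proof (rule the_equality)
  fix B' assume B': "B' \<in> bounded_ops M \<and> (\<forall>x\<in>M. \<forall>y\<in>M. cinner (A x) y = cinner x (B' y))"
  show "B' = B"
  proof (rule bounded_ops_ext[of _ M])
    fix y assume y: "y \<in> M"
    have d: "B' y - B y \<in> M" using csubspace_diff[OF M bounded_ops_in[OF _ y] bounded_ops_in[OF B y]] B' by blast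
    have "cinner (B' y - B y) (B' y - B y) = 0"
      using adj[OF d y] B' d y by (simp add: cinner_diff_right)
    then show "B' y = B y" by simp
  qed (use B B' in auto)
qed (use assms in auto)

text \<open>The norm estimate does two things: it makes the assignment well defined on linear
  combinations although the \<open>f i\<close> may be dependent (elementary tensors are), and it
  makes it Lipschitz, so that it extends from a dense subspace.\<close>

lemma bounded_ops_extension:
  fixes f g :: "'i \<Rightarrow> 'a::chilbert_space"
  assumes le: "\<And>F c. finite F \<Longrightarrow> norm (\<Sum>i\<in>F. c i *\<^sub>C g i) \<le> K * norm (\<Sum>i\<in>F. c i *\<^sub>C f i)"
    and total: "closure (csubspace hull (range f)) = UNIV"
  obtains A where "A \<in> bounded_ops UNIV" "\<And>i. A (f i) = g i"
proof -
  \<comment> \<open>The graph of the operator on the span; working with a relation postpones the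
    question whether it is single-valued.\<close>
  define G where "G = {(u, v). \<exists>F c. finite F \<and> u = (\<Sum>i\<in>F. c i *\<^sub>C f i) \<and> v = (\<Sum>i\<in>F. c i *\<^sub>C g i)}"
  have G_E: "\<exists>F c. finite F \<and> u = (\<Sum>i\<in>F. c i *\<^sub>C f i) \<and> v = (\<Sum>i\<in>F. c i *\<^sub>C g i)"
    if "(u, v) \<in> G" for u v using that by (simp add: G_def)
  have G_I: "(\<Sum>i\<in>F. c i *\<^sub>C f i, \<Sum>i\<in>F. c i *\<^sub>C g i) \<in> G" if "finite F" for F c
    unfolding G_def mem_Collect_eq prod.case by (intro exI conjI) (rule that refl)+
  have G_le: "norm v \<le> K * norm u" if "(u, v) \<in> G" for u v
    using G_E[OF that] le by auto
  have G_scale: "(c *\<^sub>C u, c *\<^sub>C v) \<in> G" if uv: "(u, v) \<in> G" for u v c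
  proof -
    obtain F d where F: "finite F" "u = (\<Sum>i\<in>F. d i *\<^sub>C f i)" "v = (\<Sum>i\<in>F. d i *\<^sub>C g i)"
      using G_E[OF uv] by auto
    show ?thesis unfolding F(2,3) scaleC_sum_right scaleC_scaleC by (rule G_I[OF F(1)])
  qed
  have G_add: "(u + u', v + v') \<in> G" if uv: "(u, v) \<in> G" "(u', v') \<in> G" for u v u' v'
  proof -
    obtain F c where F: "finite F" "u = (\<Sum>i\<in>F. c i *\<^sub>C f i)" "v = (\<Sum>i\<in>F. c i *\<^sub>C g i)"
      using G_E[OF uv(1)] by auto
    obtain F' c' where F': "finite F'" "u' = (\<Sum>i\<in>F'. c' i *\<^sub>C f i)" "v' = (\<Sum>i\<in>F'. c' i *\<^sub>C g i)"
      using G_E[OF uv(2)] by auto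
    define d where "d i = (if i \<in> F then c i else 0) + (if i \<in> F' then c' i else 0)" for i
    have "(\<Sum>i\<in>F. c i *\<^sub>C h i) + (\<Sum>i\<in>F'. c' i *\<^sub>C h i) = (\<Sum>i\<in>F \<union> F'. d i *\<^sub>C h i)"
      for h :: "'i \<Rightarrow> 'a"
    proof -
      have "(\<Sum>i\<in>F. c i *\<^sub>C h i) = (\<Sum>i\<in>F \<union> F'. (if i \<in> F then c i else 0) *\<^sub>C h i)"
        using F F' by (intro sum.mono_neutral_cong_left) auto
      moreover have "(\<Sum>i\<in>F'. c' i *\<^sub>C h i) = (\<Sum>i\<in>F \<union> F'. (if i \<in> F' then c' i else 0) *\<^sub>C h i)"
        using F F' by (intro sum.mono_neutral_cong_left) auto
      ultimately show ?thesis by (simp only: d_def scaleC_add_left sum.distrib)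
    qed
    then show ?thesis unfolding F(2,3) F'(2,3) using F(1) F'(1) G_I by simp
  qed
  have G_f: "(f i, g i) \<in> G" for i
    using G_I[of "{i}" "\<lambda>_. 1"] by simp
  have G_0: "(0, 0) \<in> G"
    using G_I[of "{}"] by simp
  have G_diff: "(u - u', v - v') \<in> G" if "(u, v) \<in> G" "(u', v') \<in> G" for u v u' v'
    using G_add[OF that(1) G_scale[OF that(2), of "-1"]] by simp
  have G_unique: "v = v'" if "(u, v) \<in> G" "(u, v') \<in> G" for u v v'
    using G_le[OF G_diff[OF that]] by simp
  define D where "D = Domain G"
  have D: "csubspace D"
    unfolding csubspace_def
  proof (intro conjI ballI allI)
    show "0 \<in> D" using G_0 by (auto simp: D_def)
    show "x + y \<in> D" if "x \<in> D" "y \<in> D" for x y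
      using that G_add unfolding D_def by (meson Domain_iff)
    show "c *\<^sub>C x \<in> D" if "x \<in> D" for c x
      using that G_scale unfolding D_def by (meson Domain_iff)
  qed
  have total': "closure D = UNIV"
  proof -
    have "csubspace hull (range f) \<subseteq> D"
      using D G_f by (intro hull_minimal) (auto simp: D_def)
    then show ?thesis using total closure_mono by blast
  qed
  define A0 where "A0 u = (THE v. (u, v) \<in> G)" for u
  have A0: "A0 u = v" if "(u, v) \<in> G" for u v
    unfolding A0_def using that G_unique by blast
  have A0_add: "A0 (u + v) = A0 u + A0 v" if "u \<in> D" "v \<in> D" for u v
    using that unfolding D_def by (auto simp: A0 dest: A0[OF G_add])
  have A0_scale: "A0 (c *\<^sub>C u) = c *\<^sub>C A0 u" if "u \<in> D" for u c
    using that unfolding D_def by (auto simp: A0 dest: A0[OF G_scale])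
  have A0_le: "norm (A0 u - A0 v) \<le> K * norm (u - v)" if "u \<in> D" "v \<in> D" for u v
    using that unfolding D_def by (auto simp: A0 dest: G_le[OF G_diff])
  \<comment> \<open>The sign of \<open>K\<close> is unknown, whereas a Lipschitz constant has to be
    nonnegative.\<close>
  have "norm (A0 u - A0 v) \<le> max K 0 * norm (u - v)" if "u \<in> D" "v \<in> D" for u v
    using A0_le[OF that] mult_right_mono[of K "max K 0" "norm (u - v)"] by simp
  then have "uniformly_continuous_on D A0"
    by (intro lipschitz_on_uniformly_continuous[of "max K 0"] lipschitz_onI) (auto simp: dist_norm)
  then obtain A where A: "uniformly_continuous_on (closure D) A" "\<And>x. x \<in> D \<Longrightarrow> A0 x = A x"
    by (rule uniformly_continuous_on_extension_on_closure) (rule that)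
  have cont: "continuous_on UNIV A"
    using A(1) uniformly_continuous_imp_continuous total' by metis
  have limD: "\<exists>u. (\<forall>n. u n \<in> D) \<and> u \<longlonglongrightarrow> x" for x
    using total' by (metis UNIV_I closure_sequential)
  have lim: "(\<lambda>n. A0 (u n)) \<longlonglongrightarrow> A x" if "\<forall>n. u n \<in> D" "u \<longlonglongrightarrow> x" for u x
    using continuous_on_tendsto_compose[OF cont that(2)] A(2) that(1) by auto
  have add: "A (x + y) = A x + A y" for x y
  proof -
    obtain u v where u: "\<forall>n. u n \<in> D" "u \<longlonglongrightarrow> x" and v: "\<forall>n. v n \<in> D" "v \<longlonglongrightarrow> y"
      using limD by meson
    have "(\<lambda>n. A0 (u n + v n)) \<longlonglongrightarrow> A (x + y)"
      using u v D by (intro lim) (auto simp: csubspace_def intro: tendsto_add)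
    moreover have "(\<lambda>n. A0 (u n + v n)) \<longlonglongrightarrow> A x + A y"
      using tendsto_add[OF lim[OF u] lim[OF v]] u v by (simp add: A0_add)
    ultimately show ?thesis using LIMSEQ_unique by blast
  qed
  have scale: "A (c *\<^sub>C x) = c *\<^sub>C A x" for c x
  proof -
    obtain u where u: "\<forall>n. u n \<in> D" "u \<longlonglongrightarrow> x" using limD by meson
    have "(\<lambda>n. A0 (c *\<^sub>C u n)) \<longlonglongrightarrow> A (c *\<^sub>C x)"
      using u D by (intro lim) (auto simp: csubspace_def intro: tendsto_scaleC)
    moreover have "(\<lambda>n. A0 (c *\<^sub>C u n)) \<longlonglongrightarrow> c *\<^sub>C A x"
      using tendsto_scaleC[OF lim[OF u], of c] u by (simp add: A0_scale)
    ultimately show ?thesis using LIMSEQ_unique by blast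
  qed
  have A0_norm: "norm (A0 u) \<le> K * norm u" if "u \<in> D" for u
    using that G_le unfolding D_def by (auto simp: A0)
  have bound: "norm (A x) \<le> K * norm x" for x
  proof -
    obtain u where u: "\<forall>n. u n \<in> D" "u \<longlonglongrightarrow> x" using limD by meson
    show ?thesis
      using tendsto_norm[OF lim[OF u]] tendsto_mult_left[OF tendsto_norm[OF u(2)], of K] A0_norm u(1)
      by (intro LIMSEQ_le) auto
  qed
  have "A \<in> bounded_ops UNIV" using add scale bound by (intro bounded_opsI) auto
  moreover have "A (f i) = g i" for i
    using A(2)[of "f i"] A0[OF G_f] DomainI[OF G_f, folded D_def] by simp
  ultimately show ?thesis using that by blast
qed

text \<open>Builds an adjoint of \<open>A\<close> from its values on a total family, in place of the
  Riesz representation theorem. The bound comes for free: if v is the image of u, then |v|^2 = <u, A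
  v> <= K |u| |v|.\<close>

lemma bounded_ops_extension_adjoint:
  fixes f g :: "'i \<Rightarrow> 'a::chilbert_space"
  assumes A: "A \<in> bounded_ops UNIV"
    and fg: "\<And>i y. cinner (g i) y = cinner (f i) (A y)"
    and total: "closure (csubspace hull (range f)) = UNIV"
  obtains B where "B \<in> bounded_ops UNIV" "\<And>i. B (f i) = g i" "\<And>x y. cinner (B x) y = cinner x (A y)"
proof -
  obtain K where K: "K > 0" "\<And>x. norm (A x) \<le> K * norm x"
    by (rule bounded_ops_UNIV_bound[OF A], rule that)
  have "norm (\<Sum>i\<in>F. c i *\<^sub>C g i) \<le> K * norm (\<Sum>i\<in>F. c i *\<^sub>C f i)" for F c
  proof -
    let ?u = "\<Sum>i\<in>F. c i *\<^sub>C f i" and ?v = "\<Sum>i\<in>F. c i *\<^sub>C g i"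
    have "cinner ?v ?v = cinner ?u (A ?v)"
      by (simp add: cinner_sum_left cinner_scaleC_left fg)
    then have "(norm ?v)\<^sup>2 = cmod (cinner ?u (A ?v))"
      by (metis abs_power2 cinner_self norm_of_real real_norm_def)
    also have "\<dots> \<le> norm ?u * (K * norm ?v)"
      by (meson K(2) mult_left_mono norm_cinner_le norm_ge_zero order_trans)
    finally have "norm ?v * norm ?v \<le> (K * norm ?u) * norm ?v"
      by (simp add: power2_eq_square mult_ac)
    then show ?thesis
      by (cases "?v = 0") (use K(1) in \<open>simp_all add: mult_le_cancel_right\<close>)
  qed
  then obtain B where B: "B \<in> bounded_ops UNIV" "\<And>i. B (f i) = g i"
    by (rule bounded_ops_extension[OF _ total]) (rule that)
  have "x \<in> {x. \<forall>y. cinner (B x) y = cinner x (A y)}" for x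
  proof (rule closed_csubspace_total[OF _ _ total])
    show "range f \<subseteq> {x. \<forall>y. cinner (B x) y = cinner x (A y)}" using B fg by auto
    show "closed_csubspace {x. \<forall>y. cinner (B x) y = cinner x (A y)}"
      unfolding closed_csubspace_def
    proof
      show "csubspace {x. \<forall>y. cinner (B x) y = cinner x (A y)}"
        using bounded_ops_add[OF B(1)] bounded_ops_scaleC[OF B(1)]
          linear_0[OF bounded_linear.linear[OF bounded_ops_bounded_linear[OF B(1)]]]
        by (auto simp: csubspace_def cinner_simps)
      show "closed {x. \<forall>y. cinner (B x) y = cinner x (A y)}"
        unfolding Collect_all_eq
        by (intro closed_INT ballI closed_Collect_eq continuous_intros
            bounded_linear.continuous_on[OF bounded_ops_bounded_linear[OF B(1)]])
    qed
  qed
  then show ?thesis using B that by blast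
qed

lemma bounded_ops_UNIV_eqI:
  assumes A: "A \<in> bounded_ops UNIV" and B: "B \<in> bounded_ops UNIV"
    and eq: "\<And>i. A (f i) = B (f i)" and total: "closure (csubspace hull (range f)) = UNIV"
  shows "A = B"
proof
  fix x
  have "x \<in> {x. A x = B x}"
  proof (rule closed_csubspace_total[OF _ _ total])
    show "range f \<subseteq> {x. A x = B x}" using eq by auto
    show "closed_csubspace {x. A x = B x}" unfolding closed_csubspace_def
    proof
      show "csubspace {x. A x = B x}"
        using A B linear_0[OF bounded_linear.linear[OF bounded_ops_bounded_linear[OF B]]]
          linear_0[OF bounded_linear.linear[OF bounded_ops_bounded_linear[OF A]]]
        by (auto simp: csubspace_def bounded_ops_add[of _ UNIV] bounded_ops_scaleC[of _ UNIV])
      show "closed {x. A x = B x}"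
        by (intro closed_Collect_eq linear_continuous_on bounded_ops_bounded_linear A B)
    qed
  qed
  then show "A x = B x" by simp
qed

section \<open>Creation operators on the full Fock space\<close>

lemma fock_cinner:
  assumes "full_fock_space tens"
  shows "cinner (tens xs) (tens ys) =
        (if length xs = length ys then \<Prod>i<length xs. cinner (xs ! i) (ys ! i) else 0)"
  using assms by (auto simp: full_fock_space_def)

lemma fock_cinner_Cons:
  assumes "full_fock_space tens"
  shows "cinner (tens (x # xs)) (tens (y # ys)) = cinner x y * cinner (tens xs) (tens ys)"
  by (simp add: fock_cinner[OF assms] prod.lessThan_Suc_shift del: prod.lessThan_Suc)

lemma fock_cinner_snoc:
  assumes "full_fock_space tens"
  shows "cinner (tens (xs @ [x])) (tens (ys @ [y])) = cinner x y * cinner (tens xs) (tens ys)"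
  by (auto simp: fock_cinner[OF assms] nth_append mult.commute intro!: prod.cong)

text \<open>Prepending (or appending) a vector multiplies all inner products between elementary tensors by
  its squared norm, so it extends to a bounded operator.\<close>

lemma fock_creation:
  fixes tens :: "'h::chilbert_space list \<Rightarrow> 'f::chilbert_space"
  assumes F: "full_fock_space tens"
    and h: "\<And>xs ys. cinner (tens (h xs)) (tens (h ys)) = of_real (k\<^sup>2) * cinner (tens xs) (tens ys)"
  shows "(THE A. A \<in> bounded_ops UNIV \<and> (\<forall>xs. A (tens xs) = tens (h xs))) \<in> bounded_ops UNIV"
    and "(THE A. A \<in> bounded_ops UNIV \<and> (\<forall>xs. A (tens xs) = tens (h xs))) (tens xs) = tens (h xs)"
proof -
  have total: "closure (csubspace hull (range tens)) = UNIV"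
    using F by (simp add: full_fock_space_def)
  have le: "norm (\<Sum>i\<in>S. c i *\<^sub>C tens (h i)) \<le> \<bar>k\<bar> * norm (\<Sum>i\<in>S. c i *\<^sub>C tens i)"
    if "finite S" for S c
  proof -
    let ?u = "\<Sum>i\<in>S. c i *\<^sub>C tens i" and ?v = "\<Sum>i\<in>S. c i *\<^sub>C tens (h i)"
    have "cinner ?v ?v = of_real (k\<^sup>2) * cinner ?u ?u"
      by (simp add: cinner_sum_left cinner_sum_right cinner_simps h sum_distrib_left mult_ac)
    then have "complex_of_real ((norm ?v)\<^sup>2) = of_real ((\<bar>k\<bar> * norm ?u)\<^sup>2)"
      by (simp add: cinner_self power_mult_distrib flip: of_real_power)
    then have "(norm ?v)\<^sup>2 = (\<bar>k\<bar> * norm ?u)\<^sup>2" unfolding of_real_eq_iff .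
    then have "norm ?v = \<bar>k\<bar> * norm ?u" by (rule power2_eq_imp_eq) simp_all
    then show ?thesis by simp
  qed
  obtain A where A: "A \<in> bounded_ops UNIV" "\<And>xs. A (tens xs) = tens (h xs)"
    by (rule bounded_ops_extension[where f=tens and g="\<lambda>xs. tens (h xs)", OF le total], assumption) (rule that)
  have "(THE A. A \<in> bounded_ops UNIV \<and> (\<forall>xs. A (tens xs) = tens (h xs))) = A"
  proof (rule the_equality)
    fix B assume B: "B \<in> bounded_ops UNIV \<and> (\<forall>xs. B (tens xs) = tens (h xs))"
    show "B = A" by (rule bounded_ops_UNIV_eqI[OF _ A(1) _ total]) (simp_all add: A B)
  qed (simp add: A)
  then show "(THE A. A \<in> bounded_ops UNIV \<and> (\<forall>xs. A (tens xs) = tens (h xs))) \<in> bounded_ops UNIV"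
    "(THE A. A \<in> bounded_ops UNIV \<and> (\<forall>xs. A (tens xs) = tens (h xs))) (tens xs) = tens (h xs)"
    using A by auto
qed

text \<open>The adjoint relation is given only between elementary tensors. Density extends it in the
  second argument, and the extension lemma then extends it in the first.\<close>

lemma fock_annihilation:
  assumes F: "full_fock_space tens" and A: "A \<in> bounded_ops UNIV"
    and g: "\<And>xs ys. cinner (g xs) (tens ys) = cinner (tens xs) (A (tens ys))"
  shows "cadjoint UNIV A \<in> bounded_ops UNIV" and "cadjoint UNIV A (tens xs) = g xs"
    and "cinner (cadjoint UNIV A x) y = cinner x (A y)"
proof -
  have total: "closure (csubspace hull (range tens)) = UNIV"
    using F by (simp add: full_fock_space_def)
  have gA: "cinner (g xs) y = cinner (tens xs) (A y)" for xs y
  proof -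
    have "y \<in> {y. cinner (g xs) y = cinner (tens xs) (A y)}"
    proof (rule closed_csubspace_total[OF _ _ total])
      show "range tens \<subseteq> {y. cinner (g xs) y = cinner (tens xs) (A y)}" using g by auto
      show "closed_csubspace {y. cinner (g xs) y = cinner (tens xs) (A y)}"
        unfolding closed_csubspace_def
      proof
        show "csubspace {y. cinner (g xs) y = cinner (tens xs) (A y)}"
          using bounded_ops_add[OF A] bounded_ops_scaleC[OF A]
            linear_0[OF bounded_linear.linear[OF bounded_ops_bounded_linear[OF A]]]
          by (auto simp: csubspace_def cinner_simps)
        show "closed {y. cinner (g xs) y = cinner (tens xs) (A y)}"
          by (intro closed_Collect_eq continuous_intros
              bounded_linear.continuous_on[OF bounded_ops_bounded_linear[OF A]])
      qed
    qed
    then show ?thesis by simp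
  qed
  obtain B where B: "B \<in> bounded_ops UNIV" "\<And>i. B (tens i) = g i"
    "\<And>x y. cinner (B x) y = cinner x (A y)"
    by (rule bounded_ops_extension_adjoint[where f=tens and g=g, OF A gA total]) (rule that)
  have "cinner (A x) y = cinner x (B y)" for x y
    unfolding cinner_commute[of "A x" y] cinner_commute[of x "B y"] B(3) ..
  then have "cadjoint UNIV A = B"
    by (intro cadjoint_eqI B(1)) (simp_all add: csubspace_def)
  then show "cadjoint UNIV A \<in> bounded_ops UNIV" "cadjoint UNIV A (tens xs) = g xs"
    "cinner (cadjoint UNIV A x) y = cinner x (A y)" using B by auto
qed

lemma left_creation:
  assumes F: "full_fock_space tens"
  shows "left_creation tens \<xi> \<in> bounded_ops UNIV" "left_creation tens \<xi> (tens xs) = tens (\<xi> # xs)"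
proof -
  have h: "cinner (tens (\<xi> # xs)) (tens (\<xi> # ys)) = of_real ((norm \<xi>)\<^sup>2) * cinner (tens xs) (tens ys)"
    for xs ys by (simp only: fock_cinner_Cons[OF F] cinner_self)
  show "left_creation tens \<xi> \<in> bounded_ops UNIV" "left_creation tens \<xi> (tens xs) = tens (\<xi> # xs)"
    unfolding left_creation_def by (rule fock_creation[where h="\<lambda>xs. \<xi> # xs", OF F h])+
qed

lemma right_creation:
  assumes F: "full_fock_space tens"
  shows "right_creation tens \<xi> \<in> bounded_ops UNIV" "right_creation tens \<xi> (tens xs) = tens (xs @ [\<xi>])"
proof -
  have h: "cinner (tens (xs @ [\<xi>])) (tens (ys @ [\<xi>])) = of_real ((norm \<xi>)\<^sup>2) * cinner (tens xs) (tens ys)"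
    for xs ys by (simp only: fock_cinner_snoc[OF F] cinner_self)
  show "right_creation tens \<xi> \<in> bounded_ops UNIV" "right_creation tens \<xi> (tens xs) = tens (xs @ [\<xi>])"
    unfolding right_creation_def by (rule fock_creation[where h="\<lambda>xs. xs @ [\<xi>]", OF F h])+
qed

lemma left_annihilation:
  fixes tens :: "'h::chilbert_space list \<Rightarrow> 'f::chilbert_space" and \<xi> :: 'h
  assumes F: "full_fock_space tens"
  defines "A \<equiv> cadjoint UNIV (left_creation tens \<xi>)"
  shows "A \<in> bounded_ops UNIV" "A (tens []) = 0" "A (tens (x # xs)) = cinner x \<xi> *\<^sub>C tens xs"
    "cinner (A u) v = cinner u (left_creation tens \<xi> v)"
proof -
  \<comment> \<open>The candidate adjoint contracts the first letter against \<xi>. It kills the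
    vacuum, since creation never produces a tensor of length 0.\<close>
  define g where "g xs = (case xs of [] \<Rightarrow> 0 | x # zs \<Rightarrow> cinner x \<xi> *\<^sub>C tens zs)" for xs
  have g: "cinner (g xs) (tens ys) = cinner (tens xs) (left_creation tens \<xi> (tens ys))" for xs ys
  proof (cases xs)
    case Nil
    then show ?thesis by (simp add: g_def left_creation(2)[OF F] fock_cinner[OF F])
  next
    case (Cons x zs)
    then show ?thesis
      by (simp add: g_def left_creation(2)[OF F] cinner_scaleC_left fock_cinner_Cons[OF F])
  qed
  note * = fock_annihilation[OF F left_creation(1)[OF F], where g=g, OF g]
  show "A \<in> bounded_ops UNIV" "A (tens []) = 0" "A (tens (x # xs)) = cinner x \<xi> *\<^sub>C tens xs"
    "cinner (A u) v = cinner u (left_creation tens \<xi> v)"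
    by (simp_all add: A_def g_def *)
qed

lemma right_annihilation:
  fixes tens :: "'h::chilbert_space list \<Rightarrow> 'f::chilbert_space" and \<xi> :: 'h
  assumes F: "full_fock_space tens"
  defines "A \<equiv> cadjoint UNIV (right_creation tens \<xi>)"
  shows "A \<in> bounded_ops UNIV" "A (tens []) = 0" "A (tens (xs @ [x])) = cinner x \<xi> *\<^sub>C tens xs"
    "cinner (A u) v = cinner u (right_creation tens \<xi> v)"
proof -
  define g where "g xs = (if xs = [] then 0 else cinner (last xs) \<xi> *\<^sub>C tens (butlast xs))" for xs
  have g: "cinner (g xs) (tens ys) = cinner (tens xs) (right_creation tens \<xi> (tens ys))" for xs ys
  proof (cases xs rule: rev_cases)
    case Nil
    then show ?thesis by (simp add: g_def right_creation(2)[OF F] fock_cinner[OF F])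
  next
    case (snoc zs x)
    then show ?thesis
      by (simp add: g_def right_creation(2)[OF F] cinner_scaleC_left fock_cinner_snoc[OF F])
  qed
  note * = fock_annihilation[OF F right_creation(1)[OF F], where g=g, OF g]
  show "A \<in> bounded_ops UNIV" "A (tens []) = 0" "A (tens (xs @ [x])) = cinner x \<xi> *\<^sub>C tens xs"
    "cinner (A u) v = cinner u (right_creation tens \<xi> v)"
    by (simp_all add: A_def g_def *)
qed

section \<open>Spectrum and resolvent\<close>

text \<open>Off the spectrum \<open>inv_into\<close> is a genuine inverse. The third claim is how
  resolvents are evaluated later: any solution in \<open>M\<close> of the linear equation is the
  resolvent vector.\<close>

lemma resolvent:
  assumes z: "z \<notin> spectrum M A" and y: "y \<in> M"
  shows "resolvent M A z y \<in> M"
    and "A (resolvent M A z y) - z *\<^sub>C resolvent M A z y = y"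
    and "x \<in> M \<Longrightarrow> A x - z *\<^sub>C x = y \<Longrightarrow> resolvent M A z y = x"
proof -
  obtain B where B: "B \<in> bounded_ops M"
    "\<And>x. x \<in> M \<Longrightarrow> B (A x - z *\<^sub>C x) = x" "\<And>x. x \<in> M \<Longrightarrow> A (B x) - z *\<^sub>C B x = x"
    using z unfolding spectrum_def by auto
  have inj: "inj_on (\<lambda>x. A x - z *\<^sub>C x) M"
    by (rule inj_on_inverseI[where g=B]) (rule B(2))
  have eq: "resolvent M A z y = x" if "x \<in> M" "A x - z *\<^sub>C x = y" for x
    unfolding resolvent_def by (rule inv_into_f_eq[OF inj that])
  have "resolvent M A z y = B y"
    by (rule eq[OF bounded_ops_in[OF B(1) y] B(3)[OF y]])
  then show "resolvent M A z y \<in> M" "A (resolvent M A z y) - z *\<^sub>C resolvent M A z y = y"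
    using bounded_ops_in[OF B(1) y] B(3)[OF y] by simp_all
  show "x \<in> M \<Longrightarrow> A x - z *\<^sub>C x = y \<Longrightarrow> resolvent M A z y = x" by (rule eq)
qed

lemma resolvent_scaleC:
  assumes "csubspace M" "A \<in> bounded_ops M" "z \<notin> spectrum M A" "y \<in> M"
  shows "resolvent M A z (k *\<^sub>C y) = k *\<^sub>C resolvent M A z y"
proof (rule resolvent(3)[OF assms(3)])
  note r = resolvent[OF assms(3,4)]
  show "k *\<^sub>C y \<in> M" "k *\<^sub>C resolvent M A z y \<in> M"
    using assms(1,4) r(1) by (simp_all add: csubspace_def)
  show "A (k *\<^sub>C resolvent M A z y) - z *\<^sub>C k *\<^sub>C resolvent M A z y = k *\<^sub>C y"
    using r(2) unfolding bounded_ops_scaleC[OF assms(2) r(1)]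
    by (metis scaleC_diff_right scaleC_scaleC mult.commute)
qed

text \<open>The lower bound yields injectivity and the norm bound 1/\<delta> for the inverse.
  Linearity of the inverse follows from injectivity, as both sides solve the same equation.\<close>

lemma not_in_spectrumI:
  assumes M: "csubspace M" and A: "A \<in> bounded_ops M"
    and surj: "\<And>y. y \<in> M \<Longrightarrow> \<exists>x\<in>M. A x - z *\<^sub>C x = y"
    and below: "\<And>x. x \<in> M \<Longrightarrow> \<delta> * norm x \<le> norm (A x - z *\<^sub>C x)" and \<delta>: "\<delta> > 0"
  shows "z \<notin> spectrum M A"
proof -
  have "\<exists>B. \<forall>y\<in>M. B y \<in> M \<and> A (B y) - z *\<^sub>C B y = y"
    using surj by (intro bchoice) auto
  then obtain B where B: "\<And>y. y \<in> M \<Longrightarrow> B y \<in> M" "\<And>y. y \<in> M \<Longrightarrow> A (B y) - z *\<^sub>C B y = y"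
    by auto
  have inj: "x = x'" if "x \<in> M" "x' \<in> M" "A x - z *\<^sub>C x = A x' - z *\<^sub>C x'" for x x'
  proof -
    have "A (x - x') - z *\<^sub>C (x - x') = 0"
      using that(3) by (simp add: bounded_ops_diff[OF A M that(1,2)] scaleC_diff_right algebra_simps)
    then show ?thesis using below[OF csubspace_diff[OF M that(1,2)]] \<delta>
      by (simp add: mult_le_0_iff)
  qed
  have M': "x + y \<in> M" "c *\<^sub>C x \<in> M" if "x \<in> M" "y \<in> M" for x y c
    using that M by (auto simp: csubspace_def)
  have "restrict B M \<in> bounded_ops M"
  proof (rule bounded_opsI[where K="1 / \<delta>"])
    fix x y assume xy: "x \<in> M" "y \<in> M"
    have "A (B x + B y) - z *\<^sub>C (B x + B y) = (A (B x) - z *\<^sub>C B x) + (A (B y) - z *\<^sub>C B y)"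
      by (simp add: bounded_ops_add[OF A B(1) B(1), OF xy] scaleC_add_right)
    then have "A (B (x + y)) - z *\<^sub>C B (x + y) = A (B x + B y) - z *\<^sub>C (B x + B y)"
      by (simp only: B(2)[OF xy(1)] B(2)[OF xy(2)] B(2)[OF M'(1)[OF xy]])
    then have "B (x + y) = B x + B y"
      by (rule inj[OF B(1)[OF M'(1)[OF xy]] M'(1)[OF B(1)[OF xy(1)] B(1)[OF xy(2)]]])
    then show "restrict B M (x + y) = restrict B M x + restrict B M y" using xy M' by simp
  next
    fix x c assume x: "x \<in> M"
    have "A (c *\<^sub>C B x) - z *\<^sub>C c *\<^sub>C B x = c *\<^sub>C (A (B x) - z *\<^sub>C B x)"
      by (simp add: bounded_ops_scaleC[OF A B(1)[OF x]] scaleC_diff_right scaleC_scaleC mult.commute)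
    then have "A (B (c *\<^sub>C x)) - z *\<^sub>C B (c *\<^sub>C x) = A (c *\<^sub>C B x) - z *\<^sub>C c *\<^sub>C B x"
      by (simp only: B(2)[OF x] B(2)[OF M'(2)[OF x x]])
    then have "B (c *\<^sub>C x) = c *\<^sub>C B x"
      by (rule inj[OF B(1)[OF M'(2)[OF x x]] M'(2)[OF B(1)[OF x] B(1)[OF x]]])
    then show "restrict B M (c *\<^sub>C x) = c *\<^sub>C restrict B M x" using x M' by simp
  next
    fix x assume x: "x \<in> M"
    show "norm (restrict B M x) \<le> 1 / \<delta> * norm x"
      using below[OF B(1)[OF x]] B(2)[OF x] x \<delta> by (simp add: field_simps)
  qed (use B(1) in auto)
  moreover have "restrict B M (A x - z *\<^sub>C x) = x" if "x \<in> M" for x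
  proof -
    have "A x - z *\<^sub>C x \<in> M"
      by (rule csubspace_diff[OF M bounded_ops_in[OF A that] M'(2)[OF that that]])
    then have "B (A x - z *\<^sub>C x) = x"
      by (intro inj[OF B(1) that] B(2))
    then show ?thesis using \<open>A x - z *\<^sub>C x \<in> M\<close> by simp
  qed
  moreover have "A (restrict B M x) - z *\<^sub>C restrict B M x = x" if "x \<in> M" for x
    using B(2)[OF that] that by simp
  ultimately have "\<exists>B\<in>bounded_ops M. \<forall>x\<in>M. B (A x - z *\<^sub>C x) = x \<and> A (B x) - z *\<^sub>C B x = x"
    by (intro bexI[of _ "restrict B M"] ballI conjI)
  then show ?thesis unfolding spectrum_def by simp
qed

text \<open>The Lax--Milgram lemma: the Richardson iteration \<open>x \<mapsto> x - \<tau> (S x - y)\<close> is a contraction.\<close>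

lemma coercive_surj:
  assumes M: "closed_csubspace M" and S: "S \<in> bounded_ops M"
    and c: "c > 0" and coercive: "\<And>x. x \<in> M \<Longrightarrow> c * (norm x)\<^sup>2 \<le> inner (S x) x"
    and y: "y \<in> M"
  shows "\<exists>x\<in>M. S x = y"
proof -
  have sub: "csubspace M" using M by (simp add: closed_csubspace_def)
  obtain K where K: "K > 0" "\<And>x. x \<in> M \<Longrightarrow> norm (S x) \<le> K * norm x"
    by (rule bounded_ops_bound[OF S], rule that)
  \<comment> \<open>The bound c <= K follows from coercivity only if \<open>M\<close> has a nonzero
    vector; the maximum covers the trivial space and keeps 1 - c^2/L^2 nonnegative.\<close>
  define L where "L = max K c"
  have L: "L > 0" "c \<le> L" "\<And>x. x \<in> M \<Longrightarrow> norm (S x) \<le> L * norm x"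
    using K c by (auto simp: L_def intro: order_trans[OF K(2) mult_right_mono])
  \<comment> \<open>This step size minimizes 1 - 2 \<tau> c + \<tau>^2 L^2, the bound for the
    squared contraction factor; the minimum is 1 - c^2/L^2.\<close>
  define \<tau> where "\<tau> = c / L\<^sup>2"
  define f where "f x = x - \<tau> *\<^sub>R (S x - y)" for x
  define q where "q = sqrt (1 - c\<^sup>2 / L\<^sup>2)"
  have "c\<^sup>2 \<le> L\<^sup>2" using L c by (intro power_mono) auto
  then have q2: "q\<^sup>2 = 1 - c\<^sup>2 / L\<^sup>2" "q \<ge> 0" and q1: "q < 1"
    using L c by (auto simp: q_def real_sqrt_lt_1_iff)
  have "\<exists>!x\<in>M. f x = x"
  proof (rule Banach_fix[where c=q])
    show "complete M" using M by (simp add: closed_csubspace_def complete_eq_closed)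
    show "M \<noteq> {}" using y by auto
    show "f ` M \<subseteq> M"
    proof
      fix u assume "u \<in> f ` M"
      then obtain x where x: "x \<in> M" "u = f x" by auto
      have "of_real \<tau> *\<^sub>C (S x - y) \<in> M"
        using sub csubspace_diff[OF sub bounded_ops_in[OF S x(1)] y] by (simp add: csubspace_def)
      then show "u \<in> M" unfolding x f_def scaleR_scaleC by (intro csubspace_diff[OF sub x(1)])
    qed
    show "dist (f x) (f x') \<le> q * dist x x'" if x: "x \<in> M" "x' \<in> M" for x x'
    proof -
      define u where "u = x - x'"
      have u: "u \<in> M" unfolding u_def by (rule csubspace_diff[OF sub x])
      have e: "f x - f x' = u - \<tau> *\<^sub>R S u"
        by (simp add: f_def u_def bounded_ops_diff[OF S sub x] scaleR_diff_right)
      have "(norm (f x - f x'))\<^sup>2 = (norm u)\<^sup>2 - 2 * \<tau> * inner (S u) u + \<tau>\<^sup>2 * (norm (S u))\<^sup>2"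
        unfolding e power2_norm_eq_inner
        by (simp add: inner_diff_left inner_diff_right inner_commute power2_eq_square algebra_simps)
      also have "\<dots> \<le> (norm u)\<^sup>2 - 2 * \<tau> * (c * (norm u)\<^sup>2) + \<tau>\<^sup>2 * (L * norm u)\<^sup>2"
        using coercive[OF u] power_mono[OF L(3)[OF u], of 2] L c
        by (intro add_mono diff_mono mult_left_mono) (auto simp: \<tau>_def)
      also have "\<dots> = (1 - c\<^sup>2 / L\<^sup>2) * (norm u)\<^sup>2"
        using L(1) by (simp add: \<tau>_def field_simps power2_eq_square)
      also have "\<dots> = (q * norm u)\<^sup>2" by (simp add: power_mult_distrib q2)
      finally show "dist (f x) (f x') \<le> q * dist x x'"
        unfolding dist_norm u_def[symmetric] by (rule power2_le_imp_le) (simp add: q2(2))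
    qed
  qed (use q2 q1 in auto)
  then obtain x where "x \<in> M" "f x = x" by auto
  moreover have "\<tau> \<noteq> 0" using c L by (simp add: \<tau>_def)
  ultimately show ?thesis by (intro bexI[of _ x]) (simp_all add: f_def)
qed

text \<open>Since <A x, x> is real, rotating A - z by \<i> or -\<i> gives an operator whose
  quadratic form has real part |Im z| |x|^2. Coercivity gives surjectivity, Cauchy-Schwarz the lower
  bound. This makes all nonreal l and s available for the uniqueness argument.\<close>

lemma selfadjoint_nonreal_not_in_spectrum:
  assumes M: "closed_csubspace M" and A: "A \<in> bounded_ops M"
    and sa: "\<And>x y. x \<in> M \<Longrightarrow> y \<in> M \<Longrightarrow> cinner (A x) y = cinner x (A y)"
    and z: "Im z \<noteq> 0"
  shows "z \<notin> spectrum M A"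
proof -
  have sub: "csubspace M" using M by (simp add: closed_csubspace_def)
  define k where "k = of_real (sgn (Im z)) * \<i>"
  have k: "cmod k = 1" "k * k = -1" using z by (auto simp: k_def norm_mult sgn_if)
  define S where "S = (\<lambda>x\<in>M. k *\<^sub>C (A x - z *\<^sub>C x))"
  have mem: "A x - z *\<^sub>C x \<in> M" if "x \<in> M" for x
    using that sub csubspace_diff[OF sub bounded_ops_in[OF A that]] by (simp add: csubspace_def)
  have coercive: "\<bar>Im z\<bar> * (norm x)\<^sup>2 = inner (S x) x" if x: "x \<in> M" for x
  proof -
    have "Im (cinner (A x) x) = 0"
      using sa[OF x x] cinner_commute[of "A x" x] by (simp add: complex_eq_iff)
    then show ?thesis
      using x z by (simp add: S_def k_def Re_cinner[symmetric] cinner_simps cinner_self sgn_if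
          flip: of_real_power)
  qed
  have S: "S \<in> bounded_ops M"
  proof -
    obtain K where K: "K > 0" "\<And>x. x \<in> M \<Longrightarrow> norm (A x) \<le> K * norm x"
      by (rule bounded_ops_bound[OF A], rule that)
    have mem2: "k *\<^sub>C (A x - z *\<^sub>C x) \<in> M" "x + y \<in> M" "c *\<^sub>C x \<in> M" if "x \<in> M" "y \<in> M" for x y c
      using that sub mem by (auto simp: csubspace_def)
    have "norm (A x - z *\<^sub>C x) \<le> (K + cmod z) * norm x" if "x \<in> M" for x
      using norm_triangle_ineq4[of "A x" "z *\<^sub>C x"] K(2)[OF that]
      by (simp add: norm_scaleC algebra_simps)
    then show ?thesis
    proof (intro bounded_opsI[where K="K + cmod z"])
      show "S (x + y) = S x + S y" if "x \<in> M" "y \<in> M" for x y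
        using that by (simp add: S_def mem2 bounded_ops_add[OF A] scaleC_add_right scaleC_diff_right)
      show "S (c *\<^sub>C x) = c *\<^sub>C S x" if "x \<in> M" for c x
        using that mem2(3)[OF that that]
        by (simp add: S_def bounded_ops_scaleC[OF A] scaleC_diff_right scaleC_scaleC mult_ac)
    qed (simp_all add: S_def mem2 norm_scaleC k)
  qed
  show ?thesis
  proof (rule not_in_spectrumI[OF sub A])
    fix y assume y: "y \<in> M"
    have "\<exists>x\<in>M. S x = k *\<^sub>C y"
      using z y sub coercive by (intro coercive_surj[OF M S, of "\<bar>Im z\<bar>"]) (auto simp: csubspace_def)
    then obtain x where x: "x \<in> M" "k *\<^sub>C (A x - z *\<^sub>C x) = k *\<^sub>C y" by (auto simp: S_def)
    then have "k *\<^sub>C k *\<^sub>C (A x - z *\<^sub>C x) = k *\<^sub>C k *\<^sub>C y" by simp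
    then have "A x - z *\<^sub>C x = y"
      unfolding scaleC_scaleC k scaleC_minus_left scaleC_one neg_equal_iff_equal .
    then show "\<exists>x\<in>M. A x - z *\<^sub>C x = y" using x by auto
  next
    fix x assume x: "x \<in> M"
    have "\<bar>Im z\<bar> * (norm x)\<^sup>2 \<le> norm (S x) * norm x"
      unfolding coercive[OF x] by (rule norm_cauchy_schwarz)
    also have "norm (S x) = norm (A x - z *\<^sub>C x)" using x by (simp add: S_def norm_scaleC k)
    finally show "\<bar>Im z\<bar> * norm x \<le> norm (A x - z *\<^sub>C x)"
      by (cases "x = 0") (auto simp: power2_eq_square mult.assoc[symmetric] mult_le_cancel_right)
  qed (use z in auto)
qed

section \<open>Orthonormal bases\<close>

text \<open>With \<open>d\<close> equal to the coefficients of \<open>x\<close> this is Bessel's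
  inequality; with arbitrary \<open>d\<close> it says that those coefficients give the best
  approximation. Both readings are used for Parseval's identity.\<close>

lemma orthonormal_dist:
  assumes "finite G" and on: "\<And>e f. e \<in> G \<Longrightarrow> f \<in> G \<Longrightarrow> cinner e f = (if e = f then 1 else 0)"
  shows "(norm (x - (\<Sum>e\<in>G. d e *\<^sub>C e)))\<^sup>2 =
    (norm x)\<^sup>2 - (\<Sum>e\<in>G. (cmod (cinner x e))\<^sup>2) + (\<Sum>e\<in>G. (cmod (cinner x e - d e))\<^sup>2)"
proof -
  let ?y = "\<Sum>e\<in>G. d e *\<^sub>C e"
  have y: "cinner ?y e = d e" if "e \<in> G" for e
  proof -
    have "cinner ?y e = (\<Sum>f\<in>G. d f * (if f = e then 1 else 0))"
      unfolding cinner_sum_left cinner_scaleC_left using that by (intro sum.cong) (auto simp: on)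
    then show ?thesis using assms(1) that by (simp add: if_distrib cong: if_cong)
  qed
  have "cinner x ?y = (\<Sum>e\<in>G. cnj (d e) * cinner x e)"
    by (simp add: cinner_sum_right cinner_scaleC_right)
  moreover have "cinner ?y ?y = (\<Sum>e\<in>G. cnj (d e) * d e)"
    unfolding cinner_sum_right cinner_scaleC_right by (intro sum.cong) (auto simp: y)
  moreover have "cinner ?y x = (\<Sum>e\<in>G. d e * cnj (cinner x e))"
    by (simp add: cinner_sum_left cinner_scaleC_left cinner_commute[of x])
  ultimately have "cinner (x - ?y) (x - ?y) = cinner x x - (\<Sum>e\<in>G. cinner x e * cnj (cinner x e))
      + (\<Sum>e\<in>G. (cinner x e - d e) * cnj (cinner x e - d e))"
    by (simp add: cinner_diff_left cinner_diff_right sum_subtractf sum.distrib algebra_simps)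
  then have "complex_of_real ((norm (x - ?y))\<^sup>2) = complex_of_real ((norm x)\<^sup>2
      - (\<Sum>e\<in>G. (cmod (cinner x e))\<^sup>2) + (\<Sum>e\<in>G. (cmod (cinner x e - d e))\<^sup>2))"
    unfolding cinner_self by (simp only: of_real_add of_real_diff of_real_sum complex_norm_square)
  then show ?thesis unfolding of_real_eq_iff .
qed

text \<open>A finite combination close to \<open>x\<close> exists by density, and any larger finite
  set of basis vectors approximates at least as well. No countability of \<open>B\<close> enters,
  which suits \<open>has_sum\<close>.\<close>

lemma parseval:
  assumes B: "orthonormal_basis M B" and x: "x \<in> M"
  shows "((\<lambda>e. (cmod (cinner x e))\<^sup>2) has_sum (norm x)\<^sup>2) B"
  unfolding has_sum_def tendsto_iff eventually_finite_subsets_at_top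
proof (intro allI impI)
  fix \<epsilon> :: real assume \<epsilon>: "\<epsilon> > 0"
  have "x \<in> closure (csubspace hull B)" using B x by (simp add: orthonormal_basis_def)
  then obtain y where y: "y \<in> csubspace hull B" "dist y x < sqrt \<epsilon>"
    using \<epsilon> unfolding closure_approachable by (metis real_sqrt_gt_zero)
  obtain F c where F: "finite F" "F \<subseteq> B" "y = (\<Sum>e\<in>F. c e *\<^sub>C e)"
    using y(1) unfolding csubspace_hull_eq by auto
  show "\<exists>X. finite X \<and> X \<subseteq> B \<and> (\<forall>Y. finite Y \<and> X \<subseteq> Y \<and> Y \<subseteq> B \<longrightarrow>
          dist (\<Sum>e\<in>Y. (cmod (cinner x e))\<^sup>2) ((norm x)\<^sup>2) < \<epsilon>)"
  proof (intro exI[of _ F] conjI allI impI F(1,2))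
    fix Y assume Y: "finite Y \<and> F \<subseteq> Y \<and> Y \<subseteq> B"
    have on: "cinner e f = (if e = f then 1 else 0)" if "e \<in> Y" "f \<in> Y" for e f
      using B Y that unfolding orthonormal_basis_def by blast
    have "y = (\<Sum>e\<in>Y. (if e \<in> F then c e else 0) *\<^sub>C e)"
      unfolding F(3) using Y by (intro sum.mono_neutral_cong_left) auto
    then have "(norm x)\<^sup>2 - (\<Sum>e\<in>Y. (cmod (cinner x e))\<^sup>2) \<le> (norm (x - y))\<^sup>2"
      using orthonormal_dist[OF _ on, of Y x "\<lambda>e. if e \<in> F then c e else 0"] Y
      by (simp add: sum_nonneg)
    also have "\<dots> < (sqrt \<epsilon>)\<^sup>2"
      using y(2) by (intro power_strict_mono) (auto simp: dist_norm norm_minus_commute)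
    finally have 1: "(norm x)\<^sup>2 - (\<Sum>e\<in>Y. (cmod (cinner x e))\<^sup>2) < \<epsilon>" using \<epsilon> by simp
    have "0 \<le> (norm (x - (\<Sum>e\<in>Y. cinner x e *\<^sub>C e)))\<^sup>2" by simp
    then have "0 \<le> (norm x)\<^sup>2 - (\<Sum>e\<in>Y. (cmod (cinner x e))\<^sup>2)"
      using orthonormal_dist[OF _ on, of Y x "cinner x"] Y by simp
    then show "dist (\<Sum>e\<in>Y. (cmod (cinner x e))\<^sup>2) ((norm x)\<^sup>2) < \<epsilon>"
      using 1 by (simp add: dist_real_def)
  qed
qed

text \<open>A minimizing sequence for the distance is Cauchy by the parallelogram law, and its limit
  is the foot of the perpendicular.\<close>

lemma orthogonal_projection_exists:
  fixes x :: "'a::chilbert_space"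
  assumes N: "closed_csubspace N"
  shows "\<exists>p\<in>N. \<forall>y\<in>N. cinner (x - p) y = 0"
proof -
  have sub: "csubspace N" and cl: "closed N" and ne: "N \<noteq> {}"
    using N by (auto simp: closed_csubspace_def csubspace_def)
  define \<delta> where "\<delta> = Inf ((\<lambda>y. (norm (x - y))\<^sup>2) ` N)"
  have bdd: "bdd_below ((\<lambda>y. (norm (x - y))\<^sup>2) ` N)" by (rule bdd_belowI[of _ 0]) auto
  have \<delta>: "\<delta> \<le> (norm (x - y))\<^sup>2" if "y \<in> N" for y
    unfolding \<delta>_def using that bdd by (intro cInf_lower) auto
  have "\<exists>y\<in>N. (norm (x - y))\<^sup>2 < \<delta> + 1 / real (Suc n)" for n
  proof -
    have "Inf ((\<lambda>y. (norm (x - y))\<^sup>2) ` N) < \<delta> + 1 / real (Suc n)"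
      by (simp add: \<delta>_def[symmetric])
    then show ?thesis using cInf_less_iff[OF _ bdd] ne by auto
  qed
  then obtain u where u: "\<And>n. u n \<in> N" "\<And>n. (norm (x - u n))\<^sup>2 < \<delta> + 1 / real (Suc n)"
    by metis
  have para: "(norm (u m - u n))\<^sup>2 \<le> 2 / real (Suc m) + 2 / real (Suc n)" for m n
  proof -
    \<comment> \<open>The midpoint stays in \<open>N\<close>, so its distance to \<open>x\<close> is
      again at least the infimum; this bounds the negative term of the parallelogram
      identity.\<close>
    have mid: "(1/2) *\<^sub>R (u m + u n) \<in> N"
      using sub u(1) unfolding csubspace_def scaleR_scaleC by blast
    have "(norm (u m - u n))\<^sup>2 = 2 * (norm (x - u m))\<^sup>2 + 2 * (norm (x - u n))\<^sup>2
        - 4 * (norm (x - (1/2) *\<^sub>R (u m + u n)))\<^sup>2"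
      by (simp add: power2_norm_eq_inner inner_diff_left inner_diff_right inner_add_left
          inner_add_right inner_commute algebra_simps)
    then show ?thesis using u(2)[of m] u(2)[of n] \<delta>[OF mid] by simp
  qed
  have "Cauchy u"
  proof (rule metric_CauchyI)
    fix \<epsilon> :: real assume \<epsilon>: "\<epsilon> > 0"
    obtain n0 :: nat where n0: "4 / \<epsilon>\<^sup>2 < real n0" using reals_Archimedean2 by blast
    have "dist (u m) (u n) < \<epsilon>" if "m \<ge> n0" "n \<ge> n0" for m n
    proof -
      have "4 / \<epsilon>\<^sup>2 > 0" using \<epsilon> by simp
      then have n0': "real n0 > 0" using n0 by linarith
      have "2 / real (Suc m) + 2 / real (Suc n) \<le> 2 / real n0 + 2 / real n0"
        using that n0' by (intro add_mono divide_left_mono) auto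
      also have "\<dots> < \<epsilon>\<^sup>2" using n0 n0' \<epsilon> by (simp add: field_simps)
      finally have "(norm (u m - u n))\<^sup>2 < \<epsilon>\<^sup>2" using para[of m n] by linarith
      then show ?thesis unfolding dist_norm using \<epsilon> by (simp add: power_less_imp_less_base[of _ 2])
    qed
    then show "\<exists>n0. \<forall>m\<ge>n0. \<forall>n\<ge>n0. dist (u m) (u n) < \<epsilon>" by blast
  qed
  then obtain p where p: "u \<longlonglongrightarrow> p" by (auto simp: Cauchy_convergent_iff convergent_def)
  have pN: "p \<in> N" using closed_sequentially[OF cl] u(1) p by blast
  have "(norm (x - p))\<^sup>2 \<le> \<delta>"
  proof (rule LIMSEQ_le)
    show "(\<lambda>n. (norm (x - u n))\<^sup>2) \<longlonglongrightarrow> (norm (x - p))\<^sup>2"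
      by (intro tendsto_intros p)
    show "(\<lambda>n. \<delta> + 1 / real (Suc n)) \<longlonglongrightarrow> \<delta>"
      using tendsto_add[OF tendsto_const[of \<delta>] LIMSEQ_Suc[OF lim_1_over_n]] by simp
    show "\<exists>n0. \<forall>n\<ge>n0. (norm (x - u n))\<^sup>2 \<le> \<delta> + 1 / real (Suc n)"
      using u(2) less_imp_le by blast
  qed
  then have best: "(norm (x - p))\<^sup>2 \<le> (norm (x - y))\<^sup>2" if "y \<in> N" for y
    using \<delta>[OF that] by linarith
  have "cinner (x - p) y = 0" if y: "y \<in> N" for y
  proof (cases "y = 0")
    case False
    \<comment> \<open>The coefficient of x - p along y. Adding k y to p would reduce the squared
      distance by |<x - p, y>|^2 / |y|^2, which minimality forbids unless it is 0.\<close>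
    define k where "k = cinner (x - p) y / of_real ((norm y)\<^sup>2)"
    have ny: "(norm y)\<^sup>2 > 0" using False by simp
    have "k *\<^sub>C y + p \<in> N" using sub y pN unfolding csubspace_def by blast
    then have "(norm (x - p))\<^sup>2 \<le> (norm ((x - p) - k *\<^sub>C y))\<^sup>2"
      using best[of "k *\<^sub>C y + p"] by (simp add: algebra_simps)
    moreover have "cinner (w - k *\<^sub>C y) (w - k *\<^sub>C y)
        = cinner w w - of_real ((cmod (cinner w y))\<^sup>2 / (norm y)\<^sup>2)"
      if k: "k = cinner w y / of_real ((norm y)\<^sup>2)" for w
    proof -
      have "cinner y y = of_real ((norm y)\<^sup>2)" by (rule cinner_self)
      moreover have "cinner y w = cnj (cinner w y)" by (rule cinner_commute)
      moreover have "complex_of_real ((cmod (cinner w y))\<^sup>2) = cinner w y * cnj (cinner w y)"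
        by (rule complex_norm_square)
      ultimately show ?thesis using ny
        by (simp add: k cinner_diff_left cinner_diff_right cinner_scaleC_left
            cinner_scaleC_right field_simps del: of_real_power)
    qed
    from this[OF k_def] have "(norm ((x - p) - k *\<^sub>C y))\<^sup>2 = (norm (x - p))\<^sup>2 - (cmod (cinner (x - p) y))\<^sup>2 / (norm y)\<^sup>2"
      unfolding cinner_self of_real_diff[symmetric] of_real_eq_iff .
    ultimately have "(cmod (cinner (x - p) y))\<^sup>2 / (norm y)\<^sup>2 \<le> 0" by linarith
    then show ?thesis using ny by (simp add: divide_le_0_iff)
  qed simp
  then show ?thesis using pN by blast
qed

text \<open>A maximal orthonormal set is total, since otherwise a normalized remainder of an
  orthogonal projection could be added. Existence matters because \<open>trace_ext_power\<close>
  quantifies over all bases: without one, every number would satisfy its description.\<close>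

lemma orthonormal_basis_exists:
  assumes M: "closed_csubspace (M :: 'a::chilbert_space set)"
  shows "\<exists>B. orthonormal_basis M B"
proof -
  define \<A> where "\<A> = {B. B \<subseteq> M \<and> (\<forall>e\<in>B. \<forall>f\<in>B. cinner e f = (if e = f then 1 else 0))}"
  have "\<exists>B\<in>\<A>. \<forall>X\<in>\<A>. B \<subseteq> X \<longrightarrow> X = B"
  proof (rule subset_Zorn_nonempty)
    show "\<A> \<noteq> {}" unfolding \<A>_def by (rule ex_in_conv[THEN iffD1], rule exI[of _ "{}"]) simp
    fix \<C> assume \<C>: "\<C> \<noteq> {}" "subset.chain \<A> \<C>"
    have sub: "C \<in> \<A>" if "C \<in> \<C>" for C using \<C>(2) that by (auto simp: subset.chain_def)
    have "cinner e f = (if e = f then 1 else 0)" if ef: "e \<in> \<Union>\<C>" "f \<in> \<Union>\<C>" for e f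
    proof -
      obtain C D where CD: "C \<in> \<C>" "e \<in> C" "D \<in> \<C>" "f \<in> D" using ef by blast
      then have "C \<subseteq> D \<or> D \<subseteq> C" using \<C>(2) by (meson subset_chain_def)
      then obtain E where "E \<in> \<C>" "e \<in> E" "f \<in> E" using CD by blast
      then show ?thesis using sub[of E] by (simp add: \<A>_def)
    qed
    then show "\<Union>\<C> \<in> \<A>" using sub unfolding \<A>_def by blast
  qed
  then obtain B where B: "B \<in> \<A>" and max: "\<And>X. X \<in> \<A> \<Longrightarrow> B \<subseteq> X \<Longrightarrow> X = B" by blast
  define N where "N = closure (csubspace hull B)"
  have N: "closed_csubspace N" unfolding N_def by (rule csubspace_closure[OF csubspace_hull])
  have BN: "B \<subseteq> N" unfolding N_def by (meson closure_subset hull_subset order_trans)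
  have NM: "N \<subseteq> M" unfolding N_def
    using M B by (intro closure_minimal hull_minimal) (auto simp: closed_csubspace_def \<A>_def)
  have "M \<subseteq> N"
  proof
    fix x assume x: "x \<in> M"
    obtain p where p: "p \<in> N" "\<And>y. y \<in> N \<Longrightarrow> cinner (x - p) y = 0"
      using orthogonal_projection_exists[OF N] by blast
    show "x \<in> N"
    proof (rule ccontr)
      assume "x \<notin> N"
      then have ne: "x - p \<noteq> 0" using p by auto
      have sub: "csubspace M" using M by (simp add: closed_csubspace_def)
      define f where "f = complex_of_real (1 / norm (x - p)) *\<^sub>C (x - p)"
      have fM: "f \<in> M"
        using sub csubspace_diff[OF sub x] p(1) NM unfolding f_def csubspace_def by blast
      have "norm f = 1" using ne by (simp add: f_def norm_scaleC norm_divide)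
      then have ff: "cinner f f = 1" by (simp add: cinner_self)
      have fB: "cinner f e = 0" if "e \<in> B" for e
        using p(2) BN that by (auto simp: f_def cinner_scaleC_left)
      have "cinner e f = 0" if "e \<in> B" for e
        using fB[OF that] cinner_commute[of e f] by simp
      with ff fB have "insert f B \<in> \<A>" using B fM unfolding \<A>_def by auto
      then have "f \<in> B" using max[of "insert f B"] by blast
      then show False using fB[of f] ff by simp
    qed
  qed
  then have "orthonormal_basis M B"
    using B NM unfolding orthonormal_basis_def \<A>_def N_def by blast
  then show ?thesis ..
qed

section \<open>Rank one operators\<close>

text \<open>For a unit vector \<Omega> this is \<open>t\<close> times the projection onto its line.
  The scalar is complex because the signed root of a negative number is imaginary.\<close>

definition rank_one :: "'a::chilbert_space set \<Rightarrow> 'a \<Rightarrow> complex \<Rightarrow> 'a \<Rightarrow> 'a" where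
  "rank_one M \<Omega> t = (\<lambda>x\<in>M. (t * cinner x \<Omega>) *\<^sub>C \<Omega>)"

text \<open>This class contains the rank one operators (a = 0) and also their resolvents.\<close>

lemma bounded_ops_scalar_plus_rank_one:
  assumes M: "csubspace M" and \<Omega>: "\<Omega> \<in> M"
  shows "(\<lambda>x\<in>M. a *\<^sub>C x + (b * cinner x \<Omega>) *\<^sub>C \<Omega>) \<in> bounded_ops M"
proof (rule bounded_opsI[where K="cmod a + cmod b * (norm \<Omega> * norm \<Omega>)"])
  have M': "x + y \<in> M" "c *\<^sub>C x \<in> M" if "x \<in> M" "y \<in> M" for x y c
    using that M by (auto simp: csubspace_def)
  let ?A = "\<lambda>x\<in>M. a *\<^sub>C x + (b * cinner x \<Omega>) *\<^sub>C \<Omega>"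
  show "?A x \<in> M" if "x \<in> M" for x
    using M'(1)[OF M'(2)[OF that that] M'(2)[OF \<Omega> \<Omega>]] that by simp
  show "?A (x + y) = ?A x + ?A y" if "x \<in> M" "y \<in> M" for x y
    using M'(1)[OF that] that
    by (simp add: cinner_add_left distrib_left scaleC_add_left scaleC_add_right)
  show "?A (c *\<^sub>C x) = c *\<^sub>C ?A x" if "x \<in> M" for c x
    using M'(2)[OF that that] that
    by (simp add: cinner_scaleC_left scaleC_add_right scaleC_scaleC mult_ac)
  show "norm (?A x) \<le> (cmod a + cmod b * (norm \<Omega> * norm \<Omega>)) * norm x" if "x \<in> M" for x
  proof -
    have "norm (?A x) \<le> cmod a * norm x + cmod b * cmod (cinner x \<Omega>) * norm \<Omega>"
      using norm_triangle_ineq[of "a *\<^sub>C x" "(b * cinner x \<Omega>) *\<^sub>C \<Omega>"] that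
      by (simp add: norm_scaleC norm_mult)
    also have "\<dots> \<le> cmod a * norm x + cmod b * (norm x * norm \<Omega>) * norm \<Omega>"
      by (intro add_left_mono mult_right_mono mult_left_mono norm_cinner_le) auto
    finally show ?thesis by (simp add: algebra_simps)
  qed
qed simp

lemma rank_one_bounded:
  assumes "csubspace M" "\<Omega> \<in> M"
  shows "rank_one M \<Omega> t \<in> bounded_ops M"
  using bounded_ops_scalar_plus_rank_one[OF assms, of 0 t] by (simp add: rank_one_def)

lemma cadjoint_rank_one:
  assumes "csubspace M" "\<Omega> \<in> M"
  shows "cadjoint M (rank_one M \<Omega> t) = rank_one M \<Omega> (cnj t)"
proof (rule cadjoint_eqI[OF rank_one_bounded[OF assms]])
  fix x y assume "x \<in> M" "y \<in> M"
  then show "cinner (rank_one M \<Omega> t x) y = cinner x (rank_one M \<Omega> (cnj t) y)"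
    by (simp add: rank_one_def cinner_scaleC_left cinner_scaleC_right cinner_commute[of \<Omega> y])
qed (rule assms)

text \<open>The nonzero vector \<open>e\<close> orthogonal to \<Omega> is an eigenvector for 0; it
  keeps 0 in the spectrum of a nonzero multiple of the projection.\<close>

context
  fixes M :: "'a::chilbert_space set" and \<Omega> e :: 'a
  assumes M: "csubspace M" and \<Omega>: "\<Omega> \<in> M" "cinner \<Omega> \<Omega> = 1"
    and e: "e \<in> M" "e \<noteq> 0" "cinner e \<Omega> = 0"
begin

lemma rank_one_in: "x \<in> M \<Longrightarrow> rank_one M \<Omega> t x \<in> M"
  using M \<Omega> by (simp add: rank_one_def csubspace_def)

lemma rank_one_compose:
  "x \<in> M \<Longrightarrow> rank_one M \<Omega> t (rank_one M \<Omega> u x) = rank_one M \<Omega> (t * u) x"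
  using rank_one_in[of x u] by (simp add: rank_one_def cinner_scaleC_left \<Omega> mult_ac)

lemma spectrum_rank_one:
  assumes t: "t \<noteq> 0"
  shows "spectrum M (rank_one M \<Omega> t) = {0, t}"
proof (intro equalityI subsetI)
  fix z assume z: "z \<in> {0, t}"
  have "\<exists>x\<in>M. x \<noteq> 0 \<and> rank_one M \<Omega> t x - z *\<^sub>C x = 0"
  proof (cases "z = 0")
    case True
    then show ?thesis using e by (intro bexI[of _ e]) (simp_all add: rank_one_def)
  next
    case False
    have "\<Omega> \<noteq> 0" using \<Omega>(2) by auto
    then show ?thesis using False z \<Omega> by (intro bexI[of _ \<Omega>]) (auto simp: rank_one_def)
  qed
  then obtain x where x: "x \<in> M" "x \<noteq> 0" "rank_one M \<Omega> t x - z *\<^sub>C x = 0" by auto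
  show "z \<in> spectrum M (rank_one M \<Omega> t)"
  proof (rule ccontr)
    assume "z \<notin> spectrum M (rank_one M \<Omega> t)"
    then obtain B where B: "B \<in> bounded_ops M" "\<forall>x\<in>M. B (rank_one M \<Omega> t x - z *\<^sub>C x) = x"
      unfolding spectrum_def by auto
    have 0: "0 \<in> M" using M by (simp add: csubspace_def)
    have "B 0 = x" using B(2) x(1,3) by metis
    moreover have "B 0 = 0" using bounded_ops_add[OF B(1) 0 0] by simp
    ultimately show False using x(2) by simp
  qed
next
  fix z assume "z \<in> spectrum M (rank_one M \<Omega> t)"
  then have no: "\<not> (\<exists>B\<in>bounded_ops M. \<forall>x\<in>M. B (rank_one M \<Omega> t x - z *\<^sub>C x) = x \<and>
      rank_one M \<Omega> t (B x) - z *\<^sub>C B x = x)" by (simp add: spectrum_def)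
  show "z \<in> {0, t}"
  proof (rule ccontr)
    assume "z \<notin> {0, t}"
    then have z: "z \<noteq> 0" "t - z \<noteq> 0" by auto
    \<comment> \<open>The inverse is multiplication by -1/z orthogonally to \<Omega> and by 1/(t -
      z) on its line; \<open>?b\<close> is the difference of these two factors.\<close>
    let ?b = "1 / z + 1 / (t - z)"
    let ?B = "\<lambda>x\<in>M. (- 1 / z) *\<^sub>C x + (?b * cinner x \<Omega>) *\<^sub>C \<Omega>"
    have B: "?B \<in> bounded_ops M" by (rule bounded_ops_scalar_plus_rank_one[OF M \<Omega>(1)])
    have "?B (rank_one M \<Omega> t x - z *\<^sub>C x) = x \<and> rank_one M \<Omega> t (?B x) - z *\<^sub>C ?B x = x"
      if x: "x \<in> M" for x
    proof -
      let ?a = "cinner x \<Omega>"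
      have zx: "z *\<^sub>C x \<in> M" using M x by (simp add: csubspace_def)
      have mem: "rank_one M \<Omega> t x - z *\<^sub>C x \<in> M"
        by (rule csubspace_diff[OF M rank_one_in[OF x] zx])
      have c1: "- (t * ?a) / z + ?b * ((t - z) * ?a) = 0" using z by (simp add: field_simps)
      have "?B (rank_one M \<Omega> t x - z *\<^sub>C x) =
          (- 1 / z) *\<^sub>C ((t * ?a) *\<^sub>C \<Omega> - z *\<^sub>C x) + (?b * (t * ?a - z * ?a)) *\<^sub>C \<Omega>"
        using mem x \<Omega> by (simp add: rank_one_def cinner_diff_left cinner_scaleC_left)
      also have "\<dots> = (- (t * ?a) / z + ?b * ((t - z) * ?a)) *\<^sub>C \<Omega> + (z / z) *\<^sub>C x"
        using z by (simp add: scaleC_diff_right scaleC_scaleC scaleC_add_left scaleC_diff_left left_diff_distrib[of t z])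
      finally have "?B (rank_one M \<Omega> t x - z *\<^sub>C x) =
          (- (t * ?a) / z + ?b * ((t - z) * ?a)) *\<^sub>C \<Omega> + (z / z) *\<^sub>C x" .
      then have 1: "?B (rank_one M \<Omega> t x - z *\<^sub>C x) = x" using z c1 by simp
      have Bx: "?B x \<in> M" by (rule bounded_ops_in[OF B x])
      have c2: "t * (- ?a / z + ?b * ?a) - z * (?b * ?a) = 0" using z by (simp add: field_simps)
      define y where "y = (- 1 / z) *\<^sub>C x + (?b * ?a) *\<^sub>C \<Omega>"
      have By: "?B x = y" using x by (simp add: y_def)
      then have yM: "y \<in> M" using Bx by simp
      have "cinner y \<Omega> = - ?a / z + ?b * ?a"
        using \<Omega> by (simp add: y_def cinner_add_left cinner_diff_left cinner_scaleC_left)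
      then have "rank_one M \<Omega> t y - z *\<^sub>C y = (t * (- ?a / z + ?b * ?a)) *\<^sub>C \<Omega> - z *\<^sub>C y"
        using yM by (simp add: rank_one_def)
      also have "\<dots> = (t * (- ?a / z + ?b * ?a) - z * (?b * ?a)) *\<^sub>C \<Omega> + (z / z) *\<^sub>C x"
        using z by (simp add: y_def scaleC_add_right scaleC_diff_right scaleC_scaleC scaleC_diff_left)
      finally have "rank_one M \<Omega> t (?B x) - z *\<^sub>C ?B x
          = (t * (- ?a / z + ?b * ?a) - z * (?b * ?a)) *\<^sub>C \<Omega> + (z / z) *\<^sub>C x" unfolding By .
      then have 2: "rank_one M \<Omega> t (?B x) - z *\<^sub>C ?B x = x" using z c2 by simp
      show ?thesis using 1 2 by blast
    qed
    then show False using no B by blast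
  qed
qed

text \<open>Since 0 ^ 0 = 1, the terms 0 ^ i cover the identity and the positive powers at once.
  Summing against coefficients then produces the values of a polynomial at 0 and at t.\<close>

lemma funpow_rank_one:
  assumes x: "x \<in> M"
  shows "(rank_one M \<Omega> t ^^ i) x = 0 ^ i *\<^sub>C x + ((t ^ i - 0 ^ i) * cinner x \<Omega>) *\<^sub>C \<Omega>"
proof (induction i)
  case (Suc i)
  have mem: "0 ^ i *\<^sub>C x + ((t ^ i - 0 ^ i) * cinner x \<Omega>) *\<^sub>C \<Omega> \<in> M"
    using M x \<Omega>(1) by (simp add: csubspace_def)
  have "(rank_one M \<Omega> t ^^ Suc i) x = rank_one M \<Omega> t (0 ^ i *\<^sub>C x + ((t ^ i - 0 ^ i) * cinner x \<Omega>) *\<^sub>C \<Omega>)"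
    by (simp only: funpow.simps o_apply Suc.IH)
  also have "\<dots> = (t * (0 ^ i * cinner x \<Omega> + (t ^ i - 0 ^ i) * cinner x \<Omega>)) *\<^sub>C \<Omega>"
    using mem \<Omega>(2) by (simp add: rank_one_def cinner_add_left cinner_scaleC_left)
  also have "t * (0 ^ i * cinner x \<Omega> + (t ^ i - 0 ^ i) * cinner x \<Omega>) = (t ^ Suc i - 0 ^ Suc i) * cinner x \<Omega>"
    by (simp add: algebra_simps)
  finally show ?case by simp
qed simp

lemma poly_op_rank_one:
  assumes x: "x \<in> M"
  shows "poly_op p (rank_one M \<Omega> t) x = poly p 0 *\<^sub>C x + ((poly p t - poly p 0) * cinner x \<Omega>) *\<^sub>C \<Omega>"
proof -
  have sum_left: "(\<Sum>i\<in>S. c i *\<^sub>C y) = (\<Sum>i\<in>S. c i) *\<^sub>C y" for S :: "nat set" and c and y :: 'a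
    by (induction S rule: infinite_finite_induct) (auto simp: scaleC_add_left)
  have "poly_op p (rank_one M \<Omega> t) x = (\<Sum>i\<le>degree p. (coeff p i * 0 ^ i) *\<^sub>C x)
      + (\<Sum>i\<le>degree p. (coeff p i * (t ^ i - 0 ^ i) * cinner x \<Omega>) *\<^sub>C \<Omega>)"
    by (simp add: poly_op_def funpow_rank_one[OF x] scaleC_add_right scaleC_scaleC sum.distrib mult.assoc)
  also have "\<dots> = poly p 0 *\<^sub>C x + ((poly p t - poly p 0) * cinner x \<Omega>) *\<^sub>C \<Omega>"
    unfolding sum_left sum_distrib_right[symmetric] poly_altdef sum_subtractf[symmetric]
    by (simp add: right_diff_distrib)
  finally show ?thesis .
qed

text \<open>On a two-point spectrum, uniform convergence means convergence at 0 and at t, and p(A)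
  depends only on these two values. The condition f 0 = 0 removes the multiple of the
  identity.\<close>

lemma cont_fun_calc_rank_one:
  assumes t: "t \<noteq> 0" and f0: "f 0 = 0"
  shows "cont_fun_calc M f (rank_one M \<Omega> (complex_of_real t)) = rank_one M \<Omega> (f t)"
proof -
  let ?A = "rank_one M \<Omega> (complex_of_real t)"
  have norm\<Omega>: "norm \<Omega> = 1" using \<Omega>(2) by (simp add: cinner_self power2_eq_1_iff flip: of_real_power)
      (metis norm_ge_zero neg_0_le_iff_le not_one_le_zero)
  have S: "{\<tau>. complex_of_real \<tau> \<in> spectrum M ?A} = {0, t}"
    using spectrum_rank_one[of "complex_of_real t"] t by auto
  show ?thesis unfolding cont_fun_calc_def S
  proof (rule the_equality, intro conjI allI impI)
    show "rank_one M \<Omega> (f t) \<in> bounded_ops M" by (rule rank_one_bounded[OF M \<Omega>(1)])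
  next
    fix p :: "nat \<Rightarrow> complex poly"
    assume lim: "uniform_limit {0, t} (\<lambda>n \<tau>. poly (p n) (complex_of_real \<tau>)) f sequentially"
    have p0: "(\<lambda>n. poly (p n) 0) \<longlonglongrightarrow> 0" and pt: "(\<lambda>n. poly (p n) (complex_of_real t)) \<longlonglongrightarrow> f t"
      using tendsto_uniform_limitI[OF lim, of 0] tendsto_uniform_limitI[OF lim, of t] f0 by auto
    have "(\<lambda>n. 2 * cmod (poly (p n) 0) + cmod (poly (p n) (complex_of_real t) - f t)) \<longlonglongrightarrow> 2 * cmod 0 + cmod (f t - f t)"
      by (intro tendsto_intros p0 pt)
    then have small: "\<forall>\<^sub>F n in sequentially. 2 * cmod (poly (p n) 0) + cmod (poly (p n) (complex_of_real t) - f t) < \<epsilon>"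
      if "\<epsilon> > 0" for \<epsilon> using order_tendstoD(2) that by fastforce
    show "uniform_limit {x \<in> M. norm x \<le> 1} (\<lambda>n. poly_op (p n) ?A) (rank_one M \<Omega> (f t)) sequentially"
    proof (rule uniform_limitI)
      fix \<epsilon> :: real assume "\<epsilon> > 0"
      show "\<forall>\<^sub>F n in sequentially. \<forall>x\<in>{x \<in> M. norm x \<le> 1}. dist (poly_op (p n) ?A x) (rank_one M \<Omega> (f t) x) < \<epsilon>"
        using small[OF \<open>\<epsilon> > 0\<close>]
      proof (rule eventually_mono, intro ballI)
        fix n x
        let ?p0 = "poly (p n) 0" and ?pt = "poly (p n) (complex_of_real t)"
        assume less: "2 * cmod ?p0 + cmod (?pt - f t) < \<epsilon>" and "x \<in> {x \<in> M. norm x \<le> 1}"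
        then have x: "x \<in> M" "norm x \<le> 1" by auto
        have "cmod (cinner x \<Omega>) \<le> 1"
          using norm_cinner_le[of x \<Omega>] x(2) norm\<Omega> by simp
        have "poly_op (p n) ?A x - rank_one M \<Omega> (f t) x
            = ?p0 *\<^sub>C x + ((?pt - f t - ?p0) * cinner x \<Omega>) *\<^sub>C \<Omega>"
          unfolding poly_op_rank_one[OF x(1)] using x(1)
          by (simp add: rank_one_def left_diff_distrib scaleC_diff_left)
        then have "dist (poly_op (p n) ?A x) (rank_one M \<Omega> (f t) x)
            \<le> cmod ?p0 * norm x + cmod (?pt - f t - ?p0) * cmod (cinner x \<Omega>)"
          unfolding dist_norm using norm_triangle_ineq[of "?p0 *\<^sub>C x" "((?pt - f t - ?p0) * cinner x \<Omega>) *\<^sub>C \<Omega>"]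
          by (simp add: norm_scaleC norm_mult norm\<Omega>)
        also have "\<dots> \<le> cmod ?p0 * 1 + cmod (?pt - f t - ?p0) * 1"
          by (intro add_mono mult_left_mono) (fact | simp)+
        also have "\<dots> \<le> 2 * cmod ?p0 + cmod (?pt - f t)"
          using norm_triangle_ineq4[of "?pt - f t" ?p0] by simp
        finally show "dist (poly_op (p n) ?A x) (rank_one M \<Omega> (f t) x) < \<epsilon>" using less by simp
      qed
    qed
  next
    fix B assume B: "B \<in> bounded_ops M \<and> (\<forall>p. uniform_limit {0, t} (\<lambda>n \<tau>. poly (p n) (complex_of_real \<tau>)) f sequentially \<longrightarrow>
        uniform_limit {x \<in> M. norm x \<le> 1} (\<lambda>n. poly_op (p n) ?A) B sequentially)"
    \<comment> \<open>A linear polynomial that interpolates f at 0 and t. The constant sequence of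
      this polynomial already determines B on the unit ball, hence everywhere by scaling.\<close>
    define q where "q = [:0, f t / complex_of_real t:]"
    have q: "poly q 0 = 0" "poly q (complex_of_real t) = f t" using t by (simp_all add: q_def)
    have "uniform_limit {0, t} (\<lambda>n \<tau>. poly q (complex_of_real \<tau>)) f sequentially"
      by (rule uniform_limitI) (auto simp: q f0)
    then have lim: "uniform_limit {x \<in> M. norm x \<le> 1} (\<lambda>n. poly_op q ?A) B sequentially"
      using B[THEN conjunct2, rule_format, of "\<lambda>_. q"] by simp
    have ball: "B x = rank_one M \<Omega> (f t) x" if x: "x \<in> M" "norm x \<le> 1" for x
    proof -
      have "(\<lambda>n::nat. poly_op q ?A x) \<longlonglongrightarrow> B x"
        using tendsto_uniform_limitI[OF lim] x by simp
      then have "B x = poly_op q ?A x" by (simp add: LIMSEQ_const_iff)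
      then show ?thesis using x unfolding poly_op_rank_one[OF x(1)] q by (simp add: rank_one_def)
    qed
    show "B = rank_one M \<Omega> (f t)"
    proof (rule bounded_ops_ext[OF B[THEN conjunct1] rank_one_bounded[OF M \<Omega>(1)]])
      fix x assume x: "x \<in> M"
      define k where "k = complex_of_real (norm x)"
      define y where "y = complex_of_real (1 / norm x) *\<^sub>C x"
      have y: "y \<in> M" "norm y \<le> 1"
        using x M by (auto simp: y_def csubspace_def norm_scaleC norm_divide)
      have xy: "x = k *\<^sub>C y" by (cases "x = 0") (simp_all add: k_def y_def scaleC_scaleC)
      show "B x = rank_one M \<Omega> (f t) x"
        unfolding xy bounded_ops_scaleC[OF B[THEN conjunct1] y(1)]
          bounded_ops_scaleC[OF rank_one_bounded[OF M \<Omega>(1)] y(1)] ball[OF y] ..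
    qed
  qed
qed

text \<open>The square of the modulus is t^2 times the projection, so the modulus is |t| times it,
  and its diagonal entries are summable by Parseval's identity.\<close>

lemma trace_class_rank_one:
  assumes t: "t \<noteq> 0"
  shows "trace_class M (rank_one M \<Omega> (complex_of_real t))"
proof -
  let ?K = "rank_one M \<Omega> (complex_of_real t)"
  have "(\<lambda>x\<in>M. cadjoint M ?K (?K x)) = rank_one M \<Omega> (complex_of_real (t\<^sup>2))"
  proof
    fix x
    show "(\<lambda>x\<in>M. cadjoint M ?K (?K x)) x = rank_one M \<Omega> (complex_of_real (t\<^sup>2)) x"
      by (cases "x \<in> M") (simp_all add: cadjoint_rank_one[OF M \<Omega>(1)] rank_one_compose power2_eq_square,
          simp add: rank_one_def)
  qed
  then have "abs_op M ?K = rank_one M \<Omega> (complex_of_real \<bar>t\<bar>)"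
    unfolding abs_op_def using cont_fun_calc_rank_one[of "t\<^sup>2" "\<lambda>t. complex_of_real (sqrt t)"] t by simp
  then have abs: "cinner (abs_op M ?K f) f = complex_of_real (\<bar>t\<bar> * (cmod (cinner \<Omega> f))\<^sup>2)" if "f \<in> M" for f
    using that by (simp add: rank_one_def cinner_scaleC_left cinner_commute[of f \<Omega>] complex_norm_square
        mult_ac flip: of_real_power)
  have "(\<lambda>f. cinner (abs_op M ?K f) f) summable_on B" if B: "orthonormal_basis M B" for B
  proof -
    have "((\<lambda>f. complex_of_real (\<bar>t\<bar> * (cmod (cinner \<Omega> f))\<^sup>2)) has_sum complex_of_real (\<bar>t\<bar> * (norm \<Omega>)\<^sup>2)) B"
      by (intro has_sum_of_real has_sum_cmult_right parseval[OF B \<Omega>(1)])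
    then have "(\<lambda>f. complex_of_real (\<bar>t\<bar> * (cmod (cinner \<Omega> f))\<^sup>2)) summable_on B"
      by (rule has_sum_imp_summable)
    moreover have "B \<subseteq> M" using B by (simp add: orthonormal_basis_def)
    ultimately show ?thesis using abs by (subst summable_on_cong) auto
  qed
  then show ?thesis unfolding trace_class_def using rank_one_bounded[OF M \<Omega>(1)] by blast
qed

end

section \<open>Principal minors and the Fredholm determinant of a rank one perturbation\<close>

lemma sum_sign_permutes_eq_0:
  assumes S: "finite S" "card S \<ge> 2"
  shows "(\<Sum>\<pi> | \<pi> permutes S. sign \<pi>) = 0"
proof -
  obtain a b where ab: "a \<in> S" "b \<in> S" "a \<noteq> b"
    using S by (metis card_le_Suc0_iff_eq not_less_eq_eq numeral_2_eq_2)
  \<comment> \<open>Composition with a transposition permutes the summands and reverses every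
    sign.\<close>
  have "(\<Sum>\<pi> | \<pi> permutes S. sign \<pi>) = (\<Sum>\<pi> | \<pi> permutes S. sign (\<pi> \<circ> Transposition.transpose a b))"
    using ab by (intro sum_permutations_compose_right permutes_swap_id) auto
  also have "\<dots> = (\<Sum>\<pi> | \<pi> permutes S. - sign \<pi>)"
  proof (intro sum.cong refl)
    fix \<pi> assume "\<pi> \<in> {\<pi>. \<pi> permutes S}"
    then have "permutation \<pi>" using S by (auto simp: permutation_permutes)
    then show "sign (\<pi> \<circ> Transposition.transpose a b) = - sign \<pi>"
      using ab by (simp add: sign_compose permutation_swap_id sign_swap_id)
  qed
  finally show ?thesis by (simp add: sum_negf)
qed

text \<open>Every entry splits as a product of a row and a column factor, and reordering the column
  factors does not change their product. All permutations therefore contribute equally up to sign,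
  so minors of size at least 2 vanish.\<close>

lemma principal_minor_rank_one:
  assumes S: "finite S" "S \<subseteq> M"
  shows "principal_minor (rank_one M \<Omega> \<kappa>) S =
    (\<Prod>e\<in>S. \<kappa> * (cmod (cinner \<Omega> e))\<^sup>2) * of_int (\<Sum>\<pi> | \<pi> permutes S. sign \<pi>)"
proof -
  have "(\<Prod>e\<in>S. cinner (rank_one M \<Omega> \<kappa> e) (\<pi> e)) = (\<Prod>e\<in>S. \<kappa> * (cmod (cinner \<Omega> e))\<^sup>2)"
    if \<pi>: "\<pi> permutes S" for \<pi>
  proof -
    have "(\<Prod>e\<in>S. cinner (rank_one M \<Omega> \<kappa> e) (\<pi> e)) = (\<Prod>e\<in>S. \<kappa> * cinner e \<Omega>) * (\<Prod>e\<in>S. cinner \<Omega> (\<pi> e))"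
      unfolding prod.distrib[symmetric] using S
      by (intro prod.cong) (auto simp: rank_one_def cinner_scaleC_left)
    also have "(\<Prod>e\<in>S. cinner \<Omega> (\<pi> e)) = (\<Prod>e\<in>S. cinner \<Omega> e)"
      using prod.permute[OF \<pi>, of "cinner \<Omega>"] by (simp add: o_def)
    also have "(\<Prod>e\<in>S. \<kappa> * cinner e \<Omega>) * (\<Prod>e\<in>S. cinner \<Omega> e) = (\<Prod>e\<in>S. \<kappa> * (cmod (cinner \<Omega> e))\<^sup>2)"
      unfolding prod.distrib[symmetric]
      by (intro prod.cong refl, simp only: cinner_commute[of _ \<Omega>] of_real_power[symmetric] complex_norm_square)
        (simp add: mult_ac)
    finally show ?thesis .
  qed
  then show ?thesis
    unfolding principal_minor_def of_int_sum sum_distrib_left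
    by (intro sum.cong refl) (simp add: mult.commute)
qed

text \<open>Only the exterior powers of degree 0 and 1 have nonzero trace; they give 1 and \<kappa>
  |\<Omega>|^2 = \<kappa>, the latter by Parseval's identity.\<close>

lemma fredholm_det_rank_one:
  assumes M: "closed_csubspace M" and \<Omega>: "\<Omega> \<in> M" "norm \<Omega> = 1"
  shows "fredholm_det M (\<lambda>x\<in>M. x + rank_one M \<Omega> \<kappa> x) = 1 + \<kappa>"
proof -
  let ?K = "rank_one M \<Omega> \<kappa>"
  let ?d = "\<lambda>k::nat. if k = 0 then 1 else if k = 1 then \<kappa> else 0"
  have eq: "(\<lambda>x\<in>M. (\<lambda>x\<in>M. x + ?K x) x - x) = ?K" by (auto simp: rank_one_def)
  have sums: "(principal_minor ?K has_sum ?d k) {S. S \<subseteq> B \<and> finite S \<and> card S = k}"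
    if B: "orthonormal_basis M B" for B k
  proof -
    have BM: "B \<subseteq> M" using B by (simp add: orthonormal_basis_def)
    consider "k = 0" | "k = 1" | "k \<ge> 2" by linarith
    then show ?thesis
    proof cases
      case 1
      have "{S. S \<subseteq> B \<and> finite S \<and> card S = k} = {{}}" using 1 by auto
      then show ?thesis using has_sum_finite[of "{{}}" "principal_minor ?K"] 1
        by (simp add: principal_minor_def)
    next
      case 2
      have *: "{S. S \<subseteq> B \<and> finite S \<and> card S = k} = (\<lambda>e. {e}) ` B"
        using 2 by (auto simp: card_1_singleton_iff)
      have "((\<lambda>e. complex_of_real ((cmod (cinner \<Omega> e))\<^sup>2)) has_sum complex_of_real ((norm \<Omega>)\<^sup>2)) B"
        by (intro has_sum_of_real parseval[OF B \<Omega>(1)])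
      then have "((\<lambda>e. \<kappa> * complex_of_real ((cmod (cinner \<Omega> e))\<^sup>2)) has_sum \<kappa>) B"
        using has_sum_cmult_right[of _ B _ \<kappa>] \<Omega>(2) by fastforce
      moreover have "principal_minor ?K {e} = \<kappa> * complex_of_real ((cmod (cinner \<Omega> e))\<^sup>2)" if "e \<in> B" for e
        using principal_minor_rank_one[of "{e}" M \<Omega> \<kappa>] subsetD[OF BM that] by simp
      ultimately have "((principal_minor ?K \<circ> (\<lambda>e. {e})) has_sum \<kappa>) B"
        by (subst has_sum_cong[where g="\<lambda>e. \<kappa> * complex_of_real ((cmod (cinner \<Omega> e))\<^sup>2)"]) auto
      then show ?thesis unfolding * using 2 by (simp add: has_sum_reindex)
    next
      case 3
      have "principal_minor ?K S = 0" if "S \<in> {S. S \<subseteq> B \<and> finite S \<and> card S = k}" for S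
        using that 3 BM by (subst principal_minor_rank_one) (auto simp: sum_sign_permutes_eq_0)
      then have "(principal_minor ?K has_sum 0) {S. S \<subseteq> B \<and> finite S \<and> card S = k}"
        by (rule has_sum_0)
      then show ?thesis using 3 by simp
    qed
  qed
  obtain B where B: "orthonormal_basis M B" using orthonormal_basis_exists[OF M] ..
  have tr: "trace_ext_power M k ?K = ?d k" for k
    unfolding trace_ext_power_def
  proof (rule the_equality)
    fix d assume "\<forall>B. orthonormal_basis M B \<longrightarrow>
      (principal_minor ?K has_sum d) {S. S \<subseteq> B \<and> finite S \<and> card S = k}"
    then show "d = ?d k" using B sums[OF B] has_sum_unique by blast
  qed (use sums in blast)
  have "(\<lambda>k. trace_ext_power M k ?K) sums (\<Sum>k\<in>{0, 1}. trace_ext_power M k ?K)"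
    by (rule sums_finite) (auto simp: tr)
  then show ?thesis unfolding fredholm_det_def eq by (simp add: tr sums_iff)
qed

section \<open>Three-term recurrences and the Joukowski map\<close>

text \<open>The characteristic roots are w and 1/w, and the limit condition removes the 1/w
  component. It holds for bounded sequences when |w| < 1 and for null sequences when |w| <= 1; both
  cases occur below.\<close>

lemma three_term_recurrence:
  fixes x :: "nat \<Rightarrow> complex"
  assumes w: "w \<noteq> 0" and rec: "\<And>n. x (n + 2) = (w + 1 / w) * x (n + 1) - x n"
    and lim: "(\<lambda>n. w ^ n * x n) \<longlonglongrightarrow> 0"
  shows "x (Suc n) = w * x n"
proof -
  \<comment> \<open>This difference isolates the component along 1/w; it satisfies w y (n + 1) = y
    n, so w^n y n is constant.\<close>
  define y where "y n = x (Suc n) - w * x n" for n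
  have step: "w * y (Suc n) = y n" for n
    using rec[of n] w by (simp add: y_def field_simps)
  have const: "w ^ n * y n = y 0" for n
  proof (induction n)
    case (Suc n)
    have "w ^ Suc n * y (Suc n) = w ^ n * (w * y (Suc n))" by simp
    then show ?case by (simp only: step Suc.IH)
  qed simp
  have "(\<lambda>n. w ^ Suc n * x (Suc n) - w\<^sup>2 * (w ^ n * x n)) \<longlonglongrightarrow> 0 - w\<^sup>2 * 0"
    by (intro tendsto_intros LIMSEQ_Suc[OF lim] lim)
  moreover have "w ^ Suc n * x (Suc n) - w\<^sup>2 * (w ^ n * x n) = w * y 0" for n
    unfolding const[of n, symmetric] by (simp add: y_def power2_eq_square algebra_simps)
  ultimately have "w * y 0 = 0" by (simp add: LIMSEQ_const_iff)
  then have "y 0 = 0" using w by simp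
  then have "y n = 0" using const[of n] w by simp
  then show ?thesis by (simp add: y_def)
qed

text \<open>The two roots of w^2 - u w + 1 have product 1, so one of them lies in the closed unit
  disc. The boundary case cannot be excluded here, because u may lie in [-2, 2].\<close>

lemma joukowski_surj:
  obtains w :: complex where "w \<noteq> 0" "cmod w \<le> 1" "u = w + 1 / w"
proof -
  define w where "w = (u + csqrt (u\<^sup>2 - 4)) / 2"
  have "(u + csqrt (u\<^sup>2 - 4)) * (u - csqrt (u\<^sup>2 - 4)) = u\<^sup>2 - (csqrt (u\<^sup>2 - 4))\<^sup>2"
    by (simp add: power2_eq_square algebra_simps)
  then have *: "w * (u - w) = 1" by (simp add: w_def field_simps)
  then have w: "w \<noteq> 0" by auto
  have u: "u = w + 1 / w" using * w by (simp add: field_simps)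
  show ?thesis
  proof (cases "cmod w \<le> 1")
    case True then show ?thesis using that w u by blast
  next
    case False
    then show ?thesis using that[of "1 / w"] w u by (simp add: norm_divide add.commute)
  qed
qed

text \<open>For real t in [-2, 2] both roots of w^2 - t w + 1 lie on the unit circle, being
  conjugate with product 1.\<close>

lemma joukowski_not_in_interval:
  assumes w: "w \<noteq> 0" "cmod w < 1" and t: "\<bar>t\<bar> \<le> 2"
  shows "w + 1 / w \<noteq> complex_of_real t"
proof
  assume eq: "w + 1 / w = complex_of_real t"
  define \<tau> where "\<tau> = arccos (t / 2)"
  have "cos \<tau> = t / 2" unfolding \<tau>_def using t by (intro cos_arccos) auto
  then have t2: "complex_of_real t = cis \<tau> + cis (- \<tau>)" by (simp add: complex_eq_iff)
  have one: "cis \<tau> * cis (- \<tau>) = 1" by (simp add: cis_mult)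
  have "w * w + 1 = complex_of_real t * w" using eq w by (simp add: field_simps)
  then have "(w - cis \<tau>) * (w - cis (- \<tau>)) = 0"
    using t2 one by (simp add: algebra_simps)
  then have "w = cis \<tau> \<or> w = cis (- \<tau>)" by auto
  then have "cmod w = 1" by auto
  then show False using w by simp
qed

section \<open>Cauchy transforms of sines\<close>

text \<open>\<open>sine_fun n t\<close> is \<open>sin (n \<theta>)\<close> for the angle \<open>\<theta> \<in> [-\<pi>, 0]\<close> with \<open>t = 2 cos \<theta>\<close>.\<close>

definition sine_fun :: "nat \<Rightarrow> real \<Rightarrow> real" where
  "sine_fun n t = (if \<bar>t\<bar> \<le> 2 then - sin (real n * arccos (t / 2)) else 0)"

lemma abs_sine_fun_le: "\<bar>sine_fun n t\<bar> \<le> 1"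
  by (simp add: sine_fun_def)

lemma sine_fun_0 [simp]: "sine_fun 0 t = 0"
  by (simp add: sine_fun_def)

text \<open>With t = 2 cos \<tau> this is the addition formula behind the Chebyshev recurrence, the
  same three-term relation as in the Jacobi matrix of the operators.\<close>

lemma sine_fun_rec: "sine_fun (n + 2) t + sine_fun n t = t * sine_fun (n + 1) t"
proof (cases "\<bar>t\<bar> \<le> 2")
  case True
  define \<tau> where "\<tau> = arccos (t / 2)"
  have "cos \<tau> = t / 2" unfolding \<tau>_def using True by (intro cos_arccos) auto
  then have t: "t = 2 * cos \<tau>" by simp
  have "sin (real (n + 2) * \<tau>) + sin (real n * \<tau>) = 2 * cos \<tau> * sin (real (n + 1) * \<tau>)"
    using sin_add[of "real (n + 1) * \<tau>" \<tau>] sin_diff[of "real (n + 1) * \<tau>" \<tau>]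
    by (simp add: algebra_simps)
  then show ?thesis using True unfolding sine_fun_def \<tau>_def[symmetric]
    by (simp only: if_True t[symmetric])
qed (simp add: sine_fun_def)

lemma sine_fun_eq_indicator:
  assumes "a > 0"
  shows "sine_fun n (x / a) = indicator {- 2 * a..2 * a} x *\<^sub>R - sin (real n * arccos (x / (2 * a)))"
  using assms by (auto simp: sine_fun_def indicator_def field_simps abs_le_iff)

lemma continuous_on_sin_arccos:
  assumes "a > 0"
  shows "continuous_on {- 2 * a..2 * a} (\<lambda>x. - sin (real n * arccos (x / (2 * a))))"
  using assms by (intro continuous_intros) (auto simp: field_simps)

text \<open>Substitution x = 2 a cos \<tau>, which reverses the orientation: x runs upwards while
  \<tau> runs from pi down to 0.\<close>

lemma integral_sine_fun:
  assumes a: "a > 0"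
    and G: "\<And>\<tau>. (G has_real_derivative 2 * a * sin \<tau> * sin (real n * \<tau>)) (at \<tau>)"
  shows "integrable lborel (\<lambda>x. sine_fun n (x / a))"
    and "(LINT x|lborel. sine_fun n (x / a)) = G 0 - G pi"
proof -
  show int: "integrable lborel (\<lambda>x. sine_fun n (x / a))"
    unfolding sine_fun_eq_indicator[OF a]
    by (intro borel_integrable_compact continuous_on_sin_arccos a compact_Icc)
  have "((\<lambda>x. - sin (real n * arccos (x / (2 * a)))) has_integral
      (G (arccos (2 * a / (2 * a))) - G (arccos (- 2 * a / (2 * a))))) {- 2 * a..2 * a}"
  \<comment> \<open>The arccosine is not differentiable at the end points, so only continuity is
    available there.\<close>
  proof (rule fundamental_theorem_of_calculus_interior)
    have "continuous_on UNIV G" by (rule DERIV_continuous_on, rule DERIV_subset[OF G]) auto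
    moreover have "continuous_on {- 2 * a..2 * a} (\<lambda>x. arccos (x / (2 * a)))"
      using a by (intro continuous_intros) (auto simp: field_simps)
    ultimately show "continuous_on {- 2 * a..2 * a} (\<lambda>x. G (arccos (x / (2 * a))))"
      using continuous_on_compose2[of UNIV G] by blast
    fix x assume x: "x \<in> {- 2 * a<..<2 * a}"
    define \<tau> where "\<tau> = arccos (x / (2 * a))"
    have x1: "- 1 < x / (2 * a)" "x / (2 * a) < 1" using x a by (auto simp: field_simps)
    have sin: "sin \<tau> = sqrt (1 - (x / (2 * a))\<^sup>2)"
      unfolding \<tau>_def using x1 by (intro sin_arccos) auto
    have "(x / (2 * a))\<^sup>2 < 1" using x1 by (simp add: abs_square_less_1)
    then have sin0: "sin \<tau> > 0" by (simp add: sin)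
    have "((\<lambda>x. arccos (x / (2 * a))) has_real_derivative inverse (- sqrt (1 - (x / (2 * a))\<^sup>2)) * (1 / (2 * a))) (at x)"
      using a by (intro DERIV_chain2[OF DERIV_arccos] x1) (auto intro!: derivative_eq_intros)
    from DERIV_chain2[OF G this[folded sin]]
    have "((\<lambda>x. G (arccos (x / (2 * a)))) has_real_derivative
        2 * a * sin \<tau> * sin (real n * \<tau>) * (inverse (- sin \<tau>) * (1 / (2 * a)))) (at x)"
      unfolding \<tau>_def .
    then show "((\<lambda>x. G (arccos (x / (2 * a)))) has_vector_derivative - sin (real n * arccos (x / (2 * a)))) (at x)"
      unfolding has_real_derivative_iff_has_vector_derivative[symmetric] \<tau>_def[symmetric]
      using a sin0 by (simp add: field_simps)
  qed (use a in auto)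
  then have "((\<lambda>x. - sin (real n * arccos (x / (2 * a)))) has_integral (G 0 - G pi)) {- 2 * a..2 * a}"
    using a by simp
  then have "((\<lambda>x. if x \<in> {- 2 * a..2 * a} then - sin (real n * arccos (x / (2 * a))) else 0) has_integral (G 0 - G pi)) UNIV"
    by (simp only: has_integral_restrict_UNIV)
  also have "(\<lambda>x. if x \<in> {- 2 * a..2 * a} then - sin (real n * arccos (x / (2 * a))) else 0) = (\<lambda>x. sine_fun n (x / a))"
    unfolding sine_fun_eq_indicator[OF a] by (auto simp: indicator_def)
  finally show "(LINT x|lborel. sine_fun n (x / a)) = G 0 - G pi"
    using has_integral_integral_lborel[OF int] has_integral_unique by blast
qed

lemma integral_sine_fun_Suc:
  assumes a: "a > 0"
  shows "integrable lborel (\<lambda>x. sine_fun (Suc n) (x / a))"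
    and "(LINT x|lborel. sine_fun (Suc n) (x / a)) = (if n = 0 then - a * pi else 0)"
proof -
  \<comment> \<open>Antiderivative from the product-to-sum formula. For n = 0 one of the two cosines
    is the constant 1, which integrates to a linear term; it is the only one that differs between 0
    and pi.\<close>
  define G where "G \<tau> = (if n = 0 then a * (\<tau> - sin (2 * \<tau>) / 2)
    else a * (sin (real n * \<tau>) / real n - sin (real (n + 2) * \<tau>) / real (n + 2)))" for \<tau> :: real
  have G: "(G has_real_derivative 2 * a * sin \<tau> * sin (real (Suc n) * \<tau>)) (at \<tau>)" for \<tau>
  proof (cases "n = 0")
    case True
    have "((\<lambda>\<tau>. a * (\<tau> - sin (2 * \<tau>) / 2)) has_real_derivative a * (1 - cos (2 * \<tau>))) (at \<tau>)"
      by (auto intro!: derivative_eq_intros)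
    moreover have "a * (1 - cos (2 * \<tau>)) = 2 * a * sin \<tau> * sin (real (Suc n) * \<tau>)"
      unfolding cos_double_sin using True by (simp add: power2_eq_square)
    ultimately show ?thesis unfolding G_def using True by simp
  next
    case False
    have "cos (real n * \<tau>) - cos (real (n + 2) * \<tau>) = 2 * sin \<tau> * sin (real (Suc n) * \<tau>)"
      using cos_add[of "real (Suc n) * \<tau>" \<tau>] cos_diff[of "real (Suc n) * \<tau>" \<tau>]
      by (simp add: algebra_simps)
    then have *: "a * (cos (real n * \<tau>) - cos (real (n + 2) * \<tau>)) = 2 * a * sin \<tau> * sin (real (Suc n) * \<tau>)"
      by simp
    have d: "((\<lambda>\<tau>. sin (k * \<tau>) / k) has_real_derivative cos (k * \<tau>)) (at \<tau>)" if "k > 0" for k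
      using that by (auto intro!: derivative_eq_intros)
    have "((\<lambda>\<tau>. a * (sin (real n * \<tau>) / real n - sin (real (n + 2) * \<tau>) / real (n + 2)))
        has_real_derivative a * (cos (real n * \<tau>) - cos (real (n + 2) * \<tau>))) (at \<tau>)"
      using False by (intro DERIV_cmult DERIV_diff d) auto
    then show ?thesis unfolding G_def *[symmetric] using False by simp
  qed
  show "integrable lborel (\<lambda>x. sine_fun (Suc n) (x / a))"
    by (rule integral_sine_fun(1)[OF a G])
  have "sin (pi * real n) = 0" "sin (pi * real (n + 2)) = 0" by (simp_all only: sin_npi2)
  then have "G 0 - G pi = (if n = 0 then - a * pi else 0)" by (simp add: G_def mult.commute)
  then show "(LINT x|lborel. sine_fun (Suc n) (x / a)) = (if n = 0 then - a * pi else 0)"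
    using integral_sine_fun(2)[OF a G] by simp
qed

lemma integrable_indicator_div:
  assumes off: "\<And>x. x \<in> {- 2 * a..2 * a} \<Longrightarrow> complex_of_real x \<noteq> s"
    and f: "continuous_on {- 2 * a..2 * a} f"
  shows "integrable lborel (\<lambda>x::real. indicator {- 2 * a..2 * a} x *\<^sub>R (complex_of_real (f x) / (of_real x - s)))"
  using assms by (intro borel_integrable_compact continuous_intros) auto

text \<open>The transforms inherit the sine recurrence up to an integral that is nonzero only for
  the first sine. They are bounded in n, hence geometric with ratio w, and the exceptional equation
  at n = 0 fixes the factor pi.\<close>

lemma cauchy_transform_sine_fun:
  assumes a: "a > 0" and w: "w \<noteq> 0" "cmod w < 1" and s: "s = of_real a * (w + 1 / w)"
  shows "integrable lborel (\<lambda>x. complex_of_real (sine_fun n (x / a)) / (of_real x - s))"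
    and "(LINT x|lborel. complex_of_real (sine_fun n (x / a)) / (of_real x - s)) = (if n = 0 then 0 else of_real pi * w ^ n)"
    and "integrable lborel (\<lambda>x. indicator {- 2 * a..2 * a} x / cmod (of_real x - s))"
proof -
  have off: "complex_of_real x \<noteq> s" if "x \<in> {- 2 * a..2 * a}" for x
  proof
    assume "complex_of_real x = s"
    then have "w + 1 / w = complex_of_real (x / a)" using s a by (simp add: field_simps)
    moreover have "\<bar>x / a\<bar> \<le> 2" using that a by (auto simp: field_simps abs_le_iff)
    ultimately show False using joukowski_not_in_interval[OF w] by blast
  qed
  let ?f = "\<lambda>n x. complex_of_real (sine_fun n (x / a)) / (of_real x - s)"
  have int: "integrable lborel (?f n)" for n
    using integrable_indicator_div[OF off continuous_on_sin_arccos[OF a], of n]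
    unfolding sine_fun_eq_indicator[OF a] by (simp add: scaleR_conv_of_real mult.assoc)
  show "integrable lborel (?f n)" by (rule int)
  have "integrable lborel (\<lambda>x::real. indicator {- 2 * a..2 * a} x *\<^sub>R (complex_of_real 1 / (of_real x - s)))"
    by (rule integrable_indicator_div[OF off]) auto
  from integrable_norm[OF this]
  show int1: "integrable lborel (\<lambda>x. indicator {- 2 * a..2 * a} x / cmod (of_real x - s))"
    by (simp add: norm_divide)
  define C where "C = (LINT x|lborel. indicator {- 2 * a..2 * a} x / cmod (of_real x - s))"
  define J where "J n = integral\<^sup>L lborel (?f n)" for n
  have J0: "J 0 = 0" by (simp add: J_def)
  have bound: "cmod (J n) \<le> C" for n
    unfolding J_def C_def
  proof (rule Bochner_Integration.integral_norm_bound_integral[OF int int1])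
    fix x
    have "\<bar>sine_fun n (x / a)\<bar> \<le> indicator {- 2 * a..2 * a} x"
      unfolding sine_fun_eq_indicator[OF a] by (auto simp: indicator_def)
    then show "cmod (?f n x) \<le> indicator {- 2 * a..2 * a} x / cmod (of_real x - s)"
      by (simp add: norm_divide divide_right_mono)
  qed
  have rec: "J (n + 2) + J n = (w + 1 / w) * J (n + 1) + (if n = 0 then - of_real pi else 0)" for n
  proof -
    let ?I = "LINT x|lborel. sine_fun (Suc n) (x / a)"
    have alg: "(A + B * d) * (S / d) = A * (S / d) + B * S" if "d \<noteq> 0" for A B d S :: complex
      using that by (simp add: field_simps)
    have intS: "integrable lborel (\<lambda>x. complex_of_real (sine_fun (Suc n) (x / a)))"
      by (rule integrable_of_real[OF integral_sine_fun_Suc(1)[OF a]])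
    have "?f (n + 2) x + ?f n x = (w + 1 / w) * ?f (n + 1) x + of_real (1 / a) * complex_of_real (sine_fun (Suc n) (x / a))" for x
    proof (cases "x \<in> {- 2 * a..2 * a}")
      case True
      have ne: "complex_of_real x - s \<noteq> 0" using off[OF True] by simp
      have "?f (n + 2) x + ?f n x = of_real (sine_fun (n + 2) (x / a) + sine_fun n (x / a)) / (of_real x - s)"
        by (simp add: add_divide_distrib)
      also have "\<dots> = of_real (x / a) * ?f (n + 1) x"
        unfolding sine_fun_rec by simp
      \<comment> \<open>Writing x as s plus x - s splits off a part in which the denominator
        cancels; this is the inhomogeneous term.\<close>
      also have "complex_of_real (x / a) = (w + 1 / w) + of_real (1 / a) * (of_real x - s)"
        using s a by (simp add: field_simps)
      also have "\<dots> * ?f (n + 1) x = (w + 1 / w) * ?f (n + 1) x + of_real (1 / a) * complex_of_real (sine_fun (Suc n) (x / a))"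
        unfolding Suc_eq_plus1 by (rule alg[OF ne])
      finally show ?thesis .
    next
      case False
      then have "sine_fun k (x / a) = 0" for k
        unfolding sine_fun_eq_indicator[OF a] by simp
      then show ?thesis by simp
    qed
    then have "(LINT x|lborel. ?f (n + 2) x + ?f n x) = (LINT x|lborel. (w + 1 / w) * ?f (n + 1) x + of_real (1 / a) * complex_of_real (sine_fun (Suc n) (x / a)))"
      by simp
    also have "\<dots> = (w + 1 / w) * J (n + 1) + of_real (1 / a) * of_real ?I"
      unfolding J_def Bochner_Integration.integral_add[OF integrable_mult_right[OF int] integrable_mult_right[OF intS]]
        integral_mult_right_zero integral_complex_of_real ..
    also have "(LINT x|lborel. ?f (n + 2) x + ?f n x) = J (n + 2) + J n"
      unfolding J_def by (rule Bochner_Integration.integral_add[OF int int])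
    finally show ?thesis using a by (simp add: integral_sine_fun_Suc(2)[OF a])
  qed
  have geo: "J (Suc (Suc n)) = w * J (Suc n)" for n
  \<comment> \<open>The index is shifted by one since the recurrence is homogeneous only from n = 1
    on.\<close>
  proof (rule three_term_recurrence[of w "\<lambda>n. J (Suc n)", OF w(1)])
    show "J (Suc (n + 2)) = (w + 1 / w) * J (Suc (n + 1)) - J (Suc n)" for n
      using rec[of "Suc n"] by (simp add: eq_diff_eq)
    show "(\<lambda>n. w ^ n * J (Suc n)) \<longlonglongrightarrow> 0"
    proof (rule Lim_null_comparison)
      show "\<forall>\<^sub>F n in sequentially. norm (w ^ n * J (Suc n)) \<le> cmod w ^ n * C"
        using bound by (intro always_eventually allI) (simp add: norm_mult norm_power mult_left_mono)
      show "(\<lambda>n. cmod w ^ n * C) \<longlonglongrightarrow> 0"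
        using w(2) by (intro tendsto_mult_left_zero LIMSEQ_power_zero) simp
    qed
  qed
  have "J 2 = (w + 1 / w) * J 1 - of_real pi" using rec[of 0] J0 by (simp add: numeral_2_eq_2)
  moreover have "J 2 = w * J 1" using geo[of 0] by (simp add: numeral_2_eq_2)
  ultimately have "J 1 / w = of_real pi" by (simp add: distrib_right)
  then have J1: "J 1 = of_real pi * w" using w(1) by (simp add: field_simps)
  have "J (Suc n) = of_real pi * w ^ Suc n" for n
    by (induction n) (use J1 geo in \<open>simp_all add: mult_ac\<close>)
  then show "integral\<^sup>L lborel (?f n) = (if n = 0 then 0 else of_real pi * w ^ n)"
    unfolding J_def[symmetric] using J0 by (cases n) auto
qed

section \<open>Double series of sines\<close>

lemma integral_lborel_prod_mult:
  fixes f g :: "real \<Rightarrow> 'a::{real_normed_field, banach, second_countable_topology}"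
  assumes f: "integrable lborel f" and g: "integrable lborel g"
  shows "integrable lborel (\<lambda>(x, y). f x * g y)"
    and "(LINT (x, y)|lborel. f x * g y) = (LINT x|lborel. f x) * (LINT y|lborel. g y)"
proof -
  have [measurable]: "f \<in> borel_measurable lborel" "g \<in> borel_measurable lborel"
    using f g by auto
  have int: "integrable (lborel \<Otimes>\<^sub>M lborel) (\<lambda>p. f (fst p) * g (snd p))"
  proof (rule lborel_pair.Fubini_integrable)
    show "(\<lambda>p. f (fst p) * g (snd p)) \<in> borel_measurable (lborel \<Otimes>\<^sub>M lborel)" by measurable
    show "integrable lborel (\<lambda>x. LINT y|lborel. norm (f (fst (x, y)) * g (snd (x, y))))"
      using f by (simp add: norm_mult)
    show "AE x in lborel. integrable lborel (\<lambda>y. f (fst (x, y)) * g (snd (x, y)))"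
      using g by simp
  qed
  then show "integrable lborel (\<lambda>(x, y). f x * g y)"
    by (simp add: lborel_prod case_prod_unfold)
  have "(LINT x|lborel. LINT y|lborel. f (fst (x, y)) * g (snd (x, y))) = integral\<^sup>L (lborel \<Otimes>\<^sub>M lborel) (\<lambda>p. f (fst p) * g (snd p))"
    by (rule lborel_pair.integral_fst'[OF int])
  then show "(LINT (x, y)|lborel. f x * g y) = (LINT x|lborel. f x) * (LINT y|lborel. g y)"
    by (simp add: lborel_prod case_prod_unfold)
qed

text \<open>Termwise integration, dominated by F(x) G(y) times the absolutely convergent
  coefficients. The field is left general: complex for the Cauchy transforms, real for integrability
  of the principal function.\<close>

lemma integral_double_series:
  fixes f g :: "nat \<Rightarrow> real \<Rightarrow> 'a::{real_normed_field, banach, second_countable_topology}"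
  assumes c: "summable (\<lambda>n. norm (c n))"
    and f: "\<And>n. integrable lborel (f n)" and g: "\<And>n. integrable lborel (g n)"
    and f_le: "\<And>n x. norm (f n x) \<le> F x" and g_le: "\<And>n y. norm (g n y) \<le> G y"
    and F: "integrable lborel F" and G: "integrable lborel G"
  shows "\<And>x y. summable (\<lambda>n. c n * (f n x * g n y))"
    and "integrable lborel (\<lambda>(x, y). (\<Sum>n. c n * (f n x * g n y)))"
    and "(\<lambda>n. c n * (integral\<^sup>L lborel (f n) * integral\<^sup>L lborel (g n))) sums
      (LINT (x, y)|lborel. (\<Sum>n. c n * (f n x * g n y)))"
proof -
  have le: "norm (c n * (f n x * g n y)) \<le> norm (c n) * (F x * G y)" for n x y
    unfolding norm_mult using f_le g_le order_trans[OF norm_ge_zero f_le]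
    by (intro mult_left_mono mult_mono) auto
  have sm: "summable (\<lambda>n. norm (c n * (f n x * g n y)))" for x y
    using le by (intro summable_comparison_test'[OF summable_mult2[OF c, of "F x * G y"]]) auto
  then show "summable (\<lambda>n. c n * (f n x * g n y))" for x y by (rule summable_norm_cancel)
  let ?h = "\<lambda>n p. c n * (f n (fst p) * g n (snd p))"
  have int: "integrable lborel (?h n)" for n
    using integral_lborel_prod_mult(1)[OF f g, of n n] unfolding case_prod_unfold
    by (rule integrable_mult_right)
  have ae: "AE p in lborel. summable (\<lambda>n. norm (?h n p))" using sm by simp
  have sm2: "summable (\<lambda>n. LINT p|lborel. norm (?h n p))"
  proof (rule summable_comparison_test'[OF summable_mult2[OF c, of "LINT (x, y)|lborel. F x * G y"]])
    fix n :: nat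
    have "(LINT p|lborel. norm (?h n p)) \<le> (LINT p|lborel. norm (c n) * (F (fst p) * G (snd p)))"
      using integral_lborel_prod_mult(1)[OF F G] le
      by (intro integral_mono integrable_norm int) (auto simp: case_prod_unfold)
    then show "norm (LINT p|lborel. norm (?h n p)) \<le> norm (c n) * (LINT (x, y)|lborel. F x * G y)"
      by (simp add: case_prod_unfold)
  qed
  show "integrable lborel (\<lambda>(x, y). (\<Sum>n. c n * (f n x * g n y)))"
    using integrable_suminf[OF int ae sm2] by (simp add: case_prod_unfold)
  have e: "integral\<^sup>L lborel (?h n) = c n * (integral\<^sup>L lborel (f n) * integral\<^sup>L lborel (g n))" for n
    using integral_lborel_prod_mult(2)[OF f g, of n n] by (simp add: case_prod_unfold)
  show "(\<lambda>n. c n * (integral\<^sup>L lborel (f n) * integral\<^sup>L lborel (g n))) sums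
      (LINT (x, y)|lborel. (\<Sum>n. c n * (f n x * g n y)))"
    using sums_integral[OF int ae sm2] unfolding e case_prod_unfold .
qed

text \<open>Imaginary part of the power series of ln (1 - z). The term with n = 0 is 0 because
  division by zero yields 0.\<close>

lemma Arg_one_minus_sums:
  assumes "0 \<le> r" "r < 1"
  shows "(\<lambda>n. - (r ^ n * sin (real n * \<alpha>) / real n)) sums Arg (1 - r * exp (\<i> * complex_of_real \<alpha>))"
proof -
  let ?z = "r * exp (\<i> * complex_of_real \<alpha>)"
  have z: "cmod ?z < 1" using assms by (simp add: norm_mult)
  then have ne: "1 - ?z \<noteq> 0" by (metis eq_iff_diff_eq_0 norm_one order_less_irrefl)
  have "(\<lambda>n. - (?z ^ n) / of_nat n) sums ln (1 - ?z)"
    using Ln_series'[of "- ?z"] z by simp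
  from sums_Im[OF this] have "(\<lambda>n. Im (- (?z ^ n) / of_nat n)) sums Arg (1 - ?z)"
    using Arg_eq_Im_Ln[OF ne] by simp
  moreover have "Im (- (?z ^ n) / of_nat n) = - (r ^ n * sin (real n * \<alpha>) / real n)" for n
  proof -
    have "?z ^ n = of_real (r ^ n) * cis (real n * \<alpha>)"
      by (simp add: power_mult_distrib cis_conv_exp[symmetric] Complex.DeMoivre mult.commute[of _ \<i>])
    then show ?thesis by simp
  qed
  ultimately show ?thesis by (simp only:)
qed

text \<open>For r < 1 the number has positive real part, where the principal argument is the
  arctangent of the slope.\<close>

lemma Arg_one_minus_eq_arctan:
  assumes "0 \<le> r" "r < 1"
  shows "Arg (1 - r * exp (\<i> * complex_of_real \<alpha>)) = - arctan (r * sin \<alpha> / (1 - r * cos \<alpha>))"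
proof -
  have "r * cos \<alpha> \<le> r * 1" using assms by (intro mult_left_mono) auto
  then have "Re (1 - r * exp (\<i> * complex_of_real \<alpha>)) > 0"
    using assms by (simp add: Re_exp)
  then show ?thesis by (simp add: arg_conv_arctan Re_exp Im_exp flip: arctan_minus)
qed

section \<open>The angles, the sum of the sine series and its double Cauchy transform\<close>

lemma theta_eq:
  assumes t: "\<bar>t\<bar> \<le> 2"
  shows "theta t = - arccos (t / 2)"
proof -
  have ac: "0 \<le> arccos (t / 2)" "arccos (t / 2) \<le> pi" "cos (arccos (t / 2)) = t / 2"
    using t by (auto intro!: arccos_lbound arccos_ubound cos_arccos)
  have "t\<^sup>2 \<le> 2\<^sup>2" using t by (metis abs_ge_zero power2_abs power_mono)
  have "sin (arccos (t / 2)) = sqrt (1 - (t / 2)\<^sup>2)" using t by (intro sin_arccos) auto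
  also have "\<dots> = sqrt ((4 - t\<^sup>2) / 2\<^sup>2)" by (simp add: power_divide field_simps)
  also have "\<dots> = sqrt (4 - t\<^sup>2) / 2" by (simp add: real_sqrt_divide)
  finally have sin: "sin (arccos (t / 2)) = sqrt (4 - t\<^sup>2) / 2" .
  show ?thesis unfolding theta_def
  proof (rule the_equality)
    show "- pi \<le> - arccos (t / 2) \<and> - arccos (t / 2) \<le> 0 \<and>
      exp (\<i> * complex_of_real (- arccos (t / 2))) = zeta t"
      using ac sin unfolding cis_conv_exp[symmetric] zeta_def by (simp add: complex_eq_iff)
    fix \<theta> assume \<theta>: "- pi \<le> \<theta> \<and> \<theta> \<le> 0 \<and> exp (\<i> * complex_of_real \<theta>) = zeta t"
    then have "Re (cis \<theta>) = Re (zeta t)" by (simp add: cis_conv_exp)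
    then have c: "cos (- \<theta>) = t / 2" by (simp add: zeta_def)
    have "arccos (cos (- \<theta>)) = - \<theta>" using \<theta> by (intro arccos_cos) auto
    then show "\<theta> = - arccos (t / 2)" unfolding c by simp
  qed
qed

text \<open>The candidate for the principal function, with \<open>t\<close> = \<delta> / |v2| and
  \<open>u\<close> = \<gamma> / |v1|. The constant is forced by -(4 / pi) * pi^2 / (2 pi \<i>) = 2
  \<i>: each Cauchy transform contributes a factor pi, and 2 \<i> r^n sin (n \<phi>) = c^n - cnj
  c^n.\<close>

definition sine_series :: "real \<Rightarrow> real \<Rightarrow> real \<Rightarrow> real \<Rightarrow> real" where
  "sine_series r \<phi> t u = (\<Sum>n. - (4 / pi) * (r ^ n * sin (real n * \<phi>) / real n) * (sine_fun n t * sine_fun n u))"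

text \<open>A product of three sines is a quarter of a signed sum of four sines, so termwise the
  series is a combination of four series of \<open>Arg_one_minus_sums\<close>.\<close>

lemma sine_series_eq:
  assumes r: "0 \<le> r" "r < 1" and tu: "\<bar>t\<bar> \<le> 2" "\<bar>u\<bar> \<le> 2"
  defines "\<theta>1 \<equiv> theta u" and "\<theta>2 \<equiv> theta t"
  shows "sine_series r \<phi> t u = 1 / pi *
            (Arg (1 - r * exp (\<i> * complex_of_real (- \<phi> + \<theta>1 + \<theta>2)))
             + Arg (1 - r * exp (\<i> * complex_of_real (\<phi> - \<theta>1 + \<theta>2)))
             - Arg (1 - r * exp (\<i> * complex_of_real (\<phi> + \<theta>1 + \<theta>2)))
             - Arg (1 - r * exp (\<i> * complex_of_real (- \<phi> - \<theta>1 + \<theta>2))))"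
proof -
  have sf: "sine_fun n t = sin (real n * \<theta>2)" "sine_fun n u = sin (real n * \<theta>1)" for n
    using tu by (simp_all add: sine_fun_def \<theta>1_def \<theta>2_def theta_eq)
  let ?A = "\<lambda>n \<alpha>. - (r ^ n * sin (real n * \<alpha>) / real n)"
  have trig: "sin (- p + x + y) + sin (p - x + y) - sin (p + x + y) - sin (- p - x + y) = 4 * sin p * sin x * sin y"
    for p x y :: real
    by (simp add: sin_add sin_diff cos_add cos_diff algebra_simps)
  have "- (4 / pi) * (r ^ n * sin (real n * \<phi>) / real n) * (sine_fun n t * sine_fun n u)
      = 1 / pi * (?A n (- \<phi> + \<theta>1 + \<theta>2) + ?A n (\<phi> - \<theta>1 + \<theta>2) - ?A n (\<phi> + \<theta>1 + \<theta>2) - ?A n (- \<phi> - \<theta>1 + \<theta>2))" for n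
  proof -
    have e: "real n * (- \<phi> + \<theta>1 + \<theta>2) = - (real n * \<phi>) + real n * \<theta>1 + real n * \<theta>2"
      "real n * (\<phi> - \<theta>1 + \<theta>2) = real n * \<phi> - real n * \<theta>1 + real n * \<theta>2"
      "real n * (\<phi> + \<theta>1 + \<theta>2) = real n * \<phi> + real n * \<theta>1 + real n * \<theta>2"
      "real n * (- \<phi> - \<theta>1 + \<theta>2) = - (real n * \<phi>) - real n * \<theta>1 + real n * \<theta>2"
      by (simp_all add: algebra_simps)
    have "?A n (- \<phi> + \<theta>1 + \<theta>2) + ?A n (\<phi> - \<theta>1 + \<theta>2) - ?A n (\<phi> + \<theta>1 + \<theta>2) - ?A n (- \<phi> - \<theta>1 + \<theta>2)
      = - (r ^ n / real n) * (sin (real n * (- \<phi> + \<theta>1 + \<theta>2)) + sin (real n * (\<phi> - \<theta>1 + \<theta>2))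
        - sin (real n * (\<phi> + \<theta>1 + \<theta>2)) - sin (real n * (- \<phi> - \<theta>1 + \<theta>2)))"
      by (simp add: right_diff_distrib distrib_left)
    also have "\<dots> = - (r ^ n / real n) * (4 * sin (real n * \<phi>) * sin (real n * \<theta>1) * sin (real n * \<theta>2))"
      unfolding e trig ..
    finally show ?thesis by (simp add: sf mult_ac)
  qed
  then show ?thesis unfolding sine_series_def
    by (simp only:) (intro sums_unique[symmetric] sums_mult sums_add sums_diff Arg_one_minus_sums r)
qed

lemma summable_sine_coeff:
  assumes r: "0 \<le> r" "r < (1::real)"
  shows "summable (\<lambda>n. \<bar>- (4 / pi) * (r ^ n * sin (real n * \<phi>) / real n)\<bar>)"
proof (rule summable_comparison_test'[OF summable_mult[OF summable_geometric[of r], of "4 / pi"]])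
  show "norm r < 1" using r by simp
  fix n :: nat
  have "\<bar>sin (real n * \<phi>)\<bar> / real n \<le> 1"
    by (cases "n = 0") (auto simp: divide_le_eq intro: order_trans[OF abs_sin_le_one])
  then have "r ^ n * (\<bar>sin (real n * \<phi>)\<bar> / real n) \<le> r ^ n * 1"
    using r by (intro mult_left_mono) auto
  then have "4 / pi * (r ^ n * (\<bar>sin (real n * \<phi>)\<bar> / real n)) \<le> 4 / pi * r ^ n"
    by (intro mult_left_mono) auto
  then show "norm \<bar>- (4 / pi) * (r ^ n * sin (real n * \<phi>) / real n)\<bar> \<le> 4 / pi * r ^ n"
    using r by (simp add: abs_mult)
qed

text \<open>Each term separates the variables, so its double transform is pi^2 (w z)^n times the
  coefficient. What remains is the difference of two logarithm series, and exponentiation turns it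
  into the quotient.\<close>

lemma sine_series_cauchy_transform:
  fixes \<phi> :: real
  assumes r: "0 \<le> r" "r < 1" and ab: "a > 0" "b > 0"
    and w: "w \<noteq> 0" "cmod w < 1" and s: "s = of_real a * (w + 1 / w)"
    and z: "z \<noteq> 0" "cmod z < 1" and l: "l = of_real b * (z + 1 / z)"
  defines "c \<equiv> r * exp (\<i> * complex_of_real \<phi>)"
  shows "integrable lborel (\<lambda>(\<delta>, \<gamma>). complex_of_real (sine_series r \<phi> (\<delta> / b) (\<gamma> / a)) / ((\<delta> - l) * (\<gamma> - s)))"
    and "exp (1 / (2 * pi * \<i>) *
      (LINT (\<delta>, \<gamma>)|lborel. complex_of_real (sine_series r \<phi> (\<delta> / b) (\<gamma> / a)) / ((\<delta> - l) * (\<gamma> - s))))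
      = (1 - w * z * cnj c) / (1 - w * z * c)"
proof -
  define k where "k n = - (4 / pi) * (r ^ n * sin (real n * \<phi>) / real n)" for n
  have k: "summable (\<lambda>n. norm (complex_of_real (k n)))"
    unfolding k_def norm_of_real by (rule summable_sine_coeff[OF r])
  let ?f = "\<lambda>n x. complex_of_real (sine_fun n (x / b)) / (of_real x - l)"
  let ?g = "\<lambda>n y. complex_of_real (sine_fun n (y / a)) / (of_real y - s)"
  note F = cauchy_transform_sine_fun[OF ab(2) z l] and G = cauchy_transform_sine_fun[OF ab(1) w s]
  have le: "cmod (complex_of_real (sine_fun n (x / d)) / (of_real x - q)) \<le> indicator {- 2 * d..2 * d} x / cmod (of_real x - q)"
    if "d > 0" for n x d q
  proof -
    have "\<bar>sine_fun n (x / d)\<bar> \<le> indicator {- 2 * d..2 * d} x"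
      unfolding sine_fun_eq_indicator[OF that] by (auto simp: indicator_def)
    then show ?thesis by (simp add: norm_divide divide_right_mono)
  qed
  note D = integral_double_series[of "\<lambda>n. complex_of_real (k n)" ?f ?g, OF k F(1) G(1) le[OF ab(2)] le[OF ab(1)] F(3) G(3)]
  have eq: "complex_of_real (sine_series r \<phi> (\<delta> / b) (\<gamma> / a)) / ((\<delta> - l) * (\<gamma> - s))
      = (\<Sum>n. complex_of_real (k n) * (?f n \<delta> * ?g n \<gamma>))" for \<delta> \<gamma>
  proof -
    have "summable (\<lambda>n. norm (k n * (sine_fun n (\<delta> / b) * sine_fun n (\<gamma> / a))))"
    proof (rule summable_comparison_test'[OF k])
      fix n :: nat
      have "\<bar>sine_fun n (\<delta> / b) * sine_fun n (\<gamma> / a)\<bar> \<le> 1 * 1"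
        unfolding abs_mult by (intro mult_mono abs_sine_fun_le) auto
      then have "\<bar>k n\<bar> * \<bar>sine_fun n (\<delta> / b) * sine_fun n (\<gamma> / a)\<bar> \<le> \<bar>k n\<bar> * 1"
        by (intro mult_left_mono) auto
      then show "norm (norm (k n * (sine_fun n (\<delta> / b) * sine_fun n (\<gamma> / a)))) \<le> norm (complex_of_real (k n))"
        by (simp add: abs_mult)
    qed
    from summable_sums[OF summable_norm_cancel[OF this]]
    have "(\<lambda>n. k n * (sine_fun n (\<delta> / b) * sine_fun n (\<gamma> / a))) sums sine_series r \<phi> (\<delta> / b) (\<gamma> / a)"
      unfolding sine_series_def k_def .
    from sums_divide[OF sums_of_real[OF this, where 'a=complex], of "(\<delta> - l) * (\<gamma> - s)"]
    have "(\<lambda>n. complex_of_real (k n) * (?f n \<delta> * ?g n \<gamma>)) sums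
        (complex_of_real (sine_series r \<phi> (\<delta> / b) (\<gamma> / a)) / ((\<delta> - l) * (\<gamma> - s)))"
      by simp
    then show ?thesis by (rule sums_unique)
  qed
  show "integrable lborel (\<lambda>(\<delta>, \<gamma>). complex_of_real (sine_series r \<phi> (\<delta> / b) (\<gamma> / a)) / ((\<delta> - l) * (\<gamma> - s)))"
    unfolding eq by (rule D(2))
  let ?L = "LINT (\<delta>, \<gamma>)|lborel. complex_of_real (sine_series r \<phi> (\<delta> / b) (\<gamma> / a)) / ((\<delta> - l) * (\<gamma> - s))"
  have "(\<lambda>n. complex_of_real (k n) * (integral\<^sup>L lborel (?f n) * integral\<^sup>L lborel (?g n))) sums ?L"
    unfolding eq by (rule D(3))
  from sums_mult[OF this, of "1 / (2 * pi * \<i>)"]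
  have S: "(\<lambda>n. 1 / (2 * pi * \<i>) * (complex_of_real (k n) * (integral\<^sup>L lborel (?f n) * integral\<^sup>L lborel (?g n))))
    sums (1 / (2 * pi * \<i>) * ?L)" .
  have c: "cmod c < 1" using r by (simp add: c_def norm_mult)
  have lt1: "cmod (p * q) < 1" if "cmod p < 1" "cmod q < 1" for p q
    using mult_left_mono[of "cmod q" 1 "cmod p"] that by (simp add: norm_mult)
  have small: "cmod (w * z * c) < 1" "cmod (w * z * cnj c) < 1"
    using c by (simp_all add: lt1 w z)
  have coeff_eq: "1 / (2 * pi * \<i>) * (complex_of_real (k n) * (integral\<^sup>L lborel (?f n) * integral\<^sup>L lborel (?g n)))
      = - ((w * z * cnj c) ^ n) / of_nat n - - ((w * z * c) ^ n) / of_nat n" for n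
  \<comment> \<open>At n = 0 the transforms are 0 instead of pi w^0, but both sides vanish there
    because of the division by n.\<close>
  proof (cases "n = 0")
    case False
    have cn: "c ^ n = of_real (r ^ n) * cis (real n * \<phi>)"
      by (simp add: c_def power_mult_distrib cis_conv_exp[symmetric] Complex.DeMoivre)
    have "c ^ n - cnj c ^ n = c ^ n - cnj (c ^ n)" by simp
    also have "\<dots> = 2 * \<i> * of_real (r ^ n * sin (real n * \<phi>))"
      unfolding cn by (simp add: complex_eq_iff)
    finally have c2: "c ^ n - cnj c ^ n = 2 * \<i> * of_real (r ^ n * sin (real n * \<phi>))" .
    have "- ((w * z * cnj c) ^ n) / of_nat n - - ((w * z * c) ^ n) / of_nat n = (w * z) ^ n * (c ^ n - cnj c ^ n) / of_nat n"
      by (simp add: power_mult_distrib right_diff_distrib diff_divide_distrib)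
    also have "\<dots> = 1 / (2 * pi * \<i>) * (complex_of_real (k n) * (of_real pi * z ^ n * (of_real pi * w ^ n)))"
      unfolding c2 k_def using False by (simp add: field_simps power_mult_distrib)
    finally show ?thesis unfolding F(2) G(2) using False by simp
  qed (simp add: k_def)
  have ln: "(\<lambda>n. - (q ^ n) / of_nat n) sums ln (1 - q)" if "cmod q < 1" for q
    using Ln_series'[of "- q"] that by simp
  have "1 / (2 * pi * \<i>) * ?L = ln (1 - w * z * cnj c) - ln (1 - w * z * c)"
    using S unfolding coeff_eq by (rule sums_unique2[OF _ sums_diff[OF ln[OF small(2)] ln[OF small(1)]]])
  moreover have "1 - w * z * c \<noteq> 0" "1 - w * z * cnj c \<noteq> 0"
    using small by (metis eq_iff_diff_eq_0 norm_one order_less_irrefl)+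
  ultimately show "exp (1 / (2 * pi * \<i>) * ?L) = (1 - w * z * cnj c) / (1 - w * z * c)"
    by (simp add: exp_diff exp_Ln)
qed

lemma integrable_sine_series:
  assumes r: "0 \<le> r" "r < 1" and ab: "a > 0" "b > 0"
  shows "integrable lborel (\<lambda>(\<delta>, \<gamma>). sine_series r \<phi> (\<delta> / b) (\<gamma> / a))"
proof -
  define k where "k n = - (4 / pi) * (r ^ n * sin (real n * \<phi>) / real n)" for n
  have k: "summable (\<lambda>n. norm (k n))"
    unfolding k_def real_norm_def by (rule summable_sine_coeff[OF r])
  have int: "integrable lborel (\<lambda>x. sine_fun n (x / d))" if "d > 0" for n d
    by (cases n) (use integral_sine_fun_Suc(1)[OF that] in auto)
  have le: "norm (sine_fun n (x / d)) \<le> indicator {- 2 * d..2 * d} x" if "d > 0" for n x d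
    unfolding sine_fun_eq_indicator[OF that] by (auto simp: indicator_def)
  have "integrable lborel (\<lambda>x. indicator {- 2 * d..2 * d} x *\<^sub>R (1::real))" for d :: real
    by (rule borel_integrable_compact) auto
  then have "integrable lborel (\<lambda>x. indicator {- 2 * d..2 * d} x :: real)" for d :: real by simp
  then show ?thesis unfolding sine_series_def k_def[symmetric]
    by (intro integral_double_series(2)[OF k int int le le] ab)
qed

section \<open>Uniqueness of the double Cauchy transform\<close>

lemma poisson_integral:
  assumes e: "e > 0" and AB: "A \<le> B"
  shows "integrable lborel (\<lambda>x. indicator {A..B} x *\<^sub>R (e / ((u - x)\<^sup>2 + e\<^sup>2)))"
    and "(LINT x|lborel. indicator {A..B} x *\<^sub>R (e / ((u - x)\<^sup>2 + e\<^sup>2))) = arctan ((B - u) / e) - arctan ((A - u) / e)"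
proof -
  have pos: "(u - x)\<^sup>2 + e\<^sup>2 \<noteq> 0" for x
    using e by (metis add_nonneg_eq_0_iff less_irrefl power_eq_0_iff zero_le_power2)
  have cont: "continuous_on {A..B} (\<lambda>x. e / ((u - x)\<^sup>2 + e\<^sup>2))"
    using pos by (intro continuous_intros) auto
  show "integrable lborel (\<lambda>x. indicator {A..B} x *\<^sub>R (e / ((u - x)\<^sup>2 + e\<^sup>2)))"
    by (intro borel_integrable_compact cont compact_Icc)
  have d: "((\<lambda>x. arctan ((x - u) / e)) has_real_derivative e / ((u - x)\<^sup>2 + e\<^sup>2)) (at x)" for x
  proof -
    have "((\<lambda>x. arctan ((x - u) / e)) has_real_derivative inverse (1 + ((x - u) / e)\<^sup>2) * (1 / e)) (at x)"
      using e by (intro DERIV_chain2[OF DERIV_arctan]) (auto intro!: derivative_eq_intros)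
    also have "1 + ((x - u) / e)\<^sup>2 = ((u - x)\<^sup>2 + e\<^sup>2) / e\<^sup>2"
      using e by (simp add: field_simps power2_eq_square)
    finally show ?thesis using e pos[of x] by (simp add: power2_eq_square)
  qed
  show "(LINT x|lborel. indicator {A..B} x *\<^sub>R (e / ((u - x)\<^sup>2 + e\<^sup>2))) = arctan ((B - u) / e) - arctan ((A - u) / e)"
    by (rule integral_FTC_atLeastAtMost[OF AB _ cont])
      (auto intro: has_vector_derivative_at_within d[unfolded has_real_derivative_iff_has_vector_derivative])
qed

text \<open>With width 1/m^2 the overshoot 1/m of the upper end point is many widths long, so even
  at u = q the full mass pi is reached. The limit is exactly the closed half line, not half the mass
  at its end.\<close>

lemma poisson_kernel_limit:
  "(\<lambda>n. arctan ((q + 1 / real (Suc n) - u) / (1 / (real (Suc n))\<^sup>2)) - arctan ((- real (Suc n) - u) / (1 / (real (Suc n))\<^sup>2)))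
    \<longlonglongrightarrow> pi * indicator {..q} u"
proof -
  let ?m = "\<lambda>n. real (Suc n)"
  have m_top: "filterlim ?m at_top sequentially"
    by (rule filterlim_compose[OF filterlim_real_sequentially filterlim_Suc])
  have minus_m: "filterlim (\<lambda>n. - ?m n) at_bot sequentially"
    using m_top by (simp only: filterlim_uminus_at_bot minus_minus)
  have low: "(\<lambda>n. arctan ((- ?m n - u) / (1 / (?m n)\<^sup>2))) \<longlonglongrightarrow> - (pi / 2)"
  proof (rule filterlim_compose[OF tendsto_arctan_at_bot], rule filterlim_at_bot_mono[OF minus_m])
    show "\<forall>\<^sub>F n in sequentially. (- ?m n - u) / (1 / (?m n)\<^sup>2) \<le> - ?m n"
      using eventually_ge_at_top[of "nat \<lceil>\<bar>u\<bar> + 1\<rceil>"]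
    proof (rule eventually_mono)
      fix n assume "nat \<lceil>\<bar>u\<bar> + 1\<rceil> \<le> n"
      then have "\<bar>u\<bar> + 1 \<le> ?m n" by linarith
      then have "(- ?m n - u) * (?m n)\<^sup>2 \<le> (- 1) * (?m n)\<^sup>2" by (intro mult_right_mono) auto
      also have "\<dots> \<le> - ?m n"
      proof -
        have sq: "(- 1) * x\<^sup>2 \<le> - x" if "x \<ge> 1" for x :: real
          using mult_left_mono[of 1 x x] that by (simp add: power2_eq_square)
        show ?thesis by (rule sq) simp
      qed
      finally show "(- ?m n - u) / (1 / (?m n)\<^sup>2) \<le> - ?m n" by simp
    qed
  qed
  have high: "(\<lambda>n. arctan ((q + 1 / ?m n - u) / (1 / (?m n)\<^sup>2))) \<longlonglongrightarrow> (if u \<le> q then pi / 2 else - (pi / 2))"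
  proof (cases "u \<le> q")
    case True
    have "(\<lambda>n. arctan ((q + 1 / ?m n - u) / (1 / (?m n)\<^sup>2))) \<longlonglongrightarrow> pi / 2"
    proof (rule filterlim_compose[OF tendsto_arctan_at_top], rule filterlim_at_top_mono[OF m_top], rule always_eventually, rule allI)
      fix n
      have "?m n = (1 / ?m n) * (?m n)\<^sup>2" by (simp add: power2_eq_square)
      also have "\<dots> \<le> (q + 1 / ?m n - u) * (?m n)\<^sup>2" using True by (intro mult_right_mono) auto
      finally show "?m n \<le> (q + 1 / ?m n - u) / (1 / (?m n)\<^sup>2)" by simp
    qed
    then show ?thesis using True by simp
  next
    case False
    have "(\<lambda>n. arctan ((q + 1 / ?m n - u) / (1 / (?m n)\<^sup>2))) \<longlonglongrightarrow> - (pi / 2)"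
    proof (rule filterlim_compose[OF tendsto_arctan_at_bot], rule filterlim_at_bot_mono[OF minus_m])
      show "\<forall>\<^sub>F n in sequentially. (q + 1 / ?m n - u) / (1 / (?m n)\<^sup>2) \<le> - ?m n"
        using eventually_ge_at_top[of "nat \<lceil>2 / (u - q)\<rceil>"]
      proof (rule eventually_mono)
        fix n assume "nat \<lceil>2 / (u - q)\<rceil> \<le> n"
        then have "2 / (u - q) \<le> ?m n" by linarith
        then have "q - u \<le> - (2 / ?m n)" using False by (simp add: field_simps)
        then have "(q + 1 / ?m n - u) * (?m n)\<^sup>2 \<le> (- (1 / ?m n)) * (?m n)\<^sup>2"
          by (intro mult_right_mono) auto
        also have "\<dots> = - ?m n" by (simp add: power2_eq_square)
        finally show "(q + 1 / ?m n - u) / (1 / (?m n)\<^sup>2) \<le> - ?m n" by simp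
      qed
    qed
    then show ?thesis using False by simp
  qed
  show ?thesis using tendsto_diff[OF high low] by (cases "u \<le> q") auto
qed

text \<open>Integrating the hypothesis over x in an interval and exchanging the integrals gives
  arctangent weights, which converge boundedly to a half line indicator. The map \<open>f\<close> is
  kept general so that each coordinate can be treated in turn.\<close>

lemma integral_poisson_zero_imp_halfspace:
  fixes H :: "'a \<Rightarrow> real"
  assumes N: "sigma_finite_measure N" and H: "integrable N H" and f [measurable]: "f \<in> borel_measurable N"
    and zero: "\<And>x e. e > 0 \<Longrightarrow> (LINT p|N. H p * (e / ((f p - x)\<^sup>2 + e\<^sup>2))) = 0"
  shows "(LINT p|N. H p * indicator {..q} (f p)) = 0"
proof -
  interpret N: sigma_finite_measure N by (rule N)
  interpret P: pair_sigma_finite N lborel ..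
  have [measurable]: "H \<in> borel_measurable N" using H by auto
  have interval: "(LINT p|N. H p * (arctan ((B - f p) / e) - arctan ((A - f p) / e))) = 0"
    if e: "e > 0" and AB: "A \<le> B" for A B e
  proof -
    let ?k = "\<lambda>(p, x). H p * (indicator {A..B} x *\<^sub>R (e / ((f p - x)\<^sup>2 + e\<^sup>2)))"
    have int: "integrable (N \<Otimes>\<^sub>M lborel) ?k"
    proof (rule P.Fubini_integrable)
      show "?k \<in> borel_measurable (N \<Otimes>\<^sub>M lborel)" by measurable
      have ne: "norm (H p * (indicator {A..B} x *\<^sub>R (e / ((f p - x)\<^sup>2 + e\<^sup>2))))
          = \<bar>H p\<bar> * (indicator {A..B} x *\<^sub>R (e / ((f p - x)\<^sup>2 + e\<^sup>2)))" for p x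
        using e by (simp add: abs_mult)
      have "(LINT x|lborel. norm (?k (p, x))) = \<bar>H p\<bar> * (arctan ((B - f p) / e) - arctan ((A - f p) / e))" for p
        by (simp only: prod.case ne integral_mult_right_zero poisson_integral(2)[OF e AB])
      moreover have "integrable N (\<lambda>p. \<bar>H p\<bar> * (arctan ((B - f p) / e) - arctan ((A - f p) / e)))"
      proof (rule Bochner_Integration.integrable_bound)
        show "integrable N (\<lambda>p. \<bar>H p\<bar> * pi)" using H by simp
        show "AE p in N. norm (\<bar>H p\<bar> * (arctan ((B - f p) / e) - arctan ((A - f p) / e))) \<le> norm (\<bar>H p\<bar> * pi)"
        proof (rule AE_I2)
          fix p
          have "\<bar>arctan ((B - f p) / e) - arctan ((A - f p) / e)\<bar> \<le> pi"
            using arctan_bounded[of "(B - f p) / e"] arctan_bounded[of "(A - f p) / e"] by linarith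
          then show "norm (\<bar>H p\<bar> * (arctan ((B - f p) / e) - arctan ((A - f p) / e))) \<le> norm (\<bar>H p\<bar> * pi)"
            by (simp add: abs_mult mult_left_mono)
        qed
      qed measurable
      ultimately show "integrable N (\<lambda>p. LINT x|lborel. norm (?k (p, x)))" by simp
      show "AE p in N. integrable lborel (\<lambda>x. ?k (p, x))"
        unfolding prod.case by (intro AE_I2 integrable_mult_right poisson_integral(1)[OF e AB])
    qed
    have "(LINT p|N. (LINT x|lborel. ?k (p, x))) = (LINT x|lborel. (LINT p|N. ?k (p, x)))"
      using P.Fubini_integral[of "\<lambda>p x. ?k (p, x)"] int by simp
    also have "\<dots> = (LINT x|(lborel :: real measure). 0)"
    proof (rule Bochner_Integration.integral_cong[OF refl])
      fix x :: real
      have "(LINT p|N. ?k (p, x)) = (LINT p|N. indicator {A..B} x * (H p * (e / ((f p - x)\<^sup>2 + e\<^sup>2))))"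
        by (simp add: mult_ac)
      then show "(LINT p|N. ?k (p, x)) = 0" by (simp only: integral_mult_right_zero zero[OF e] mult_zero_right)
    qed
    finally show ?thesis
      unfolding prod.case integral_mult_right_zero poisson_integral(2)[OF e AB] by simp
  qed
  let ?K = "\<lambda>n p. arctan ((q + 1 / real (Suc n) - f p) / (1 / (real (Suc n))\<^sup>2)) - arctan ((- real (Suc n) - f p) / (1 / (real (Suc n))\<^sup>2))"
  have lim: "(\<lambda>n. LINT p|N. H p * ?K n p) \<longlonglongrightarrow> (LINT p|N. H p * (pi * indicator {..q} (f p)))"
  proof (rule integral_dominated_convergence[where w="\<lambda>p. \<bar>H p\<bar> * pi"])
    show "integrable N (\<lambda>p. \<bar>H p\<bar> * pi)" using H by simp
    show "AE p in N. (\<lambda>n. H p * ?K n p) \<longlonglongrightarrow> H p * (pi * indicator {..q} (f p))"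
      by (intro AE_I2 tendsto_mult_left poisson_kernel_limit)
    show "AE p in N. norm (H p * ?K n p) \<le> \<bar>H p\<bar> * pi" for n
    proof (rule AE_I2)
      fix p
      have "\<bar>?K n p\<bar> \<le> pi"
        using arctan_bounded[of "(q + 1 / real (Suc n) - f p) / (1 / (real (Suc n))\<^sup>2)"]
          arctan_bounded[of "(- real (Suc n) - f p) / (1 / (real (Suc n))\<^sup>2)"] by linarith
      then show "norm (H p * ?K n p) \<le> \<bar>H p\<bar> * pi"
        unfolding real_norm_def abs_mult by (intro mult_left_mono) auto
    qed
  qed measurable
  \<comment> \<open>For negative q the interval from -(n + 1) to q + 1/(n + 1) is nonempty only once
    n is large.\<close>
  have ev: "\<forall>\<^sub>F n in sequentially. (LINT p|N. H p * ?K n p) = 0"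
    using eventually_ge_at_top[of "nat \<lceil>- q\<rceil>"]
  proof (rule eventually_mono)
    fix n assume "nat \<lceil>- q\<rceil> \<le> n"
    then have "- real (Suc n) \<le> q" by linarith
    also have "q \<le> q + 1 / real (Suc n)" by simp
    finally show "(LINT p|N. H p * ?K n p) = 0"
      by (intro interval) auto
  qed
  have "(LINT p|N. H p * (pi * indicator {..q} (f p))) = 0"
    by (rule LIMSEQ_unique[OF lim tendsto_eventually[OF ev]])
  moreover have "(LINT p|N. H p * (pi * indicator {..q} (f p))) = (LINT p|N. pi * (H p * indicator {..q} (f p)))"
    by (simp add: mult_ac)
  ultimately show ?thesis by simp
qed

text \<open>Closed lower quadrants are stable under intersection and generate the Borel sets; the
  sets over which h integrates to 0 form a Dynkin system.\<close>

lemma integral_atMost_zero_imp_AE_zero: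
  fixes h :: "real \<times> real \<Rightarrow> real"
  assumes h: "integrable lborel h"
    and zero: "\<And>q q'. (LINT p|lborel. h p * indicator {..q} (fst p) * indicator {..q'} (snd p)) = 0"
  shows "AE p in lborel. h p = 0"
proof -
  have [measurable]: "h \<in> borel_measurable borel" using h by auto
  have si: "set_integrable lborel A h" if "A \<in> sets borel" for A
    unfolding set_integrable_def using h that by (intro integrable_mult_indicator) auto
  have atMost: "(LINT p:{..c}|lborel. h p) = 0" for c
  proof -
    have e: "indicator {..c} p *\<^sub>R h p = h p * indicator {..fst c} (fst p) * indicator {..snd c} (snd p)" for p
      by (auto simp: indicator_def less_eq_prod_def)
    show ?thesis unfolding set_lebesgue_integral_def e by (rule zero)
  qed
  \<comment> \<open>Closure under complements needs the integral over the whole plane, obtained by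
    exhausting it with quadrants.\<close>
  have total: "(LINT p|lborel. h p) = 0"
  proof -
    have "(\<lambda>n. LINT p|lborel. indicator {..(real n, real n)} p *\<^sub>R h p) \<longlonglongrightarrow> (LINT p|lborel. h p)"
    proof (rule integral_dominated_convergence[where w="\<lambda>p. \<bar>h p\<bar>"])
      show "AE p in lborel. (\<lambda>n. indicator {..(real n, real n)} p *\<^sub>R h p) \<longlonglongrightarrow> h p"
      proof (rule AE_I2, rule tendsto_eventually)
        fix p :: "real \<times> real"
        show "\<forall>\<^sub>F n in sequentially. indicator {..(real n, real n)} p *\<^sub>R h p = h p"
          using eventually_ge_at_top[of "nat \<lceil>max (fst p) (snd p)\<rceil>"]
        proof (rule eventually_mono)
          fix n assume "nat \<lceil>max (fst p) (snd p)\<rceil> \<le> n"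
          then have "max (fst p) (snd p) \<le> real n" by linarith
          then have "p \<in> {..(real n, real n)}" by (simp add: less_eq_prod_def)
          then show "indicator {..(real n, real n)} p *\<^sub>R h p = h p" by simp
        qed
      qed
      show "AE p in lborel. norm (indicator {..(real n, real n)} p *\<^sub>R h p) \<le> \<bar>h p\<bar>" for n
        by (rule AE_I2) (auto simp: indicator_def)
    qed (use h in auto)
    moreover have "(LINT p|lborel. indicator {..(real n, real n)} p *\<^sub>R h p) = 0" for n
      using atMost[of "(real n, real n)"] by (simp add: set_lebesgue_integral_def)
    ultimately show ?thesis by (simp add: LIMSEQ_const_iff)
  qed
  have int_stable: "Int_stable (range (\<lambda>a::real \<times> real. {..a}))"
  proof (rule Int_stableI)
    fix A B :: "(real \<times> real) set" assume "A \<in> range atMost" "B \<in> range atMost"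
    then obtain a b where "A = {..a}" "B = {..b}" by auto
    then have "A \<inter> B = {..inf a b}" by auto
    then show "A \<inter> B \<in> range atMost" by blast
  qed
  have pow: "range (\<lambda>a::real \<times> real. {..a}) \<subseteq> Pow UNIV" by simp
  have all: "(LINT p:A|lborel. h p) = 0" if "A \<in> sigma_sets UNIV (range (\<lambda>a::real \<times> real. {..a}))" for A
    using int_stable pow that
  proof (induction rule: sigma_sets_induct_disjoint)
    fix A :: "(real \<times> real) set" assume "A \<in> range atMost"
    then show "(LINT p:A|lborel. h p) = 0" using atMost by auto
  next
    show "(LINT p:{}|lborel. h p) = 0" by (simp add: set_lebesgue_integral_def)
  next
    fix A assume A: "A \<in> sigma_sets UNIV (range (\<lambda>a::real \<times> real. {..a}))" "(LINT p:A|lborel. h p) = 0"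
    have Ab: "A \<in> sets borel" using A(1) by (simp add: borel_eq_atMost)
    have "(LINT p|lborel. h p - indicator A p *\<^sub>R h p) = 0"
      using h si[OF Ab] A(2) total by (simp add: set_integrable_def set_lebesgue_integral_def)
    moreover have "indicator (UNIV - A) p *\<^sub>R h p = h p - indicator A p *\<^sub>R h p" for p
      by (simp add: indicator_def)
    ultimately show "(LINT p:UNIV - A|lborel. h p) = 0"
      unfolding set_lebesgue_integral_def by simp
  next
    fix A :: "nat \<Rightarrow> (real \<times> real) set"
    assume A: "disjoint_family A" "range A \<subseteq> sigma_sets UNIV (range (\<lambda>a::real \<times> real. {..a}))"
      "\<And>i. (LINT p:A i|lborel. h p) = 0"
    have Ab: "A i \<in> sets borel" for i using A(2) by (auto simp: borel_eq_atMost)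
    have "(LINT p:(\<Union>i. A i)|lborel. h p) = (\<Sum>i. (LINT p:A i|lborel. h p))"
      using Ab A(1) by (intro lebesgue_integral_countable_add si) (auto simp: disjoint_family_on_def)
    then show "(LINT p:\<Union> (range A)|lborel. h p) = 0" using A(3) by simp
  qed
  show ?thesis
  proof (rule density_unique_real[OF h])
    fix A assume "A \<in> sets (lborel :: (real \<times> real) measure)"
    then have "A \<in> sigma_sets UNIV (range (\<lambda>a::real \<times> real. {..a}))" by (simp add: borel_eq_atMost)
    then show "(LINT p:A|lborel. h p) = (LINT p:A|lborel. 0)" using all by (simp add: set_lebesgue_integral_def)
  qed simp
qed

section \<open>From Cauchy kernels to Poisson kernels\<close>

definition cauchy_kernel :: "complex \<Rightarrow> complex \<Rightarrow> real \<times> real \<Rightarrow> complex" where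
  "cauchy_kernel l s p = 1 / ((of_real (fst p) - l) * (of_real (snd p) - s))"

lemma cmod_of_real_diff_ge: "\<bar>Im l\<bar> \<le> cmod (of_real x - l)"
  using abs_Im_le_cmod[of "of_real x - l"] by simp

lemma cauchy_kernel_le:
  assumes "Im l \<noteq> 0" "Im s \<noteq> 0"
  shows "cmod (cauchy_kernel l s p) \<le> 1 / (\<bar>Im l\<bar> * \<bar>Im s\<bar>)"
  unfolding cauchy_kernel_def norm_divide norm_mult norm_one using assms
  by (intro divide_left_mono mult_mono cmod_of_real_diff_ge mult_pos_pos)
    (auto intro: less_le_trans[OF _ cmod_of_real_diff_ge])

lemma borel_measurable_cauchy_kernel [measurable]: "cauchy_kernel l s \<in> borel_measurable borel"
  unfolding cauchy_kernel_def borel_prod[symmetric] by measurable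

lemma integrable_cauchy_kernel:
  assumes h: "integrable lborel (h :: real \<times> real \<Rightarrow> real)" and ls: "Im l \<noteq> 0" "Im s \<noteq> 0"
  shows "integrable lborel (\<lambda>p. of_real (h p) * cauchy_kernel l s p)"
    and "cmod (LINT p|lborel. of_real (h p) * cauchy_kernel l s p) \<le> (LINT p|lborel. \<bar>h p\<bar>) / (\<bar>Im l\<bar> * \<bar>Im s\<bar>)"
proof -
  have le: "cmod (of_real (h p) * cauchy_kernel l s p) \<le> \<bar>h p\<bar> / (\<bar>Im l\<bar> * \<bar>Im s\<bar>)" for p
    using mult_left_mono[OF cauchy_kernel_le[OF ls, of p], of "\<bar>h p\<bar>"] by (simp add: norm_mult)
  have [measurable]: "h \<in> borel_measurable borel" using h by auto
  have int: "integrable lborel (\<lambda>p. \<bar>h p\<bar> / (\<bar>Im l\<bar> * \<bar>Im s\<bar>))" using h by simp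
  show 1: "integrable lborel (\<lambda>p. of_real (h p) * cauchy_kernel l s p)"
    by (rule Bochner_Integration.integrable_bound[OF int]) (use le in \<open>auto simp: abs_mult\<close>)
  show "cmod (LINT p|lborel. of_real (h p) * cauchy_kernel l s p) \<le> (LINT p|lborel. \<bar>h p\<bar>) / (\<bar>Im l\<bar> * \<bar>Im s\<bar>)"
    using Bochner_Integration.integral_norm_bound_integral[OF 1 int le] by simp
qed

text \<open>The jump of the Cauchy kernel across the real line is a Poisson kernel, so the four
  choices of half planes for l and s combine to a product of two Poisson kernels. These are turned
  into half line indicators one coordinate at a time.\<close>

lemma cauchy_transform_zero_imp_AE_zero:
  fixes h :: "real \<times> real \<Rightarrow> real"
  assumes h: "integrable lborel h"
    and zero: "\<And>l s. Im l \<noteq> 0 \<Longrightarrow> Im s \<noteq> 0 \<Longrightarrow> (LINT p|lborel. of_real (h p) * cauchy_kernel l s p) = 0"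
  shows "AE p in lborel. h p = 0"
proof (rule integral_atMost_zero_imp_AE_zero[OF h])
  have [measurable]: "h \<in> borel_measurable borel" using h by auto
  have [measurable]: "(fst :: real \<times> real \<Rightarrow> real) \<in> borel_measurable borel" "(snd :: real \<times> real \<Rightarrow> real) \<in> borel_measurable borel"
    by (intro borel_measurable_continuous_onI continuous_intros)+
  let ?P = "\<lambda>e u x. e / ((u - x)\<^sup>2 + e\<^sup>2) :: real"
  have P_le: "\<bar>?P e u x\<bar> \<le> 1 / e" if "e > 0" for e u x
  proof -
    have "e / ((u - x)\<^sup>2 + e\<^sup>2) \<le> e / e\<^sup>2" using that by (intro divide_left_mono mult_pos_pos add_nonneg_pos) auto
    also have "\<dots> = 1 / e" by (simp add: power2_eq_square)
    finally show ?thesis using that by simp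
  qed
  have poisson: "(LINT p|lborel. h p * ?P e' (snd p) y * ?P e (fst p) x) = 0" if e: "e > 0" "e' > 0" for e e' x y
  proof -
    let ?l = "Complex x e" and ?s = "Complex y e'"
    have im: "complex_of_real (?P e u x) = (1 / (of_real u - Complex x e) - 1 / (of_real u - Complex x (- e))) / (2 * \<i>)"
      if "e > 0" for e u x
    proof -
      have ne: "complex_of_real u - Complex x e \<noteq> 0" "complex_of_real u - Complex x (- e) \<noteq> 0"
        using that by (auto simp: complex_eq_iff)
      have "(complex_of_real u - Complex x e) * (complex_of_real u - Complex x (- e)) = of_real ((u - x)\<^sup>2 + e\<^sup>2)"
        by (simp add: complex_eq_iff power2_eq_square algebra_simps)
      then have "(1 / (of_real u - Complex x e) - 1 / (of_real u - Complex x (- e))) = (Complex x e - Complex x (- e)) / of_real ((u - x)\<^sup>2 + e\<^sup>2)"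
        using ne by (simp add: diff_frac_eq)
      also have "Complex x e - Complex x (- e) = 2 * \<i> * of_real e" by (simp add: complex_eq_iff)
      finally have d: "1 / (of_real u - Complex x e) - 1 / (of_real u - Complex x (- e))
          = 2 * \<i> * of_real e / of_real ((u - x)\<^sup>2 + e\<^sup>2)" .
      have e: "2 * \<i> * E / Q / (2 * \<i>) = E / Q" for E Q :: complex by (cases "Q = 0") (simp_all add: field_simps)
      show ?thesis unfolding d of_real_divide e ..
    qed
    let ?k = "\<lambda>l s p. complex_of_real (h p) * cauchy_kernel l s p"
    have "complex_of_real (h p * ?P e' (snd p) y * ?P e (fst p) x) =
      - (1 / 4) * (?k ?l ?s p - ?k (Complex x (- e)) ?s p - ?k ?l (Complex y (- e')) p + ?k (Complex x (- e)) (Complex y (- e')) p)" for p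
    proof -
      have alg: "H * ((b - b') / (2 * \<i>)) * ((a - a') / (2 * \<i>)) =
          - (1 / 4) * (H * (a * b) - H * (a' * b) - H * (a * b') + H * (a' * b'))" for H a a' b b' :: complex
        by (simp add: field_simps)
      have ker: "cauchy_kernel l s p = 1 / (of_real (fst p) - l) * (1 / (of_real (snd p) - s))" for l s
        by (simp add: cauchy_kernel_def)
      show ?thesis unfolding of_real_mult im[OF e(1)] im[OF e(2)] ker by (rule alg)
    qed
    then have "(LINT p|lborel. complex_of_real (h p * ?P e' (snd p) y * ?P e (fst p) x)) =
      (LINT p|lborel. - (1 / 4) * (?k ?l ?s p - ?k (Complex x (- e)) ?s p - ?k ?l (Complex y (- e')) p + ?k (Complex x (- e)) (Complex y (- e')) p))"
      by (simp only:)
    also have "\<dots> = 0"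
      using e by (simp add: integrable_cauchy_kernel[OF h] zero)
    finally show ?thesis unfolding integral_complex_of_real by simp
  qed
  fix q q'
  have step1: "(LINT p|lborel. h p * ?P e' (snd p) y * indicator {..q} (fst p)) = 0" if e': "e' > 0" for e' y
  proof (rule integral_poisson_zero_imp_halfspace)
    show "integrable lborel (\<lambda>p. h p * ?P e' (snd p) y)"
    proof (rule Bochner_Integration.integrable_bound)
      show "integrable lborel (\<lambda>p. h p * (1 / e'))" using h by simp
      show "AE p in lborel. norm (h p * ?P e' (snd p) y) \<le> norm (h p * (1 / e'))"
      proof (rule AE_I2)
        fix p
        show "norm (h p * ?P e' (snd p) y) \<le> norm (h p * (1 / e'))"
          unfolding real_norm_def abs_mult using P_le[OF e', of "snd p" y] e' by (intro mult_left_mono) auto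
      qed
    qed measurable
    show "(LINT p|lborel. h p * ?P e' (snd p) y * ?P e (fst p) x) = 0" if "e > 0" for x e
      by (rule poisson[OF that e'])
  qed (auto intro: sigma_finite_lborel)
  show "(LINT p|lborel. h p * indicator {..q} (fst p) * indicator {..q'} (snd p)) = 0"
  proof (rule integral_poisson_zero_imp_halfspace)
    show "integrable lborel (\<lambda>p. h p * indicator {..q} (fst p))"
      by (rule Bochner_Integration.integrable_bound[OF h]) (auto simp: indicator_def)
    show "(LINT p|lborel. h p * indicator {..q} (fst p) * ?P e (snd p) x) = 0" if "e > 0" for x e
      using step1[OF that, of x] by (simp add: mult_ac)
  qed (auto intro: sigma_finite_lborel)
qed

text \<open>Equal exponentials force the two integrals to differ by an element of a discrete group; this
  difference is continuous in \<open>l\<close> and vanishes as \<open>l\<close> goes to infinity in the half plane.\<close>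

lemma exp_cauchy_transform_unique:
  fixes g1 g2 :: "real \<times> real \<Rightarrow> real"
  assumes g: "integrable lborel g1" "integrable lborel g2"
    and eq: "\<And>l s. Im l \<noteq> 0 \<Longrightarrow> Im s \<noteq> 0 \<Longrightarrow>
      exp (1 / (2 * pi * \<i>) * (LINT p|lborel. of_real (g1 p) * cauchy_kernel l s p)) =
      exp (1 / (2 * pi * \<i>) * (LINT p|lborel. of_real (g2 p) * cauchy_kernel l s p))"
  shows "AE p in lborel. g1 p = g2 p"
proof -
  define h where "h p = g1 p - g2 p" for p
  have h: "integrable lborel h" unfolding h_def using g by simp
  define D where "D l s = (LINT p|lborel. of_real (h p) * cauchy_kernel l s p)" for l s
  define C where "C = (LINT p|lborel. \<bar>h p\<bar>)"
  have C: "C \<ge> 0" unfolding C_def by simp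
  \<comment> \<open>The exponents differ by 2 pi \<i> times an integer, and undoing the prefactor
    multiplies by another 2 pi \<i>.\<close>
  have D_int: "\<exists>n::int. D l s = - (4 * pi\<^sup>2 * of_int n)" if ls: "Im l \<noteq> 0" "Im s \<noteq> 0" for l s
  proof -
    have "D l s = (LINT p|lborel. of_real (g1 p) * cauchy_kernel l s p) - (LINT p|lborel. of_real (g2 p) * cauchy_kernel l s p)"
      unfolding D_def h_def using integrable_cauchy_kernel(1)[OF g(1) ls] integrable_cauchy_kernel(1)[OF g(2) ls]
      by (simp add: left_diff_distrib)
    then have "exp (1 / (2 * pi * \<i>) * D l s) = 1"
      using eq[OF ls] by (simp add: right_diff_distrib exp_diff)
    then obtain n :: int where "1 / (2 * pi * \<i>) * D l s = \<i> * of_real (of_int (2 * n) * pi)"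
      unfolding exp_eq_1 by (auto simp: complex_eq_iff)
    then have "D l s = \<i> * of_real (of_int (2 * n) * pi) * (2 * pi * \<i>)" by (simp add: field_simps)
    also have "\<dots> = - (4 * pi\<^sup>2 * of_int n)" by (simp add: power2_eq_square)
    finally show ?thesis by blast
  qed
  have D_0: "D l s = 0" if ls: "Im l \<noteq> 0" "Im s \<noteq> 0" for l s
  proof -
    define \<sigma> where "\<sigma> = sgn (Im l)"
    define m where "m = \<bar>Im l\<bar>"
    have \<sigma>: "\<bar>\<sigma>\<bar> = 1" "Im l = \<sigma> * m" and m: "m > 0" using ls by (auto simp: \<sigma>_def m_def sgn_if)
    \<comment> \<open>A vertical ray that starts at l and moves away from the real axis, so that it
      stays in the half plane of l.\<close>
    define L where "L t = Complex (Re l) (\<sigma> * t)" for t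
    have ImL: "Im (L t) \<noteq> 0" "\<bar>Im (L t)\<bar> = t" if "t \<ge> m" for t
      using that m \<sigma>(1) by (auto simp: L_def abs_mult)
    have lip: "cmod (D (L t) s - D (L u) s) \<le> C / (m * m * \<bar>Im s\<bar>) * \<bar>t - u\<bar>" if tu: "t \<ge> m" "u \<ge> m" for t u
    proof -
      \<comment> \<open>The resolvent identity for the Cauchy kernel, which makes the integral
        Lipschitz along the ray.\<close>
      have k: "cauchy_kernel (L t) s p - cauchy_kernel (L u) s p = (L t - L u) * (1 / (of_real (fst p) - L u) * cauchy_kernel (L t) s p)" for p
      proof -
        have nz: "complex_of_real (fst p) - L t \<noteq> 0" "complex_of_real (fst p) - L u \<noteq> 0" "complex_of_real (snd p) - s \<noteq> 0"
          using ImL tu ls(2) by (auto simp: complex_eq_iff)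
        have alg: "1 / (A * S) - 1 / (B * S) = (B - A) * (1 / B * (1 / (A * S)))"
          if "A \<noteq> 0" "B \<noteq> 0" "S \<noteq> 0" for A B S :: complex
          using that by (simp add: field_simps)
        have "cauchy_kernel (L t) s p - cauchy_kernel (L u) s p =
            ((of_real (fst p) - L u) - (of_real (fst p) - L t)) * (1 / (of_real (fst p) - L u) * cauchy_kernel (L t) s p)"
          unfolding cauchy_kernel_def by (rule alg[OF nz])
        then show ?thesis by simp
      qed
      have Lu: "cmod (L t - L u) = \<bar>t - u\<bar>"
      proof -
        have "L t - L u = \<i> * of_real (\<sigma> * (t - u))" by (simp add: L_def complex_eq_iff algebra_simps)
        then show ?thesis by (simp only: norm_mult norm_of_real abs_mult \<sigma>) simp
      qed
      have inv: "cmod (1 / (of_real (fst p) - L u)) \<le> 1 / m" for p :: "real \<times> real"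
      proof -
        have "m \<le> cmod (of_real (fst p) - L u)"
          using cmod_of_real_diff_ge[of "L u" "fst p"] ImL(2)[OF tu(2)] tu by linarith
        then show ?thesis unfolding norm_divide norm_one using m
          by (intro divide_left_mono mult_pos_pos) auto
      qed
      have ker: "cmod (cauchy_kernel (L t) s p) \<le> 1 / (m * \<bar>Im s\<bar>)" for p
      proof -
        have "1 / (t * \<bar>Im s\<bar>) \<le> 1 / (m * \<bar>Im s\<bar>)"
          using tu m ls by (intro divide_left_mono mult_right_mono) auto
        then show ?thesis using cauchy_kernel_le[OF ImL(1)[OF tu(1)] ls(2), of p] ImL(2)[OF tu(1)] by simp
      qed
      have le: "cmod (of_real (h p) * cauchy_kernel (L t) s p - of_real (h p) * cauchy_kernel (L u) s p)
          \<le> \<bar>h p\<bar> * (\<bar>t - u\<bar> * (1 / m * (1 / (m * \<bar>Im s\<bar>))))" for p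
        unfolding right_diff_distrib[symmetric] k norm_mult norm_of_real Lu
        by (intro mult_left_mono mult_mono inv ker) (use m in auto)
      have "D (L t) s - D (L u) s = (LINT p|lborel. of_real (h p) * cauchy_kernel (L t) s p - of_real (h p) * cauchy_kernel (L u) s p)"
        unfolding D_def using integrable_cauchy_kernel(1)[OF h ImL(1) ls(2)] tu by simp
      also have "cmod \<dots> \<le> (LINT p|lborel. \<bar>h p\<bar> * (\<bar>t - u\<bar> * (1 / m * (1 / (m * \<bar>Im s\<bar>)))))"
        using h integrable_cauchy_kernel(1)[OF h ImL(1) ls(2)] tu
        by (intro Bochner_Integration.integral_norm_bound_integral le) auto
      also have "\<dots> = C / (m * m * \<bar>Im s\<bar>) * \<bar>t - u\<bar>" by (simp add: C_def)
      finally show ?thesis .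
    qed
    have cont: "continuous_on {m..} (\<lambda>t. D (L t) s)"
    proof (rule lipschitz_on_continuous_on)
      show "(C / (m * m * \<bar>Im s\<bar>))-lipschitz_on {m..} (\<lambda>t. D (L t) s)"
        using C m lip by (intro lipschitz_onI) (auto simp: dist_norm dist_real_def)
    qed
    have "(\<lambda>t. D (L t) s) constant_on {m..}"
    proof (rule continuous_discrete_range_constant[OF _ cont])
      fix t assume "t \<in> {m..}"
      \<comment> \<open>Distinct values are at least 4 pi^2 apart, so a continuous function on the
        connected ray is constant.\<close>
      have "4 * pi\<^sup>2 \<le> norm (D (L u) s - D (L t) s)" if "u \<in> {m..}" "D (L u) s \<noteq> D (L t) s" for u
      proof -
        have tu: "m \<le> t" "m \<le> u" using that(1) \<open>t \<in> {m..}\<close> by auto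
        obtain i :: int where i: "D (L u) s = - (4 * pi\<^sup>2 * of_int i)"
          using D_int[OF ImL(1)[OF tu(2)] ls(2)] by blast
        obtain j :: int where j: "D (L t) s = - (4 * pi\<^sup>2 * of_int j)"
          using D_int[OF ImL(1)[OF tu(1)] ls(2)] by blast
        note ij = i j
        have "D (L u) s - D (L t) s = of_real (4 * pi\<^sup>2 * of_int (j - i))" by (simp add: ij algebra_simps)
        then have "norm (D (L u) s - D (L t) s) = 4 * pi\<^sup>2 * \<bar>of_int (j - i)\<bar>"
          by (simp only: norm_of_real abs_mult) simp
        moreover have "i \<noteq> j" using that(2) ij by auto
        then have "1 \<le> \<bar>real_of_int (j - i)\<bar>" by linarith
        ultimately show ?thesis by simp
      qed
      then show "\<exists>e>0. \<forall>u. u \<in> {m..} \<and> D (L u) s \<noteq> D (L t) s \<longrightarrow> e \<le> norm (D (L u) s - D (L t) s)"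
        by (intro exI[of _ "4 * pi\<^sup>2"]) auto
    qed auto
    then obtain a where a: "\<And>t. t \<ge> m \<Longrightarrow> D (L t) s = a" by (auto simp: constant_on_def)
    \<comment> \<open>The kernel decays like 1/t along the ray, so the constant value must be
      0.\<close>
    have "cmod a \<le> C / \<bar>Im s\<bar> / t" if "t \<ge> m" for t
      using integrable_cauchy_kernel(2)[OF h ImL(1)[OF that] ls(2)] ImL(2)[OF that] a[OF that]
      by (simp add: D_def C_def mult.commute)
    then have "\<forall>\<^sub>F t in at_top. cmod a \<le> C / \<bar>Im s\<bar> / t"
      using eventually_ge_at_top[of m] by (rule eventually_mono[rotated])
    moreover have "((\<lambda>t. C / \<bar>Im s\<bar> / t) \<longlongrightarrow> 0) at_top"
      by (intro tendsto_divide_0[OF tendsto_const] filterlim_at_top_imp_at_infinity filterlim_ident)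
    ultimately have "cmod a \<le> 0" by (intro tendsto_lowerbound) auto
    have "L m = l" unfolding L_def \<sigma>(2)[symmetric] by (rule complex_surj)
    then have "D l s = a" using a[of m] by simp
    with \<open>cmod a \<le> 0\<close> show ?thesis by simp
  qed
  have "AE p in lborel. h p = 0"
    by (rule cauchy_transform_zero_imp_AE_zero[OF h]) (use D_0 D_def in auto)
  then show ?thesis by (simp add: h_def)
qed

section \<open>Semicircular operators\<close>

lemma orthonormal_sequence_tendsto_0:
  assumes on: "\<And>m n :: nat. cinner (e m) (e n) = (if m = n then 1 else 0)"
  shows "(\<lambda>n. cinner x (e n)) \<longlonglongrightarrow> 0"
proof -
  have inj: "inj_on e S" for S
    by (rule inj_onI) (metis on zero_neq_one)
  have "(\<Sum>n<N. (cmod (cinner x (e n)))\<^sup>2) \<le> (norm x)\<^sup>2" for N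
  proof -
    have o: "cinner u v = (if u = v then 1 else 0)" if "u \<in> e ` {..<N}" "v \<in> e ` {..<N}" for u v
      using that on inj_onD[OF inj[of UNIV]] by auto
    have "0 \<le> (norm (x - (\<Sum>u\<in>e ` {..<N}. cinner x u *\<^sub>C u)))\<^sup>2" by simp
    then have "0 \<le> (norm x)\<^sup>2 - (\<Sum>u\<in>e ` {..<N}. (cmod (cinner x u))\<^sup>2)"
      using orthonormal_dist[of "e ` {..<N}" x "cinner x", OF _ o] by simp
    then show ?thesis by (simp add: sum.reindex[OF inj])
  qed
  then have "summable (\<lambda>n. (cmod (cinner x (e n)))\<^sup>2)"
    by (intro summableI_nonneg_bounded) auto
  then have "(\<lambda>n. (cmod (cinner x (e n)))\<^sup>2) \<longlonglongrightarrow> 0" by (rule summable_LIMSEQ_zero)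
  from tendsto_real_sqrt[OF this] show ?thesis by (simp add: tendsto_norm_zero_iff)
qed

text \<open>Captures what the left and the right operator share: on the orthonormal sequence
  \<open>e\<close>, the operator is \<open>a\<close> times the sum of the unilateral shift and its
  adjoint. The sequence need not span the space.\<close>

locale semicircular =
  fixes X :: "'f::chilbert_space \<Rightarrow> 'f" and e :: "nat \<Rightarrow> 'f" and a :: real
  assumes X: "X \<in> bounded_ops UNIV" and selfadjoint: "cinner (X x) y = cinner x (X y)"
    and a_pos: "a > 0" and orthonormal: "cinner (e m) (e n) = (if m = n then 1 else 0)"
    and X_0: "X (e 0) = of_real a *\<^sub>C e (Suc 0)"
    and X_Suc: "X (e (Suc n)) = of_real a *\<^sub>C (e (Suc (Suc n)) + e n)"
begin

lemma norm_e: "norm (e n) = 1"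
  using orthonormal[of n n] by (simp add: cinner_self power2_eq_1_iff flip: of_real_power)
    (metis norm_ge_zero neg_0_le_iff_le not_one_le_zero)

lemma e_in:
  assumes M: "csubspace M" and inv: "\<And>x. x \<in> M \<Longrightarrow> X x \<in> M" and e0: "e 0 \<in> M"
  shows "e n \<in> M"
proof (induction n rule: less_induct)
  case (less n)
  have sc: "c *\<^sub>C x \<in> M" if "x \<in> M" for c x using M that by (simp add: csubspace_def)
  have inverse: "of_real (1 / a) *\<^sub>C of_real a *\<^sub>C x = x" for x :: 'f
    using a_pos by (simp add: scaleC_scaleC)
  consider "n = 0" | "n = Suc 0" | k where "n = Suc (Suc k)" by (metis not0_implies_Suc)
  then show ?case
  proof cases
    case 2
    have "of_real (1 / a) *\<^sub>C X (e 0) \<in> M" by (intro sc inv e0)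
    then show ?thesis unfolding X_0 inverse using 2 by simp
  next
    case 3
    have "of_real (1 / a) *\<^sub>C X (e (Suc k)) \<in> M" using 3 less by (intro sc inv) simp
    then have "(e (Suc (Suc k)) + e k) - e k \<in> M"
      unfolding X_Suc inverse using 3 less by (intro csubspace_diff[OF M]) simp_all
    then show ?thesis using 3 by simp
  qed (simp add: e0)
qed

text \<open>Solves the resolvent equation at the vacuum in the ambient space. In the partial sums
  everything cancels except two boundary terms, which tend to 0 as |w| < 1.\<close>

lemma resolvent_vector:
  assumes w: "w \<noteq> 0" "cmod w < 1" and s: "s = of_real a * (w + 1 / w)"
  obtains V where "(\<lambda>n. (- (w / of_real a) * w ^ n) *\<^sub>C e n) sums V" "X V - s *\<^sub>C V = e 0"
proof -
  define x where "x n = - (w / of_real a) * w ^ n" for n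
  have x0: "1 - of_real a * x (Suc 0) = - (s * x 0)"
    using a_pos w(1) by (simp add: x_def s field_simps)
  have rec: "of_real a * x n - s * x (Suc n) = - (of_real a * x (Suc (Suc n)))" for n
    using a_pos w(1) by (simp add: x_def s field_simps)
  define v where "v N = (\<Sum>n<N. x n *\<^sub>C e n)" for N
  have lin: "X (u + u') = X u + X u'" "X (c *\<^sub>C u) = c *\<^sub>C X u" for u u' c
    using bounded_ops_add[OF X] bounded_ops_scaleC[OF X] by auto
  have Xv: "X (v (Suc N)) - s *\<^sub>C v (Suc N)
      = e 0 - (of_real a * x (Suc N)) *\<^sub>C e N + (of_real a * x N) *\<^sub>C e (Suc N)" for N
  proof (induction N)
    case 0
    have "X (v (Suc 0)) - s *\<^sub>C v (Suc 0) = (of_real a * x 0) *\<^sub>C e (Suc 0) + (- (s * x 0)) *\<^sub>C e 0"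
      by (simp add: v_def lin X_0 scaleC_scaleC mult.commute)
    also have "\<dots> = e 0 - (of_real a * x (Suc 0)) *\<^sub>C e 0 + (of_real a * x 0) *\<^sub>C e (Suc 0)"
      unfolding x0[symmetric] by (simp add: scaleC_diff_left)
    finally show ?case .
  next
    case (Suc N)
    have v: "v (Suc (Suc N)) = v (Suc N) + x (Suc N) *\<^sub>C e (Suc N)" by (simp add: v_def)
    have "X (v (Suc (Suc N))) - s *\<^sub>C v (Suc (Suc N)) = (X (v (Suc N)) - s *\<^sub>C v (Suc N))
        + (x (Suc N) *\<^sub>C X (e (Suc N)) - (s * x (Suc N)) *\<^sub>C e (Suc N))"
      by (simp add: v lin scaleC_add_right scaleC_scaleC)
    also have "\<dots> = e 0 + (of_real a * x N - s * x (Suc N)) *\<^sub>C e (Suc N)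
        + (of_real a * x (Suc N)) *\<^sub>C e (Suc (Suc N))"
      by (simp add: Suc.IH X_Suc scaleC_add_right scaleC_diff_left scaleC_scaleC mult.commute)
    finally show ?case unfolding rec by simp
  qed
  have "norm (x n *\<^sub>C e n) = cmod w / a * cmod w ^ n" for n
    using a_pos unfolding x_def norm_scaleC norm_e norm_mult norm_minus_cancel norm_divide norm_power by simp
  then have "summable (\<lambda>n. norm (x n *\<^sub>C e n))"
    using summable_mult[OF summable_geometric[of "cmod w"], of "cmod w / a"] w(2) by simp
  then have "summable (\<lambda>n. x n *\<^sub>C e n)" by (rule summable_norm_cancel)
  then have sums: "(\<lambda>n. x n *\<^sub>C e n) sums (\<Sum>n. x n *\<^sub>C e n)" by (rule summable_sums)
  define V where "V = (\<Sum>n. x n *\<^sub>C e n)"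
  have vV: "(\<lambda>N. v (Suc N)) \<longlonglongrightarrow> V"
    using LIMSEQ_Suc[OF sums[unfolded sums_def]] by (simp add: v_def V_def)
  have "(\<lambda>N. X (v (Suc N)) - s *\<^sub>C v (Suc N)) \<longlonglongrightarrow> X V - s *\<^sub>C V"
    by (intro tendsto_diff tendsto_scaleC vV bounded_linear.tendsto[OF bounded_ops_bounded_linear[OF X]])
  moreover have "(\<lambda>N. X (v (Suc N)) - s *\<^sub>C v (Suc N)) \<longlonglongrightarrow> e 0 - 0 + 0"
    unfolding Xv
  proof (intro tendsto_add tendsto_diff tendsto_const)
    have "(\<lambda>n. of_real a * x n) \<longlonglongrightarrow> of_real a * (- (w / of_real a) * 0)"
      unfolding x_def by (intro tendsto_intros LIMSEQ_power_zero w)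
    then have ax: "(\<lambda>n. of_real a * x n) \<longlonglongrightarrow> 0" by simp
    have null: "(\<lambda>N. y N *\<^sub>C e (i N)) \<longlonglongrightarrow> 0" if "y \<longlonglongrightarrow> 0" for y i
      using that by (simp add: tendsto_norm_zero_iff[symmetric, of "\<lambda>N. y N *\<^sub>C e (i N)"] norm_scaleC norm_e
          tendsto_norm_zero_iff)
    show "(\<lambda>N. (of_real a * x (Suc N)) *\<^sub>C e N) \<longlonglongrightarrow> 0"
      by (rule null[OF LIMSEQ_Suc[OF ax]])
    show "(\<lambda>N. (of_real a * x N) *\<^sub>C e (Suc N)) \<longlonglongrightarrow> 0"
      by (rule null[OF ax])
  qed
  ultimately have "X V - s *\<^sub>C V = e 0" using LIMSEQ_unique by fastforce
  then show ?thesis using that[of V] sums unfolding V_def x_def by simp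
qed

text \<open>Pairing the resolvent equation with \<open>e n\<close> gives the three-term recurrence,
  and Bessel's inequality makes the coefficients a null sequence. Hence they are geometric, which
  both locates s and determines them.\<close>

lemma resolvent_vacuum:
  assumes M: "closed_csubspace M" and inv: "\<And>x. x \<in> M \<Longrightarrow> X x \<in> M" and e0: "e 0 \<in> M"
    and spec: "s \<notin> spectrum M (restrict X M)"
  obtains w where "w \<noteq> 0" "cmod w < 1" "s = of_real a * (w + 1 / w)"
    "(\<lambda>n. (- (w / of_real a) * w ^ n) *\<^sub>C e n) sums resolvent M (restrict X M) s (e 0)"
proof -
  have sub: "csubspace M" using M by (simp add: closed_csubspace_def)
  define R where "R = resolvent M (restrict X M) s (e 0)"
  have RM: "R \<in> M" unfolding R_def by (rule resolvent(1)[OF spec e0])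
  have XR: "X R - s *\<^sub>C R = e 0" using resolvent(2)[OF spec e0] RM by (simp add: R_def)
  define x where "x n = cinner R (e n)" for n
  have eq: "cinner R (X (e n)) - s * x n = (if n = 0 then 1 else 0)" for n
  proof -
    have "cinner (X R - s *\<^sub>C R) (e n) = cinner (e 0) (e n)" by (simp add: XR)
    then show ?thesis
      by (simp add: cinner_diff_left cinner_scaleC_left selfadjoint orthonormal x_def split: if_splits)
  qed
  have x1: "of_real a * x (Suc 0) - s * x 0 = 1"
    using eq[of 0] by (simp add: X_0 cinner_scaleC_right x_def)
  obtain w where w: "w \<noteq> 0" "cmod w \<le> 1" "s / of_real a = w + 1 / w"
    by (rule joukowski_surj)
  then have s: "s = of_real a * (w + 1 / w)" using a_pos by (simp add: field_simps)
  have rec: "x (n + 2) = (w + 1 / w) * x (n + 1) - x n" for n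
  proof -
    have "of_real a * (x (n + 2) + x n) = of_real a * ((w + 1 / w) * x (n + 1))"
      using eq[of "Suc n"] by (simp add: X_Suc cinner_scaleC_right cinner_add_right x_def s mult.assoc)
    then have "x (n + 2) + x n = (w + 1 / w) * x (n + 1)" using a_pos by simp
    then show ?thesis by (simp only: eq_diff_eq)
  qed
  have x_lim: "x \<longlonglongrightarrow> 0" unfolding x_def by (rule orthonormal_sequence_tendsto_0[OF orthonormal])
  have geo: "x (Suc n) = w * x n" for n
  proof (rule three_term_recurrence[OF w(1) rec])
    show "(\<lambda>n. w ^ n * x n) \<longlonglongrightarrow> 0"
    proof (rule Lim_null_comparison[OF _ tendsto_norm_zero[OF x_lim]])
      have "cmod (w ^ n) * cmod (x n) \<le> 1 * cmod (x n)" for n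
        using w(2) by (intro mult_right_mono) (auto simp: norm_power power_le_one)
      then show "\<forall>\<^sub>F n in sequentially. norm (w ^ n * x n) \<le> norm (x n)"
        by (simp add: norm_mult)
    qed
  qed
  have "of_real a * (w * x 0) - of_real a * (w + 1 / w) * x 0 = 1"
    using x1 geo[of 0] s by simp
  then have "- (of_real a * x 0) = w" using w(1) by (simp add: field_simps)
  then have "- w = of_real a * x 0" by (metis minus_minus)
  then have "x 0 = (- w) / of_real a" using a_pos by simp
  then have "x 0 = - (w / of_real a)" by simp
  then have xn: "x n = - (w / of_real a) * w ^ n" for n
    by (induction n) (simp_all add: geo)
  \<comment> \<open>On the unit circle all coefficients would have modulus 1/a, contradicting
    convergence to 0.\<close>
  have "cmod w \<noteq> 1"
  proof
    assume "cmod w = 1"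
    then have "cmod (x n) = 1 / a" for n using a_pos by (simp add: xn norm_mult norm_divide norm_power)
    then have "(\<lambda>n::nat. 1 / a) \<longlonglongrightarrow> 0" using tendsto_norm_zero[OF x_lim] by simp
    then show False using a_pos by (simp add: LIMSEQ_const_iff)
  qed
  then have w1: "cmod w < 1" using w(2) by simp
  \<comment> \<open>The coefficients control the resolvent vector only along the sequence
    \<open>e\<close>. Uniqueness of the solution in \<open>M\<close> identifies it with the
    series.\<close>
  obtain V where V: "(\<lambda>n. (- (w / of_real a) * w ^ n) *\<^sub>C e n) sums V" "X V - s *\<^sub>C V = e 0"
    by (rule resolvent_vector[OF w(1) w1 s])
  have "V \<in> M"
  proof (rule closed_sequentially)
    show "closed M" using M by (simp add: closed_csubspace_def)
    show "(\<lambda>N. \<Sum>n<N. (- (w / of_real a) * w ^ n) *\<^sub>C e n) \<longlonglongrightarrow> V" using V(1) by (simp add: sums_def)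
    show "(\<Sum>n<N. (- (w / of_real a) * w ^ n) *\<^sub>C e n) \<in> M" for N
      by (rule csubspace_sum[OF sub]) (rule e_in[OF sub inv e0])
  qed
  then have "R = V" unfolding R_def using V(2) by (intro resolvent(3)[OF spec e0]) simp_all
  then show ?thesis using that[OF w(1) w1 s] V(1) by (simp add: R_def)
qed

end

text \<open>All that is needed from the Fock space: a common vacuum, the cross Gram matrix diag(c^n)
  of the two sequences, and a commutator supported on the vacuum.\<close>

locale semicircular_pair =
  X1: semicircular X1 e a + X2: semicircular X2 f b
  for X1 :: "'f::chilbert_space \<Rightarrow> 'f" and e a X2 f b +
  fixes c :: complex
  assumes f_0: "f 0 = e 0"
    and cinner_e_f: "cinner (e m) (f n) = (if m = n then c ^ n else 0)"
    and commutator: "X1 (X2 x) - X2 (X1 x) = (of_real (a * b) * (cnj c - c) * cinner x (e 0)) *\<^sub>C e 0"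
    and c_less: "cmod c < 1" and Im_c: "Im c \<noteq> 0"
begin

definition T :: "'f \<Rightarrow> 'f" where "T x = X1 x + \<i> *\<^sub>C X2 x"

definition T' :: "'f \<Rightarrow> 'f" where "T' x = X1 x + (- \<i>) *\<^sub>C X2 x"

lemma T_bounded: "T \<in> bounded_ops UNIV" "T' \<in> bounded_ops UNIV"
  unfolding T_def[abs_def] T'_def[abs_def]
  by (intro bounded_ops_UNIV_add bounded_ops_UNIV_scale X1.X X2.X)+

lemma T_adjoint: "cinner (T x) y = cinner x (T' y)" "cinner (T' x) y = cinner x (T y)"
  by (simp_all add: T_def T'_def cinner_simps X1.selfadjoint X2.selfadjoint)

lemma cadjoint_T: "cadjoint UNIV T = T'"
  by (rule cadjoint_eqI[OF T_bounded(2)]) (simp_all add: T_adjoint csubspace_def)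

definition M :: "'f set" where "M = closure {A (e 0) | A. A \<in> unital_alg {T, T'}}"

lemma M_closed: "closed_csubspace M"
  unfolding M_def
proof (rule csubspace_closure, unfold csubspace_def, intro conjI ballI allI)
  let ?W = "{A (e 0) | A. A \<in> unital_alg {T, T'}}"
  have W: "A (e 0) \<in> ?W" if "A \<in> unital_alg {T, T'}" for A using that by auto
  have "(\<lambda>x. 0 *\<^sub>C x) \<in> unital_alg {T, T'}" by (intro unital_alg.scale unital_alg.one)
  from W[OF this] show "0 \<in> ?W" by simp
  show "x + y \<in> ?W" if "x \<in> ?W" "y \<in> ?W" for x y
  proof -
    from CollectD[OF that(1)] obtain A where A: "x = A (e 0) \<and> A \<in> unital_alg {T, T'}" ..
    from CollectD[OF that(2)] obtain B where B: "y = B (e 0) \<and> B \<in> unital_alg {T, T'}" ..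
    show ?thesis
      using W[OF unital_alg.add[OF conjunct2[OF A] conjunct2[OF B]]]
      unfolding conjunct1[OF A] conjunct1[OF B] .
  qed
  show "k *\<^sub>C x \<in> ?W" if "x \<in> ?W" for k x
  proof -
    from CollectD[OF that] obtain A where A: "x = A (e 0) \<and> A \<in> unital_alg {T, T'}" ..
    show ?thesis using W[OF unital_alg.scale[OF conjunct2[OF A]]] unfolding conjunct1[OF A] .
  qed
qed

lemma M_csubspace: "csubspace M"
  using M_closed by (simp add: closed_csubspace_def)

lemma e_0_in: "e 0 \<in> M"
proof -
  have "e 0 \<in> {A (e 0) | A. A \<in> unital_alg {T, T'}}"
    by (intro CollectI exI[of _ "\<lambda>x. x"]) (simp add: unital_alg.one)
  then show ?thesis unfolding M_def by (rule subsetD[OF closure_subset])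
qed

lemma T_in: assumes "x \<in> M" shows "T x \<in> M" "T' x \<in> M"
proof -
  have "S x \<in> M" if S: "S \<in> {T, T'}" for S
  proof -
    have bl: "bounded_linear S"
      using S bounded_ops_bounded_linear[OF T_bounded(1)] bounded_ops_bounded_linear[OF T_bounded(2)] by auto
    have "S ` {A (e 0) | A. A \<in> unital_alg {T, T'}} \<subseteq> {A (e 0) | A. A \<in> unital_alg {T, T'}}"
    proof (intro image_subsetI)
      fix y assume "y \<in> {A (e 0) | A. A \<in> unital_alg {T, T'}}"
      from CollectD[OF this] obtain A where A: "y = A (e 0) \<and> A \<in> unital_alg {T, T'}" ..
      show "S y \<in> {A (e 0) | A. A \<in> unital_alg {T, T'}}" unfolding conjunct1[OF A]
        by (rule CollectI, rule exI[of _ "\<lambda>x. S (A x)"], rule conjI[OF refl],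
            rule unital_alg.mult[OF unital_alg.gen[OF S] conjunct2[OF A]])
    qed
    also have "\<dots> \<subseteq> M" unfolding M_def by (rule closure_subset)
    finally have W: "S ` {A (e 0) | A. A \<in> unital_alg {T, T'}} \<subseteq> M" .
    have "S ` closure {A (e 0) | A. A \<in> unital_alg {T, T'}} \<subseteq> M"
      by (rule image_closure_subset[OF linear_continuous_on[OF bl] _ W])
        (use M_closed in \<open>simp add: closed_csubspace_def\<close>)
    then show ?thesis using assms unfolding M_def[symmetric] by blast
  qed
  then show "T x \<in> M" "T' x \<in> M" by auto
qed

lemma X_in: assumes "x \<in> M" shows "X1 x \<in> M" "X2 x \<in> M"
proof -
  have "(1/2) *\<^sub>C (T x + T' x) \<in> M" "(- \<i>/2) *\<^sub>C (T x - T' x) \<in> M"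
    using M_csubspace T_in[OF assms] csubspace_diff[OF M_csubspace T_in[OF assms]]
    by (simp_all add: csubspace_def del: scaleC_minus_left)
  moreover have "(1/2) *\<^sub>C (T x + T' x) = X1 x"
    by (simp add: T_def T'_def scaleC_add_left[symmetric] flip: scaleC_add_right)
      (simp add: scaleC_add_right scaleC_add_left[symmetric])
  moreover have "(- \<i>/2) *\<^sub>C (T x - T' x) = X2 x"
    by (simp add: T_def T'_def scaleC_add_right scaleC_scaleC flip: scaleC_add_left)
  ultimately show "X1 x \<in> M" "X2 x \<in> M" by simp_all
qed

lemma restrict_bounded: "restrict X1 M \<in> bounded_ops M" "restrict X2 M \<in> bounded_ops M"
  "restrict T M \<in> bounded_ops M" "restrict T' M \<in> bounded_ops M"
  using X_in T_in by (auto intro!: bounded_ops_restrict X1.X X2.X T_bounded M_csubspace)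

lemma cadjoint_restrict:
  assumes N: "csubspace N" "\<And>x. x \<in> N \<Longrightarrow> T x \<in> N" "\<And>x. x \<in> N \<Longrightarrow> T' x \<in> N"
  shows "cadjoint N (restrict T N) = restrict T' N"
proof (rule cadjoint_eqI)
  show "restrict T' N \<in> bounded_ops N"
    using N by (intro bounded_ops_restrict T_bounded) auto
qed (use N in \<open>auto simp: T_adjoint\<close>)

lemma cadjoint_restrict_M: "cadjoint M (restrict T M) = restrict T' M"
  by (rule cadjoint_restrict) (simp_all add: M_csubspace T_in)

lemma real_part: "real_part_op M (restrict T M) = restrict X1 M"
proof -
  have "(1/2) *\<^sub>C (T x + T' x) = X1 x" for x
    by (simp add: T_def T'_def scaleC_add_right flip: scaleC_add_left)
  then show ?thesis
    unfolding real_part_op_def cadjoint_restrict_M by (auto simp: fun_eq_iff)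
qed

lemma imag_part: "imag_part_op M (restrict T M) = restrict X2 M"
proof -
  have "(- \<i>/2) *\<^sub>C (T x - T' x) = X2 x" for x
    by (simp add: T_def T'_def scaleC_add_right scaleC_scaleC flip: scaleC_add_left)
  then show ?thesis
    unfolding imag_part_op_def cadjoint_restrict_M by (auto simp: fun_eq_iff)
qed

text \<open>The self-commutator is 2 \<i> times the commutator of X1 and X2, and cnj c - c = -2 \<i>
  Im c, whence the factor 4.\<close>

lemma T_commutator: "T' (T x) - T (T' x) = (of_real (4 * a * b * Im c) * cinner x (e 0)) *\<^sub>C e 0"
proof -
  have lin: "X1 (u + v) = X1 u + X1 v" "X1 (k *\<^sub>C u) = k *\<^sub>C X1 u"
    "X2 (u + v) = X2 u + X2 v" "X2 (k *\<^sub>C u) = k *\<^sub>C X2 u" for u v k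
    using bounded_ops_add[OF X1.X] bounded_ops_scaleC[OF X1.X]
      bounded_ops_add[OF X2.X] bounded_ops_scaleC[OF X2.X] by auto
  have "T' (T x) - T (T' x) = (\<i> + \<i>) *\<^sub>C (X1 (X2 x)) - (\<i> + \<i>) *\<^sub>C (X2 (X1 x))"
    unfolding T_def T'_def lin scaleC_add_right scaleC_scaleC scaleC_add_left by simp
  also have "\<dots> = (\<i> + \<i>) *\<^sub>C (X1 (X2 x) - X2 (X1 x))" by (simp only: scaleC_diff_right)
  also have "\<dots> = ((\<i> + \<i>) * (of_real (a * b) * (cnj c - c) * cinner x (e 0))) *\<^sub>C e 0"
    unfolding commutator scaleC_scaleC ..
  also have "(\<i> + \<i>) * (of_real (a * b) * (cnj c - c) * cinner x (e 0)) = of_real (4 * a * b * Im c) * cinner x (e 0)"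
  proof -
    have "(\<i> + \<i>) * (cnj c - c) = of_real (4 * Im c)" by (simp add: complex_eq_iff)
    then have "of_real (a * b) * ((\<i> + \<i>) * (cnj c - c)) * cinner x (e 0) = of_real (a * b) * of_real (4 * Im c) * cinner x (e 0)"
      by simp
    then show ?thesis by (simp add: mult_ac)
  qed
  finally show ?thesis .
qed

lemma self_commutator: "self_commutator M (restrict T M) = rank_one M (e 0) (of_real (4 * a * b * Im c))"
  unfolding self_commutator_def cadjoint_restrict_M rank_one_def
  by (rule restrict_ext) (simp add: T_in T_commutator del: of_real_mult)

lemma C_op: "C_op M (restrict T M) = rank_one M (e 0) (of_real (- 2 * a * b * Im c))"
  unfolding C_op_def self_commutator rank_one_def
  by (rule restrict_ext) (simp add: scaleC_scaleC mult_ac)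

lemma vacuum: "cinner (e 0) (e 0) = 1" "e (Suc 0) \<in> M" "e (Suc 0) \<noteq> 0" "cinner (e (Suc 0)) (e 0) = 0"
  using X1.e_in[OF M_csubspace X_in(1) e_0_in, of "Suc 0"] X1.norm_e[of "Suc 0"]
  by (auto simp: X1.orthonormal)

lemmas rank_one_facts = M_csubspace e_0_in vacuum

lemma C_hat: "C_hat M (restrict T M) = rank_one M (e 0) (signed_root (- 2 * a * b * Im c))"
  unfolding C_hat_def C_op
  using X1.a_pos X2.a_pos Im_c by (intro cont_fun_calc_rank_one[OF rank_one_facts]) (auto simp: signed_root_def)

text \<open>The root stands on both sides of the resolvents, so only its square enters the
  determinant and the choice of branch drops out.\<close>

lemma signed_root_square: "signed_root t * signed_root t = of_real t"
proof (cases "t < 0")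
  case True
  have "complex_of_real (sqrt (- t)) * of_real (sqrt (- t)) = of_real (- t)"
    using True unfolding of_real_mult[symmetric] by simp
  moreover have "signed_root t * signed_root t = - (complex_of_real (sqrt (- t)) * of_real (sqrt (- t)))"
    using True by (simp add: signed_root_def complex_eq_iff)
  ultimately show ?thesis by simp
next
  case False
  then show ?thesis unfolding signed_root_def by (simp flip: of_real_mult)
qed

text \<open>Normality on N annihilates the self-commutator there, so N is orthogonal to the vacuum,
  as Im c is nonzero. N is invariant under T and its adjoint, hence orthogonal to the whole orbit of
  the vacuum and to its closure M, which contains N.\<close>

lemma completely_non_normal: "completely_non_normal M (restrict T M)"
  unfolding completely_non_normal_def
proof (intro allI impI)
  fix N assume N: "reducing_subspace M (restrict T M) N \<and> normal_op N (restrict (restrict T M) N)"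
  then have sub: "closed_csubspace N" "N \<subseteq> M" and TN: "restrict T M ` N \<subseteq> N" "restrict T' M ` N \<subseteq> N"
    unfolding reducing_subspace_def cadjoint_restrict_M by auto
  have Tin: "T x \<in> N" "T' x \<in> N" if "x \<in> N" for x
  proof -
    have "restrict T M x \<in> N" "restrict T' M x \<in> N" using TN that by blast+
    moreover have "x \<in> M" using sub(2) that by blast
    ultimately show "T x \<in> N" "T' x \<in> N" by simp_all
  qed
  have csub: "csubspace N" using sub(1) by (simp add: closed_csubspace_def)
  have "restrict (restrict T M) N = restrict T N"
    using subsetD[OF sub(2)] by (intro ext) (simp add: restrict_def)
  then have normal: "T' (T x) = T (T' x)" if "x \<in> N" for x
    using N that cadjoint_restrict[OF csub Tin] Tin unfolding normal_op_def by simp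
  have ortho: "cinner x (e 0) = 0" if "x \<in> N" for x
  proof -
    have "(of_real (4 * a * b * Im c) * cinner x (e 0)) *\<^sub>C e 0 = 0"
      using T_commutator[of x] normal[OF that] by simp
    from arg_cong[OF this, of "\<lambda>u. cinner u (e 0)"]
    have "of_real (4 * a * b * Im c) * cinner x (e 0) = 0"
      by (simp add: cinner_scaleC_left vacuum(1))
    then show ?thesis using X1.a_pos X2.a_pos Im_c by simp
  qed
  \<comment> \<open>Adjoints of algebra elements are produced by induction as mere functions that
    preserve N; boundedness is irrelevant for the orthogonality argument.\<close>
  have adj: "\<exists>A'. (\<forall>x\<in>N. A' x \<in> N) \<and> (\<forall>x y. cinner x (A y) = cinner (A' x) y)"
    if "A \<in> unital_alg {T, T'}" for A
    using that
  proof induction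
    case one
    show ?case by (intro exI[of _ "\<lambda>x. x"]) simp
  next
    case (gen A)
    then consider "A = T" | "A = T'" by auto
    then show ?case
    proof cases
      case 1
      show ?thesis unfolding 1 by (intro exI[of _ T']) (simp add: T_adjoint Tin)
    next
      case 2
      show ?thesis unfolding 2 by (intro exI[of _ T]) (simp add: T_adjoint Tin)
    qed
  next
    case (add A B)
    from add.IH(1) obtain A' where A': "(\<forall>x\<in>N. A' x \<in> N) \<and> (\<forall>x y. cinner x (A y) = cinner (A' x) y)" ..
    from add.IH(2) obtain B' where B': "(\<forall>x\<in>N. B' x \<in> N) \<and> (\<forall>x y. cinner x (B y) = cinner (B' x) y)" ..
    with A' show ?case using csub
      by (intro exI[of _ "\<lambda>x. A' x + B' x"]) (simp add: csubspace_def cinner_add_left cinner_add_right)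
  next
    case (scale A k)
    from scale.IH obtain A' where A': "(\<forall>x\<in>N. A' x \<in> N) \<and> (\<forall>x y. cinner x (A y) = cinner (A' x) y)" ..
    then show ?case using csub
      by (intro exI[of _ "\<lambda>x. cnj k *\<^sub>C A' x"]) (simp add: csubspace_def cinner_scaleC_left cinner_scaleC_right)
  next
    case (mult A B)
    from mult.IH(1) obtain A' where A': "(\<forall>x\<in>N. A' x \<in> N) \<and> (\<forall>x y. cinner x (A y) = cinner (A' x) y)" ..
    from mult.IH(2) obtain B' where B': "(\<forall>x\<in>N. B' x \<in> N) \<and> (\<forall>x y. cinner x (B y) = cinner (B' x) y)" ..
    with A' show ?case by (intro exI[of _ "\<lambda>x. B' (A' x)"]) simp
  qed
  show "N = {0}"
  proof
    show "N \<subseteq> {0}"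
    proof
      fix x assume x: "x \<in> N"
      have "cinner x (A (e 0)) = 0" if A: "A \<in> unital_alg {T, T'}" for A
      proof -
        from adj[OF A] obtain A' where A': "(\<forall>x\<in>N. A' x \<in> N) \<and> (\<forall>x y. cinner x (A y) = cinner (A' x) y)" ..
        then show ?thesis using ortho x by simp
      qed
      then have "{A (e 0) | A. A \<in> unital_alg {T, T'}} \<subseteq> {y. cinner x y = 0}" by auto
      then have "M \<subseteq> {y. cinner x y = 0}"
        unfolding M_def by (intro closure_minimal closed_Collect_eq continuous_intros) auto
      then have "cinner x x = 0" using x sub(2) by blast
      then show "x \<in> {0}" by simp
    qed
    show "{0} \<subseteq> N" using csub by (simp add: csubspace_def)
  qed
qed

text \<open>E(l, s) is the identity plus a multiple of the vacuum projection, and that multiple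
  contains the pairing of the two resolvents at the vacuum. Moving the resolvent at l to the other
  side turns the pairing into a geometric series in w z c.\<close>

lemma determining_function:
  assumes l: "l \<notin> spectrum M (restrict X2 M)" and s: "s \<notin> spectrum M (restrict X1 M)"
  shows "\<exists>w z. w \<noteq> 0 \<and> cmod w < 1 \<and> s = of_real a * (w + 1 / w) \<and>
    z \<noteq> 0 \<and> cmod z < 1 \<and> l = of_real b * (z + 1 / z) \<and>
    fredholm_det M (determining_function M (restrict T M) l s) = (1 - w * z * cnj c) / (1 - w * z * c)"
proof -
  have f0M: "f 0 \<in> M" by (simp add: f_0 e_0_in)
  obtain w where w: "w \<noteq> 0" "cmod w < 1" "s = of_real a * (w + 1 / w)"
    "(\<lambda>n. (- (w / of_real a) * w ^ n) *\<^sub>C e n) sums resolvent M (restrict X1 M) s (e 0)"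
    by (rule X1.resolvent_vacuum[OF M_closed X_in(1) e_0_in s])
  obtain z where z: "z \<noteq> 0" "cmod z < 1" "l = of_real b * (z + 1 / z)"
    by (rule X2.resolvent_vacuum[OF M_closed X_in(2) f0M l])
  \<comment> \<open>From the resolvent at l only the parameter z is taken; the vector is built at
    cnj l, where the adjoint of X2 - l lives.\<close>
  have z': "cnj z \<noteq> 0" "cmod (cnj z) < 1" "cnj l = of_real b * (cnj z + 1 / cnj z)"
    using z by simp_all
  obtain V where V: "(\<lambda>n. (- (cnj z / of_real b) * cnj z ^ n) *\<^sub>C f n) sums V" "X2 V - cnj l *\<^sub>C V = f 0"
    by (rule X2.resolvent_vector[OF z'])
  define R1 where "R1 = resolvent M (restrict X1 M) s (e 0)"
  define R2 where "R2 = resolvent M (restrict X2 M) l R1"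
  have R1M: "R1 \<in> M" unfolding R1_def by (rule resolvent(1)[OF s e_0_in])
  have R2M: "R2 \<in> M" unfolding R2_def by (rule resolvent(1)[OF l R1M])
  have R2: "X2 R2 - l *\<^sub>C R2 = R1" using resolvent(2)[OF l R1M] R2M by (simp add: R2_def)
  have "cinner R2 (e 0) = cinner R2 (X2 V - cnj l *\<^sub>C V)" unfolding V(2) f_0 ..
  also have "\<dots> = cinner (X2 R2 - l *\<^sub>C R2) V"
    by (simp add: cinner_diff_left cinner_diff_right cinner_scaleC_left cinner_scaleC_right X2.selfadjoint)
  finally have ip: "cinner R2 (e 0) = cinner R1 V" unfolding R2 .
  \<comment> \<open>Orthogonality of tensors of different degree leaves a single term; conjugation
    in the second argument turns cnj z back into z.\<close>
  have eV: "cinner (e n) V = - (z / of_real b) * z ^ n * c ^ n" for n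
  proof -
    have "(\<lambda>m. cinner (e n) ((- (cnj z / of_real b) * cnj z ^ m) *\<^sub>C f m)) sums cinner (e n) V"
      by (rule bounded_linear.sums[OF bounded_linear_cinner_right V(1)])
    moreover have "(\<lambda>m. cinner (e n) ((- (cnj z / of_real b) * cnj z ^ m) *\<^sub>C f m))
        = (\<lambda>m. if m = n then - (z / of_real b) * z ^ n * c ^ n else 0)"
      by (auto simp: fun_eq_iff cinner_scaleC_right cinner_e_f simp del: scaleC_minus_left)
    ultimately have "(\<lambda>m. if m = n then - (z / of_real b) * z ^ n * c ^ n else 0) sums cinner (e n) V" by simp
    then show ?thesis using sums_unique2[OF sums_single[of n "\<lambda>_. - (z / of_real b) * z ^ n * c ^ n"]] by simp
  qed
  have lt1: "cmod (p * q) < 1" if "cmod p < 1" "cmod q < 1" for p q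
    using mult_left_mono[of "cmod q" 1 "cmod p"] that by (simp add: norm_mult)
  have small: "cmod (w * z * c) < 1" using lt1 w(2) z(2) c_less by blast
  then have ne: "1 - w * z * c \<noteq> 0" by (metis eq_iff_diff_eq_0 norm_one order_less_irrefl)
  define k where "k = w * z / of_real (a * b) * (1 / (1 - w * z * c))"
  have "(\<lambda>n. cinner ((- (w / of_real a) * w ^ n) *\<^sub>C e n) V) sums cinner R1 V"
    unfolding R1_def by (rule bounded_linear.sums[OF bounded_linear_cinner_left w(4)])
  moreover have "cinner ((- (w / of_real a) * w ^ n) *\<^sub>C e n) V = w * z / of_real (a * b) * (w * z * c) ^ n" for n
    unfolding cinner_scaleC_left eV by (simp add: power_mult_distrib)
  moreover have "(\<lambda>n. w * z / of_real (a * b) * (w * z * c) ^ n) sums k"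
    unfolding k_def by (intro sums_mult geometric_sums small)
  ultimately have R1V: "cinner R1 V = k" using sums_unique2 by simp
  define \<sigma> where "\<sigma> = signed_root (- 2 * a * b * Im c)"
  define \<kappa> where "\<kappa> = (1 / \<i>) * (\<sigma> * \<sigma> * k)"
  have "determining_function M (restrict T M) l s = (\<lambda>x\<in>M. x + rank_one M (e 0) \<kappa> x)"
    unfolding determining_function_def real_part imag_part C_hat \<sigma>_def[symmetric]
  proof (rule restrict_ext)
    fix x assume x: "x \<in> M"
    have 1: "rank_one M (e 0) \<sigma> x = (\<sigma> * cinner x (e 0)) *\<^sub>C e 0" using x by (simp add: rank_one_def)
    have 2: "resolvent M (restrict X1 M) s (rank_one M (e 0) \<sigma> x) = (\<sigma> * cinner x (e 0)) *\<^sub>C R1"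
      unfolding 1 R1_def by (rule resolvent_scaleC[OF M_csubspace restrict_bounded(1) s e_0_in])
    have 3: "resolvent M (restrict X2 M) l ((\<sigma> * cinner x (e 0)) *\<^sub>C R1) = (\<sigma> * cinner x (e 0)) *\<^sub>C R2"
      unfolding R2_def by (rule resolvent_scaleC[OF M_csubspace restrict_bounded(2) l R1M])
    have "(\<sigma> * cinner x (e 0)) *\<^sub>C R2 \<in> M" using M_csubspace R2M by (simp add: csubspace_def)
    then have 4: "rank_one M (e 0) \<sigma> ((\<sigma> * cinner x (e 0)) *\<^sub>C R2) = (\<sigma> * (\<sigma> * cinner x (e 0) * k)) *\<^sub>C e 0"
      by (simp add: rank_one_def cinner_scaleC_left ip R1V)
    show "x + (1 / \<i>) *\<^sub>C rank_one M (e 0) \<sigma> (resolvent M (restrict X2 M) l (resolvent M (restrict X1 M) s (rank_one M (e 0) \<sigma> x)))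
        = x + rank_one M (e 0) \<kappa> x"
      unfolding 2 3 4 using x by (simp add: rank_one_def \<kappa>_def scaleC_scaleC mult_ac)
  qed
  then have "fredholm_det M (determining_function M (restrict T M) l s) = 1 + \<kappa>"
    using fredholm_det_rank_one[OF M_closed e_0_in X1.norm_e] by simp
  also have "\<dots> = (1 - w * z * cnj c) / (1 - w * z * c)"
  proof -
    have cc: "2 * \<i> * of_real (Im c) = c - cnj c" by (simp add: complex_eq_iff)
    \<comment> \<open>The product a b in the commutator cancels against the normalization 1/(a b) of
      the two resolvent series; 1/\<i> times -2 Im c becomes c - cnj c.\<close>
    have alg: "1 / \<i> * (p * (- 2 * q) * (y / p * (1 / D))) = 2 * \<i> * q * y / D" if "p \<noteq> 0" for p q y D :: complex
      using that by (cases "D = 0") (simp_all add: field_simps)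
    have "\<sigma> * \<sigma> = of_real (- 2 * a * b * Im c)" unfolding \<sigma>_def by (rule signed_root_square)
    also have "\<dots> = of_real (a * b) * (- 2 * of_real (Im c))" by simp
    finally have "\<kappa> = 1 / \<i> * (of_real (a * b) * (- 2 * of_real (Im c)) * (w * z / of_real (a * b) * (1 / (1 - w * z * c))))"
      unfolding \<kappa>_def k_def by (simp only:)
    also have "\<dots> = 2 * \<i> * of_real (Im c) * (w * z) / (1 - w * z * c)"
      by (rule alg) (use X1.a_pos X2.a_pos in simp)
    finally have "\<kappa> = 2 * \<i> * of_real (Im c) * (w * z) / (1 - w * z * c)" .
    then have "\<kappa> = (c - cnj c) * (w * z) / (1 - w * z * c)" unfolding cc .
    then show ?thesis using ne by (simp add: field_simps)
  qed
  finally show ?thesis using w(1-3) z by blast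
qed

lemma nonreal_not_in_spectrum:
  assumes "Im l \<noteq> 0"
  shows "l \<notin> spectrum M (restrict X1 M)" "l \<notin> spectrum M (restrict X2 M)"
  by (rule selfadjoint_nonreal_not_in_spectrum[OF M_closed restrict_bounded(1) _ assms],
      simp add: X1.selfadjoint,
      rule selfadjoint_nonreal_not_in_spectrum[OF M_closed restrict_bounded(2) _ assms],
      simp add: X2.selfadjoint)

lemma principal_function_sine_series:
  assumes r: "0 \<le> r" "r < 1" and c: "c = of_real r * exp (\<i> * complex_of_real \<phi>)"
  shows "principal_function M (restrict T M) (\<lambda>(\<delta>, \<gamma>). sine_series r \<phi> (\<delta> / b) (\<gamma> / a))"
  unfolding principal_function_def real_part imag_part self_commutator prod.case
proof (intro conjI allI impI)
  show "trace_class M (rank_one M (e 0) (of_real (4 * a * b * Im c)))"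
    using X1.a_pos X2.a_pos Im_c by (intro trace_class_rank_one[OF rank_one_facts]) simp
  show "integrable lborel (\<lambda>(\<delta>, \<gamma>). sine_series r \<phi> (\<delta> / b) (\<gamma> / a))"
    by (rule integrable_sine_series[OF r X1.a_pos X2.a_pos])
  fix l s assume "l \<notin> spectrum M (restrict X2 M)" "s \<notin> spectrum M (restrict X1 M)"
  then obtain w z where wz: "w \<noteq> 0" "cmod w < 1" "s = of_real a * (w + 1 / w)"
    "z \<noteq> 0" "cmod z < 1" "l = of_real b * (z + 1 / z)"
    "fredholm_det M (determining_function M (restrict T M) l s) = (1 - w * z * cnj c) / (1 - w * z * c)"
    using determining_function by blast
  note S = sine_series_cauchy_transform[OF r X1.a_pos X2.a_pos wz(1-6), of \<phi>]
  show "integrable lborel (\<lambda>(\<delta>, \<gamma>). complex_of_real (sine_series r \<phi> (\<delta> / b) (\<gamma> / a)) / ((\<delta> - l) * (\<gamma> - s)))"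
    by (rule S(1))
  show "fredholm_det M (determining_function M (restrict T M) l s) = exp (1 / (2 * pi * \<i>) *
      (LINT (\<delta>, \<gamma>)|lborel. complex_of_real (sine_series r \<phi> (\<delta> / b) (\<gamma> / a)) / ((\<delta> - l) * (\<gamma> - s))))"
    unfolding S(2) wz(7) c ..
qed (rule M_closed restrict_bounded completely_non_normal)+

text \<open>Nonreal l and s lie outside both spectra, and the determinant identity at these points
  already determines the function almost everywhere.\<close>

lemma principal_function_unique:
  assumes g: "principal_function M (restrict T M) g1" "principal_function M (restrict T M) g2"
  shows "AE p in lborel. g1 p = g2 p"
proof (rule exp_cauchy_transform_unique)
  show "integrable lborel g1" "integrable lborel g2" using g by (simp_all add: principal_function_def)
  fix l s assume ls: "Im l \<noteq> 0" "Im s \<noteq> 0"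
  have det: "fredholm_det M (determining_function M (restrict T M) l s) =
      exp (1 / (2 * pi * \<i>) * (LINT p|lborel. of_real (g p) * cauchy_kernel l s p))"
    if "principal_function M (restrict T M) g" for g
  proof -
    have "(\<lambda>(\<delta>, \<gamma>). complex_of_real (g (\<delta>, \<gamma>)) / ((\<delta> - l) * (\<gamma> - s))) = (\<lambda>p. of_real (g p) * cauchy_kernel l s p)"
      by (auto simp: fun_eq_iff cauchy_kernel_def)
    then show ?thesis
      using that nonreal_not_in_spectrum(2)[OF ls(1)] nonreal_not_in_spectrum(1)[OF ls(2)]
      unfolding principal_function_def real_part imag_part by simp
  qed
  show "exp (1 / (2 * pi * \<i>) * (LINT p|lborel. of_real (g1 p) * cauchy_kernel l s p)) =
      exp (1 / (2 * pi * \<i>) * (LINT p|lborel. of_real (g2 p) * cauchy_kernel l s p))"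
    using det[OF g(1)] det[OF g(2)] by simp
qed

end

section \<open>Left and right semicircular operators on the full Fock space\<close>

text \<open>Both sequences are normalized tensor powers, of v1 and of v2. Lists of equal letters can
  be extended at either end, so the left and the right operator act on them by the same
  recurrence.\<close>

lemma fock_semicircular_pair:
  fixes tens :: "'h::chilbert_space list \<Rightarrow> 'f::chilbert_space" and v1 v2 :: 'h
  assumes F: "full_fock_space tens" and Im: "Im (cinner v1 v2) \<noteq> 0"
    and less: "cmod (cinner v1 v2 / of_real (norm v1 * norm v2)) < 1"
  defines "X1 \<equiv> \<lambda>x. left_creation tens v1 x + cadjoint UNIV (left_creation tens v1) x"
    and "X2 \<equiv> \<lambda>x. right_creation tens v2 x + cadjoint UNIV (right_creation tens v2) x"
  shows "semicircular_pair X1 (\<lambda>n. of_real (1 / norm v1 ^ n) *\<^sub>C tens (replicate n v1)) (norm v1)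
    X2 (\<lambda>n. of_real (1 / norm v2 ^ n) *\<^sub>C tens (replicate n v2)) (norm v2)
    (cinner v1 v2 / of_real (norm v1 * norm v2))"
proof -
  have v: "v1 \<noteq> 0" "v2 \<noteq> 0" using Im by auto
  note lc = left_creation[OF F] and la = left_annihilation[OF F]
    and rc = right_creation[OF F] and ra = right_annihilation[OF F]
  have X1: "X1 \<in> bounded_ops UNIV" unfolding X1_def by (intro bounded_ops_UNIV_add lc(1) la(1))
  have X2: "X2 \<in> bounded_ops UNIV" unfolding X2_def by (intro bounded_ops_UNIV_add rc(1) ra(1))
  have lin: "X1 (u + u') = X1 u + X1 u'" "X1 (k *\<^sub>C u) = k *\<^sub>C X1 u"
    "X2 (u + u') = X2 u + X2 u'" "X2 (k *\<^sub>C u) = k *\<^sub>C X2 u" for u u' k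
    using bounded_ops_add[OF X1] bounded_ops_scaleC[OF X1]
      bounded_ops_add[OF X2] bounded_ops_scaleC[OF X2] by auto
  have X1_Nil: "X1 (tens []) = tens [v1]" and X1_Cons: "X1 (tens (x # xs)) = tens (v1 # x # xs) + cinner x v1 *\<^sub>C tens xs" for x xs
    by (simp_all add: X1_def lc(2) la(2,3))
  have X2_Nil: "X2 (tens []) = tens [v2]" and X2_snoc: "X2 (tens (xs @ [x])) = tens (xs @ [x, v2]) + cinner x v2 *\<^sub>C tens xs" for x xs
    by (simp_all add: X2_def rc(2) ra(2,3))
  have sa1: "cinner (X1 x) y = cinner x (X1 y)" for x y
  proof -
    have "cinner (left_creation tens v1 x) y = cinner x (cadjoint UNIV (left_creation tens v1) y)"
      using la(4)[of v1 y x] cinner_commute by metis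
    then show ?thesis by (simp add: X1_def cinner_add_left cinner_add_right la(4))
  qed
  have sa2: "cinner (X2 x) y = cinner x (X2 y)" for x y
  proof -
    have "cinner (right_creation tens v2 x) y = cinner x (cadjoint UNIV (right_creation tens v2) y)"
      using ra(4)[of v2 y x] cinner_commute by metis
    then show ?thesis by (simp add: X2_def cinner_add_left cinner_add_right ra(4))
  qed
  have rep: "cinner (tens (replicate m u)) (tens (replicate n u')) = (if m = n then cinner u u' ^ n else 0)" for m n u u'
    by (simp add: fock_cinner[OF F])
  have on: "cinner (of_real (1 / norm u ^ m) *\<^sub>C tens (replicate m u)) (of_real (1 / norm u ^ n) *\<^sub>C tens (replicate n u)) = (if m = n then 1 else 0)"
    if "u \<noteq> 0" for m n u
    using that by (simp add: cinner_scaleC_left cinner_scaleC_right rep cinner_self power2_eq_square power_mult_distrib)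
  have step: "of_real (1 / norm u ^ n) *\<^sub>C y = of_real (norm u) *\<^sub>C of_real (1 / norm u ^ Suc n) *\<^sub>C y"
    "of_real (1 / norm u ^ Suc n) *\<^sub>C cinner u u *\<^sub>C y = of_real (norm u) *\<^sub>C of_real (1 / norm u ^ n) *\<^sub>C y"
    if "u \<noteq> 0" for u :: 'h and n and y :: 'f
    using that by (simp_all add: scaleC_scaleC cinner_self power2_eq_square)
  let ?e = "\<lambda>n. of_real (1 / norm v1 ^ n) *\<^sub>C tens (replicate n v1)"
  let ?f = "\<lambda>n. of_real (1 / norm v2 ^ n) *\<^sub>C tens (replicate n v2)"
  let ?c = "cinner v1 v2 / of_real (norm v1 * norm v2)"
  have S1: "semicircular X1 ?e (norm v1)"
  proof
    show "X1 (?e 0) = of_real (norm v1) *\<^sub>C ?e (Suc 0)"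
      using v by (simp add: X1_Nil scaleC_scaleC)
    show "X1 (?e (Suc n)) = of_real (norm v1) *\<^sub>C (?e (Suc (Suc n)) + ?e n)" for n
    proof -
      have "X1 (?e (Suc n)) = of_real (1 / norm v1 ^ Suc n) *\<^sub>C tens (replicate (Suc (Suc n)) v1)
          + of_real (1 / norm v1 ^ Suc n) *\<^sub>C cinner v1 v1 *\<^sub>C tens (replicate n v1)"
        unfolding lin replicate_Suc X1_Cons scaleC_add_right ..
      then show ?thesis
        unfolding step(1)[OF v(1), of "Suc n" "tens (replicate (Suc (Suc n)) v1)"]
          step(2)[OF v(1), of n "tens (replicate n v1)"] scaleC_add_right[symmetric] .
    qed
  qed (use X1 sa1 v on in auto)
  have S2: "semicircular X2 ?f (norm v2)"
  proof
    show "X2 (?f 0) = of_real (norm v2) *\<^sub>C ?f (Suc 0)"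
      using v by (simp add: X2_Nil scaleC_scaleC)
    show "X2 (?f (Suc n)) = of_real (norm v2) *\<^sub>C (?f (Suc (Suc n)) + ?f n)" for n
    proof -
      have r1: "replicate (Suc n) v2 = replicate n v2 @ [v2]" for n by (simp add: replicate_append_same)
      have r2: "replicate n v2 @ [v2, v2] = replicate (Suc (Suc n)) v2" unfolding r1 by simp
      have "X2 (?f (Suc n)) = of_real (1 / norm v2 ^ Suc n) *\<^sub>C tens (replicate (Suc (Suc n)) v2)
          + of_real (1 / norm v2 ^ Suc n) *\<^sub>C cinner v2 v2 *\<^sub>C tens (replicate n v2)"
        unfolding lin r1[of n] X2_snoc scaleC_add_right r2 ..
      then show ?thesis
        unfolding step(1)[OF v(2), of "Suc n" "tens (replicate (Suc (Suc n)) v2)"]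
          step(2)[OF v(2), of n "tens (replicate n v2)"] scaleC_add_right[symmetric] .
    qed
  qed (use X2 sa2 v on in auto)
  have e0: "?e 0 = tens []" by simp
  \<comment> \<open>The two operators act on opposite ends of a tensor and interfere only on short
    ones. On one letter the contributions still agree; on the vacuum they leave <v2, v1> - <v1,
    v2>.\<close>
  have comm_tens: "X1 (X2 (tens xs)) - X2 (X1 (tens xs)) =
      ((cinner v2 v1 - cinner v1 v2) * cinner (tens xs) (tens [])) *\<^sub>C tens []" for xs
  proof (cases xs)
    case Nil
    have "X2 (tens [v1]) = tens [v1, v2] + cinner v1 v2 *\<^sub>C tens []" using X2_snoc[of "[]" v1] by simp
    then show ?thesis using Nil
      by (simp add: X1_Nil X2_Nil X1_Cons fock_cinner[OF F] scaleC_diff_left)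
  next
    case (Cons x ys)
    have "X1 (X2 (tens xs)) = X2 (X1 (tens xs))"
    proof (cases ys rule: rev_cases)
      case Nil
      have "X2 (tens [x]) = tens [x, v2] + cinner x v2 *\<^sub>C tens []"
        "X2 (tens [v1, x]) = tens [v1, x, v2] + cinner x v2 *\<^sub>C tens [v1]"
        using X2_snoc[of "[]" x] X2_snoc[of "[v1]" x] by simp_all
      then show ?thesis using Nil Cons by (simp add: X1_Nil X1_Cons X2_Nil lin)
    next
      case (snoc zs y)
      have "X2 (tens (x # zs @ [y])) = tens (x # zs @ [y, v2]) + cinner y v2 *\<^sub>C tens (x # zs)"
        "X2 (tens (v1 # x # zs @ [y])) = tens (v1 # x # zs @ [y, v2]) + cinner y v2 *\<^sub>C tens (v1 # x # zs)"
        "X2 (tens (zs @ [y])) = tens (zs @ [y, v2]) + cinner y v2 *\<^sub>C tens zs"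
        using X2_snoc[of "x # zs" y] X2_snoc[of "v1 # x # zs" y] X2_snoc[of zs y] by simp_all
      then show ?thesis using snoc Cons
        by (simp add: X1_Cons lin scaleC_add_right scaleC_scaleC mult.commute)
    qed
    moreover have "cinner (tens xs) (tens []) = 0" using Cons by (simp add: fock_cinner[OF F])
    ultimately show ?thesis by simp
  qed
  have total: "closure (csubspace hull (range tens)) = UNIV" using F by (simp add: full_fock_space_def)
  have comm: "X1 (X2 x) - X2 (X1 x) = ((cinner v2 v1 - cinner v1 v2) * cinner x (tens [])) *\<^sub>C tens []" for x
  proof -
    have "(\<lambda>x. X1 (X2 x) - X2 (X1 x)) = (\<lambda>x. ((cinner v2 v1 - cinner v1 v2) * cinner x (tens [])) *\<^sub>C tens [])"
    proof (rule bounded_ops_UNIV_eqI[where f=tens, OF _ _ _ total])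
      show "X1 (X2 (tens xs)) - X2 (X1 (tens xs)) =
          ((cinner v2 v1 - cinner v1 v2) * cinner (tens xs) (tens [])) *\<^sub>C tens []" for xs
        by (rule comm_tens)
      show "(\<lambda>x. X1 (X2 x) - X2 (X1 x)) \<in> bounded_ops UNIV"
        by (rule bounded_ops_UNIV_I)
          (intro bounded_linear_sub bounded_linear_compose[of X1 X2] bounded_linear_compose[of X2 X1]
            bounded_ops_bounded_linear X1 X2, simp add: lin scaleC_diff_right)
      show "(\<lambda>x. ((cinner v2 v1 - cinner v1 v2) * cinner x (tens [])) *\<^sub>C tens []) \<in> bounded_ops UNIV"
        using rank_one_bounded[of UNIV "tens []" "cinner v2 v1 - cinner v1 v2"]
        by (simp add: rank_one_def csubspace_def restrict_UNIV)
    qed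
    then show ?thesis by (rule fun_cong)
  qed
  show ?thesis
  proof (intro semicircular_pair.intro semicircular_pair_axioms.intro S1 S2)
    show "?f 0 = ?e 0" by simp
    show "cinner (?e m) (?f n) = (if m = n then ?c ^ n else 0)" for m n
      by (simp add: cinner_scaleC_left cinner_scaleC_right rep power_divide power_mult_distrib)
    show "X1 (X2 x) - X2 (X1 x) = (of_real (norm v1 * norm v2) * (cnj ?c - ?c) * cinner x (?e 0)) *\<^sub>C ?e 0" for x
    proof -
      have "of_real (norm v1 * norm v2) * (cnj ?c - ?c) = cinner v2 v1 - cinner v1 v2"
        using v by (simp add: field_simps cinner_commute[of v2 v1])
      then show ?thesis unfolding e0 comm by simp
    qed
    show "cmod ?c < 1" by (rule less)
    show "Im ?c \<noteq> 0" using Im v unfolding Im_divide_of_real by simp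
  qed
qed

section \<open>The principal function\<close>

text \<open>Existence is asserted together with the formula, so that the statement about every
  principal function is not vacuous.\<close>

theorem mainTheorem1:
  fixes tens :: "'h::chilbert_space list \<Rightarrow> 'f::chilbert_space"
    and v1 v2 :: 'h
    and X1 X2 T :: "'f \<Rightarrow> 'f"
    and M :: "'f set"
    and r \<phi> :: real
  assumes fock: "full_fock_space tens"
    and indep: "\<forall>a b. a *\<^sub>C v1 + b *\<^sub>C v2 = 0 \<longrightarrow> a = 0 \<and> b = 0"
    and Im_ne: "Im (cinner v1 v2) \<noteq> 0"
    and X1: "X1 = (\<lambda>x. left_creation tens v1 x + cadjoint UNIV (left_creation tens v1) x)"
    and X2: "X2 = (\<lambda>x. right_creation tens v2 x + cadjoint UNIV (right_creation tens v2) x)"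
    and T: "T = (\<lambda>x. X1 x + \<i> *\<^sub>C X2 x)"
    and M: "M = closure {A (tens []) | A. A \<in> unital_alg {T, cadjoint UNIV T}}"
    and r: "0 < r" "r < 1"
    and polar: "cinner v1 v2 / complex_of_real (norm v1 * norm v2)
                  = complex_of_real r * exp (\<i> * complex_of_real \<phi>)"
  shows "(\<exists>g. principal_function M (restrict T M) g) \<and>
    (\<forall>g. principal_function M (restrict T M) g \<longrightarrow>
      (AE (\<delta>, \<gamma>) in lborel. \<bar>\<gamma>\<bar> \<le> 2 * norm v1 \<and> \<bar>\<delta>\<bar> \<le> 2 * norm v2 \<longrightarrow>
        (let \<theta>1 = theta (\<gamma> / norm v1); \<theta>2 = theta (\<delta> / norm v2) in
          g (\<delta>, \<gamma>) = 1 / pi *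
            (Arg (1 - r * exp (\<i> * complex_of_real (- \<phi> + \<theta>1 + \<theta>2)))
             + Arg (1 - r * exp (\<i> * complex_of_real (\<phi> - \<theta>1 + \<theta>2)))
             - Arg (1 - r * exp (\<i> * complex_of_real (\<phi> + \<theta>1 + \<theta>2)))
             - Arg (1 - r * exp (\<i> * complex_of_real (- \<phi> - \<theta>1 + \<theta>2)))) \<and>
          g (\<delta>, \<gamma>) = 1 / pi *
            (arctan (r * sin (\<phi> - (\<theta>1 + \<theta>2)) / (1 - r * cos (\<phi> - (\<theta>1 + \<theta>2))))
             + arctan (r * sin (\<phi> + (\<theta>1 + \<theta>2)) / (1 - r * cos (\<phi> + (\<theta>1 + \<theta>2))))
             - arctan (r * sin (\<phi> - (\<theta>1 - \<theta>2)) / (1 - r * cos (\<phi> - (\<theta>1 - \<theta>2))))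
             - arctan (r * sin (\<phi> + (\<theta>1 - \<theta>2)) / (1 - r * cos (\<phi> + (\<theta>1 - \<theta>2))))))))"
proof -
  let ?c = "cinner v1 v2 / complex_of_real (norm v1 * norm v2)"
  have ab: "norm v1 > 0" "norm v2 > 0" using Im_ne by auto
  have less: "cmod ?c < 1" unfolding polar using r by (simp add: norm_mult)
  interpret P: semicircular_pair X1 "\<lambda>n. of_real (1 / norm v1 ^ n) *\<^sub>C tens (replicate n v1)" "norm v1"
    X2 "\<lambda>n. of_real (1 / norm v2 ^ n) *\<^sub>C tens (replicate n v2)" "norm v2" ?c
    unfolding X1 X2 by (rule fock_semicircular_pair[OF fock Im_ne less])
  have T_eq: "P.T = T" unfolding T P.T_def[abs_def] ..
  have M_eq: "P.M = M" unfolding M P.M_def T_eq P.cadjoint_T[unfolded T_eq] by simp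
  have r': "0 \<le> r" "r < 1" using r by auto
  let ?g = "\<lambda>(\<delta>, \<gamma>). sine_series r \<phi> (\<delta> / norm v2) (\<gamma> / norm v1)"
  have ex: "principal_function M (restrict T M) ?g"
    using P.principal_function_sine_series[OF r' polar] unfolding T_eq M_eq .
  show ?thesis
  proof (intro conjI allI impI)
    show "\<exists>g. principal_function M (restrict T M) g" by (rule exI[of _ ?g]) (rule ex)
    fix g assume "principal_function M (restrict T M) g"
    then have "AE p in lborel. g p = ?g p"
      using P.principal_function_unique[unfolded T_eq M_eq] ex by blast
    then show "AE (\<delta>, \<gamma>) in lborel. \<bar>\<gamma>\<bar> \<le> 2 * norm v1 \<and> \<bar>\<delta>\<bar> \<le> 2 * norm v2 \<longrightarrow>
        (let \<theta>1 = theta (\<gamma> / norm v1); \<theta>2 = theta (\<delta> / norm v2) in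
          g (\<delta>, \<gamma>) = 1 / pi *
            (Arg (1 - r * exp (\<i> * complex_of_real (- \<phi> + \<theta>1 + \<theta>2)))
             + Arg (1 - r * exp (\<i> * complex_of_real (\<phi> - \<theta>1 + \<theta>2)))
             - Arg (1 - r * exp (\<i> * complex_of_real (\<phi> + \<theta>1 + \<theta>2)))
             - Arg (1 - r * exp (\<i> * complex_of_real (- \<phi> - \<theta>1 + \<theta>2)))) \<and>
          g (\<delta>, \<gamma>) = 1 / pi *
            (arctan (r * sin (\<phi> - (\<theta>1 + \<theta>2)) / (1 - r * cos (\<phi> - (\<theta>1 + \<theta>2))))
             + arctan (r * sin (\<phi> + (\<theta>1 + \<theta>2)) / (1 - r * cos (\<phi> + (\<theta>1 + \<theta>2))))
             - arctan (r * sin (\<phi> - (\<theta>1 - \<theta>2)) / (1 - r * cos (\<phi> - (\<theta>1 - \<theta>2))))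
             - arctan (r * sin (\<phi> + (\<theta>1 - \<theta>2)) / (1 - r * cos (\<phi> + (\<theta>1 - \<theta>2))))))"
    proof (rule eventually_mono)
      fix p assume g: "g p = ?g p"
      obtain \<delta> \<gamma> where p: "p = (\<delta>, \<gamma>)" by (cases p)
      define \<theta>1 where "\<theta>1 = theta (\<gamma> / norm v1)"
      define \<theta>2 where "\<theta>2 = theta (\<delta> / norm v2)"
      let ?Arg = "\<lambda>\<alpha>. Arg (1 - r * exp (\<i> * complex_of_real \<alpha>))"
      let ?atan = "\<lambda>\<alpha>. arctan (r * sin \<alpha> / (1 - r * cos \<alpha>))"
      \<comment> \<open>Oddness of sine and arctangent absorbs the sign of an angle; this regroups
        the four arguments into the arctangent form.\<close>
      have Arg_minus: "?Arg (- \<alpha>) = ?atan \<alpha>" and Arg_plus: "?Arg \<alpha> = - ?atan \<alpha>" for \<alpha>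
        unfolding Arg_one_minus_eq_arctan[OF r'] by (simp_all flip: arctan_minus)
      have angles: "- \<phi> + \<theta>1 + \<theta>2 = - (\<phi> - (\<theta>1 + \<theta>2))" "\<phi> - \<theta>1 + \<theta>2 = \<phi> - (\<theta>1 - \<theta>2)"
        "\<phi> + \<theta>1 + \<theta>2 = \<phi> + (\<theta>1 + \<theta>2)" "- \<phi> - \<theta>1 + \<theta>2 = - (\<phi> + (\<theta>1 - \<theta>2))"
        by simp_all
      have arg: "g (\<delta>, \<gamma>) = 1 / pi * (?Arg (- \<phi> + \<theta>1 + \<theta>2) + ?Arg (\<phi> - \<theta>1 + \<theta>2)
          - ?Arg (\<phi> + \<theta>1 + \<theta>2) - ?Arg (- \<phi> - \<theta>1 + \<theta>2))"
        if "\<bar>\<gamma>\<bar> \<le> 2 * norm v1 \<and> \<bar>\<delta>\<bar> \<le> 2 * norm v2"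
      proof -
        have "\<bar>\<delta> / norm v2\<bar> \<le> 2" "\<bar>\<gamma> / norm v1\<bar> \<le> 2" using that ab by (simp_all add: abs_divide divide_le_eq)
        then show ?thesis
          using g unfolding p \<theta>1_def \<theta>2_def prod.case by (simp only: sine_series_eq[OF r'])
      qed
      have "1 / pi * (?Arg (- \<phi> + \<theta>1 + \<theta>2) + ?Arg (\<phi> - \<theta>1 + \<theta>2) - ?Arg (\<phi> + \<theta>1 + \<theta>2) - ?Arg (- \<phi> - \<theta>1 + \<theta>2))
          = 1 / pi * (?atan (\<phi> - (\<theta>1 + \<theta>2)) + ?atan (\<phi> + (\<theta>1 + \<theta>2)) - ?atan (\<phi> - (\<theta>1 - \<theta>2)) - ?atan (\<phi> + (\<theta>1 - \<theta>2)))"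
        unfolding angles Arg_minus Arg_plus[of "\<phi> - (\<theta>1 - \<theta>2)"] Arg_plus[of "\<phi> + (\<theta>1 + \<theta>2)"] by simp
      note atan = arg[unfolded this]
      show "case p of (\<delta>, \<gamma>) \<Rightarrow> \<bar>\<gamma>\<bar> \<le> 2 * norm v1 \<and> \<bar>\<delta>\<bar> \<le> 2 * norm v2 \<longrightarrow>
        (let \<theta>1 = theta (\<gamma> / norm v1); \<theta>2 = theta (\<delta> / norm v2) in
          g (\<delta>, \<gamma>) = 1 / pi *
            (?Arg (- \<phi> + \<theta>1 + \<theta>2) + ?Arg (\<phi> - \<theta>1 + \<theta>2) - ?Arg (\<phi> + \<theta>1 + \<theta>2) - ?Arg (- \<phi> - \<theta>1 + \<theta>2)) \<and>
          g (\<delta>, \<gamma>) = 1 / pi *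
            (?atan (\<phi> - (\<theta>1 + \<theta>2)) + ?atan (\<phi> + (\<theta>1 + \<theta>2)) - ?atan (\<phi> - (\<theta>1 - \<theta>2)) - ?atan (\<phi> + (\<theta>1 - \<theta>2))))"
        unfolding p prod.case Let_def \<theta>1_def[symmetric] \<theta>2_def[symmetric]
        using arg atan by (intro impI conjI)
    qed
  qed
qed

end
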